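(* Let $d\in\mathbb{N}$ and let $(v^n)$ be a sequence in $\mathcal{V}(d)$. Assume that it is bounded in $H^{1/2}_+$ and that the spectrum of $K_{v^n}^2$ does not depend on $n$. Then the following statements are equivalent: (i) There exists $s_0>\frac12$ such that $(v^n)$ is unbounded in $H^{s_0}_+$. (ii) For every $s>\frac12$, $(v^n)$ is unbounded in $H^s_+$. (iii) There exist a subsequence $(n_k)$ and $v_{\mathrm{bad}}\in\mathcal{V}(d')$, where $d'\le d-1$ if $d$ is even and $d'\leq d-2$ if $d$ is odd, such that $v^{n_k}\rightharpoonup v_{\mathrm{bad}}$ weakly in $H^{1/2}_+$.
   Context: $\mathbb{T}=\mathbb{R}/2\pi\mathbb{Z}$ with normalized measure $dx/2\pi$. $L^2_+$ is the closed subspace of $L^2(\mathbb{T})$ of functions whose Fourier series is supported on nonnegative frequencies; $\Pi:L^2\to L^2_+$ is the orthogonal projection; $H^s_+:=H^s(\mathbb{T})\cap L^2_+$. For $u\in H^{1/2}_+$, $H_u:L^2_+\to L^2_+$, $H_u(h)=\Pi(u\bar h)$, is the (bounded, $\mathbb{C}$-antilinear) Hankel operator, $S$ is multiplication by $e^{ix}$ on $L^2_+$, and $K_u=H_uS$. $K_u^2$ is a compact, nonnegative selfadjoint operator. For $d\in\mathbb{N}$, $\mathcal{V}(d)$ is the set of $u\in H^{1/2}_+$ such that $\operatorname{rk}(H_u)+\operatorname{rk}(K_u)=d$ (its elements are rational functions of $z=e^{ix}$ with no pole in the closed unit disc, hence smooth). *)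

theory Defs
  imports "HOL-Analysis.Analysis"
begin

text \<open>The circle \<open>\<real> / 2\<pi>\<int>\<close> is represented by its fundamental domain \<open>[0, 2\<pi>]\<close> with the
  normalized measure \<open>dx / 2\<pi>\<close>. Functions are total on \<open>\<real>\<close>, but their values outside
  \<open>[0, 2\<pi>]\<close> are invisible to this measure, so no periodicity needs to be required.\<close>

definition circle :: "real measure" where
  "circle = uniform_measure lborel {0..2 * pi}"

definition square_integrable :: "(real \<Rightarrow> complex) \<Rightarrow> bool" where
  "square_integrable f \<longleftrightarrow>
     f \<in> borel_measurable circle \<and> integrable circle (\<lambda>x. (cmod (f x))\<^sup>2)"

definition fourier_fun :: "(real \<Rightarrow> complex) \<Rightarrow> int \<Rightarrow> complex" where
  "fourier_fun f k = (LINT x|circle. f x * cis (- (of_int k * x)))"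

lemma measurable_circle: "borel_measurable circle = borel_measurable borel"
  by (intro measurable_cong_sets) (simp_all add: circle_def)

lemma finite_measure_circle: "finite_measure circle"
  by (rule finite_measureI)
     (simp add: circle_def emeasure_lborel_Icc_eq divide_ennreal)

lemma square_integrable_mult:
  assumes "square_integrable f" "square_integrable g"
  shows "integrable circle (\<lambda>x. f x * g x)"
proof (rule Bochner_Integration.integrable_bound)
  show "integrable circle (\<lambda>x. (cmod (f x))\<^sup>2 + (cmod (g x))\<^sup>2)"
    using assms by (auto simp: square_integrable_def)
  show "(\<lambda>x. f x * g x) \<in> borel_measurable circle"
    using assms by (auto simp: square_integrable_def)
  have "cmod (f x * g x) \<le> norm ((cmod (f x))\<^sup>2 + (cmod (g x))\<^sup>2)" for x
  proof -
    have "0 \<le> (cmod (f x) - cmod (g x))\<^sup>2" "0 \<le> cmod (f x) * cmod (g x)" by simp_all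
    then show ?thesis
      unfolding norm_mult power2_diff real_norm_def by linarith
  qed
  then show "AE x in circle. norm (f x * g x) \<le> norm ((cmod (f x))\<^sup>2 + (cmod (g x))\<^sup>2)"
    by simp
qed

lemma square_integrable_cis: "square_integrable (\<lambda>x. cis (a * x))"
proof -
  interpret finite_measure circle by (rule finite_measure_circle)
  have "(\<lambda>x. cis (a * x)) \<in> borel_measurable circle"
    unfolding measurable_circle by (intro borel_measurable_continuous_onI continuous_intros)
  then show ?thesis by (simp add: square_integrable_def)
qed

lemma square_integrable_cnj: "square_integrable f \<Longrightarrow> square_integrable (\<lambda>x. cnj (f x))"
  by (auto simp: square_integrable_def intro: borel_measurable_continuous_on[OF continuous_on_cnj[OF continuous_on_id]])

lemma square_integrable_cmult: "square_integrable f \<Longrightarrow> square_integrable (\<lambda>x. c * f x)"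
  by (auto simp: square_integrable_def norm_mult power_mult_distrib)

lemma square_integrable_add:
  assumes "square_integrable f" "square_integrable g"
  shows "square_integrable (\<lambda>x. f x + g x)"
proof -
  have "integrable circle (\<lambda>x. (cmod (f x + g x))\<^sup>2)"
  proof (rule Bochner_Integration.integrable_bound)
    show "integrable circle (\<lambda>x. 2 * ((cmod (f x))\<^sup>2 + (cmod (g x))\<^sup>2))"
      using assms by (auto simp: square_integrable_def)
    show "(\<lambda>x. (cmod (f x + g x))\<^sup>2) \<in> borel_measurable circle"
      using assms by (auto simp: square_integrable_def)
    have "(cmod (f x + g x))\<^sup>2 \<le> 2 * ((cmod (f x))\<^sup>2 + (cmod (g x))\<^sup>2)" for x
    proof -
      have "(cmod (f x + g x))\<^sup>2 \<le> (cmod (f x) + cmod (g x))\<^sup>2"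
        by (intro power_mono norm_triangle_ineq) simp
      moreover have "0 \<le> (cmod (f x) - cmod (g x))\<^sup>2" by simp
      ultimately show ?thesis unfolding power2_diff power2_sum by argo
    qed
    then show "AE x in circle. norm ((cmod (f x + g x))\<^sup>2)
        \<le> norm (2 * ((cmod (f x))\<^sup>2 + (cmod (g x))\<^sup>2))" by simp
  qed
  then show ?thesis using assms by (auto simp: square_integrable_def)
qed

lemma integrable_fourier:
  "square_integrable f \<Longrightarrow> integrable circle (\<lambda>x. f x * cis (- (of_int k * x)))"
  using square_integrable_mult[OF _ square_integrable_cis[of "- of_int k"]] by simp

lemma fourier_fun_add:
  assumes "square_integrable f" "square_integrable g"
  shows "fourier_fun (\<lambda>x. f x + g x) k = fourier_fun f k + fourier_fun g k"
  using assms by (simp add: fourier_fun_def distrib_right integrable_fourier)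

lemma fourier_fun_cmult: "fourier_fun (\<lambda>x. c * f x) k = c * fourier_fun f k"
  by (simp add: fourier_fun_def mult.assoc)

lemma fourier_fun_shift: "fourier_fun (\<lambda>x. cis x * f x) k = fourier_fun f (k - 1)"
proof -
  have "cis x * f x * cis (- (of_int k * x)) = f x * cis (- (of_int (k - 1) * x))" for x
    by (simp add: cis_mult mult.assoc mult.left_commute algebra_simps)
  then show ?thesis by (simp only: fourier_fun_def)
qed

definition hardy_fun :: "(real \<Rightarrow> complex) \<Rightarrow> bool" where
  "hardy_fun f \<longleftrightarrow> square_integrable f \<and> (\<forall>k<0. fourier_fun f k = 0)"

definition hardy_rel :: "(real \<Rightarrow> complex) \<Rightarrow> (real \<Rightarrow> complex) \<Rightarrow> bool" where
  "hardy_rel f g \<longleftrightarrow> hardy_fun f \<and> hardy_fun g \<and> (AE x in circle. f x = g x)"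

lemma fourier_fun_cong_AE:
  assumes "square_integrable f" "square_integrable g" "AE x in circle. f x = g x"
  shows "fourier_fun f k = fourier_fun g k"
  unfolding fourier_fun_def
  using assms integrable_fourier[of f k] integrable_fourier[of g k]
  by (intro integral_cong_AE) auto

lemma hardy_fun_zero: "hardy_fun (\<lambda>x. 0)"
  by (simp add: hardy_fun_def square_integrable_def fourier_fun_def)

lemma hardy_fun_add: "hardy_fun f \<Longrightarrow> hardy_fun g \<Longrightarrow> hardy_fun (\<lambda>x. f x + g x)"
  by (simp add: hardy_fun_def square_integrable_add fourier_fun_add)

lemma hardy_fun_cmult: "hardy_fun f \<Longrightarrow> hardy_fun (\<lambda>x. c * f x)"
  by (simp add: hardy_fun_def square_integrable_cmult fourier_fun_cmult)

lemma hardy_fun_shift: "hardy_fun f \<Longrightarrow> hardy_fun (\<lambda>x. cis x * f x)"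
proof -
  assume f: "hardy_fun f"
  have "(\<lambda>x. cis x) \<in> borel_measurable circle"
    using square_integrable_cis[of 1] by (simp add: square_integrable_def)
  then show ?thesis
    using f by (auto simp: hardy_fun_def square_integrable_def fourier_fun_shift norm_mult)
qed

text \<open>\<open>L\<^sup>2\<^sub>+\<close>: classes, modulo equality almost everywhere, of square integrable functions
  whose Fourier coefficients of negative index vanish.\<close>

quotient_type hardy = "real \<Rightarrow> complex" / partial: hardy_rel
proof (rule part_equivpI)
  show "\<exists>f. hardy_rel f f"
    using hardy_fun_zero by (auto simp: hardy_rel_def)
  show "symp hardy_rel"
    by (auto simp: symp_def hardy_rel_def elim: AE_mp)
  show "transp hardy_rel"
    by (auto simp: transp_def hardy_rel_def)
qed

lift_definition fourier :: "hardy \<Rightarrow> int \<Rightarrow> complex" is fourier_fun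
  by (auto simp: hardy_rel_def hardy_fun_def intro!: ext fourier_fun_cong_AE)

instantiation hardy :: ab_group_add
begin

lift_definition zero_hardy :: hardy is "\<lambda>x. 0"
  by (simp add: hardy_rel_def hardy_fun_zero)

lift_definition plus_hardy :: "hardy \<Rightarrow> hardy \<Rightarrow> hardy" is "\<lambda>f g x. f x + g x"
  by (auto simp: hardy_rel_def hardy_fun_add)

lift_definition uminus_hardy :: "hardy \<Rightarrow> hardy" is "\<lambda>f x. - 1 * f x"
  using hardy_fun_cmult[of _ "- 1"] by (auto simp: hardy_rel_def)

definition minus_hardy :: "hardy \<Rightarrow> hardy \<Rightarrow> hardy" where
  "minus_hardy f g = f + - g"

instance
proof
  fix a b c :: hardy
  show "a + b + c = a + (b + c)"
    by transfer (auto simp: hardy_rel_def hardy_fun_add add.assoc)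
  show "a + b = b + a"
    by transfer (auto simp: hardy_rel_def hardy_fun_add add.commute)
  show "0 + a = a"
    by transfer (auto simp: hardy_rel_def)
  show "- a + a = 0"
    by transfer (use hardy_fun_zero in \<open>auto simp: hardy_rel_def\<close>)
  show "a - b = a + - b"
    by (rule minus_hardy_def)
qed

end

lift_definition scaleC :: "complex \<Rightarrow> hardy \<Rightarrow> hardy" is "\<lambda>c f x. c * f x"
  by (auto simp: hardy_rel_def hardy_fun_cmult)

global_interpretation hardy: vector_space scaleC
proof
  fix a b :: complex and x y :: hardy
  show "scaleC a (x + y) = scaleC a x + scaleC a y"
    by transfer (auto simp: hardy_rel_def hardy_fun_cmult hardy_fun_add distrib_left)
  show "scaleC (a + b) x = scaleC a x + scaleC b x"
    by transfer (use hardy_fun_cmult[of _ "_ + _"] in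
        \<open>auto simp: hardy_rel_def hardy_fun_cmult hardy_fun_add distrib_right\<close>)
  show "scaleC a (scaleC b x) = scaleC (a * b) x"
    by transfer (auto simp: hardy_rel_def hardy_fun_cmult mult.assoc)
  show "scaleC 1 x = x"
    by transfer (auto simp: hardy_rel_def)
qed

instantiation hardy :: real_vector
begin

definition scaleR_hardy :: "real \<Rightarrow> hardy \<Rightarrow> hardy" where
  "scaleR_hardy r = scaleC (complex_of_real r)"

instance
  by standard
     (simp_all add: scaleR_hardy_def hardy.scale_right_distrib hardy.scale_left_distrib)

end

text \<open>The real inner product is the real part of \<open>\<langle>f, g\<rangle> = \<integral> f g\<^sup>* dx/2\<pi>\<close>; it induces the
  \<open>L\<^sup>2\<close> norm.\<close>

instantiation hardy :: real_inner
begin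

lift_definition inner_hardy :: "hardy \<Rightarrow> hardy \<Rightarrow> real" is
  "\<lambda>f g. Re (LINT x|circle. f x * cnj (g x))"
proof -
  fix f f' g g' :: "real \<Rightarrow> complex"
  assume "hardy_rel f f'" "hardy_rel g g'"
  then have *: "integrable circle (\<lambda>x. f x * cnj (g x))" "integrable circle (\<lambda>x. f' x * cnj (g' x))"
    "AE x in circle. f x * cnj (g x) = f' x * cnj (g' x)"
    by (auto simp: hardy_rel_def hardy_fun_def intro!: square_integrable_mult square_integrable_cnj)
  then show "Re (LINT x|circle. f x * cnj (g x)) = Re (LINT x|circle. f' x * cnj (g' x))"
    by (intro arg_cong[where f = Re] integral_cong_AE) auto
qed

definition norm_hardy :: "hardy \<Rightarrow> real" where
  "norm_hardy f = sqrt (inner f f)"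

definition sgn_hardy :: "hardy \<Rightarrow> hardy" where
  "sgn_hardy f = f /\<^sub>R norm f"

definition dist_hardy :: "hardy \<Rightarrow> hardy \<Rightarrow> real" where
  "dist_hardy f g = norm (f - g)"

definition uniformity_hardy :: "(hardy \<times> hardy) filter" where
  "uniformity_hardy = (INF e\<in>{0<..}. principal {(x, y). dist x y < e})"

definition open_hardy :: "hardy set \<Rightarrow> bool" where
  "open_hardy U \<longleftrightarrow> (\<forall>x\<in>U. \<forall>\<^sub>F (x', y) in uniformity. x' = x \<longrightarrow> y \<in> U)"

instance
proof
  fix x y z :: hardy and r :: real and U :: "hardy set"
  show "sgn x = x /\<^sub>R norm x" by (rule sgn_hardy_def)
  show "dist x y = norm (x - y)" by (rule dist_hardy_def)
  show "uniformity = (INF e\<in>{0<..}. principal {(x::hardy, y). dist x y < e})"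
    by (rule uniformity_hardy_def)
  show "open U \<longleftrightarrow> (\<forall>x\<in>U. \<forall>\<^sub>F (x', y) in uniformity. x' = x \<longrightarrow> y \<in> U)"
    by (rule open_hardy_def)
  show "norm x = sqrt (inner x x)" by (rule norm_hardy_def)
  have int: "integrable circle (\<lambda>x. f x * cnj (g x))"
    if "hardy_rel f f" "hardy_rel g g" for f g
    using that
    by (auto simp: hardy_rel_def hardy_fun_def intro!: square_integrable_mult square_integrable_cnj)
  show "inner x y = inner y x"
  proof transfer
    fix f g :: "real \<Rightarrow> complex"
    have "(LINT x|circle. f x * cnj (g x)) = (LINT x|circle. cnj (g x * cnj (f x)))"
      by (simp add: mult.commute)
    also have "\<dots> = cnj (LINT x|circle. g x * cnj (f x))"
      by (rule Bochner_Integration.integral_cnj)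
    finally show "Re (LINT x|circle. f x * cnj (g x)) = Re (LINT x|circle. g x * cnj (f x))"
      by simp
  qed
  show "inner (x + y) z = inner x z + inner y z"
    by transfer (simp add: distrib_right int)
  show "inner (r *\<^sub>R x) y = r * inner x y"
    unfolding scaleR_hardy_def by transfer (simp add: mult.assoc)
  have sq: "Re (LINT x|circle. f x * cnj (f x)) = (LINT x|circle. (cmod (f x))\<^sup>2)" for f
    by (simp add: complex_norm_square[symmetric] del: of_real_power)
  show "0 \<le> inner x x"
    by transfer (simp add: sq)
  show "inner x x = 0 \<longleftrightarrow> x = 0"
  proof transfer
    fix f assume f: "hardy_rel f f"
    then have "integrable circle (\<lambda>x. (cmod (f x))\<^sup>2)"
      by (simp add: hardy_rel_def hardy_fun_def square_integrable_def)
    then have "(LINT x|circle. (cmod (f x))\<^sup>2) = 0 \<longleftrightarrow> (AE x in circle. (cmod (f x))\<^sup>2 = 0)"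
      by (intro integral_nonneg_eq_0_iff_AE) auto
    then show "Re (LINT x|circle. f x * cnj (f x)) = 0 \<longleftrightarrow> hardy_rel f (\<lambda>x. 0)"
      using f by (simp add: sq hardy_rel_def hardy_fun_zero)
  qed
qed

end

text \<open>The projector \<open>\<Pi>\<close> onto nonnegative frequencies. On \<open>L\<^sup>2\<close> this is the orthogonal
  projection onto \<open>L\<^sup>2\<^sub>+\<close>. It has to be applied to \<open>u h\<^sup>*\<close> with \<open>u \<in> H\<^sup>1\<^sup>/\<^sup>2\<^sub>+\<close> and
  \<open>h \<in> L\<^sup>2\<^sub>+\<close>, which is integrable but in general not square integrable, and is therefore
  described by truncation of the Fourier series. An element of \<open>L\<^sup>2\<^sub>+\<close> is determined by
  its coefficients; \<open>szego f\<close> is unspecified if the truncated series is not in \<open>L\<^sup>2\<close>,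
  which does not happen for such products.\<close>

definition szego :: "(real \<Rightarrow> complex) \<Rightarrow> hardy" where
  "szego f = (THE g. \<forall>k\<ge>0. fourier g k = fourier_fun f k)"

lift_definition hankel :: "hardy \<Rightarrow> hardy \<Rightarrow> hardy" is
  "\<lambda>u h. szego (\<lambda>x. u x * cnj (h x))"
proof -
  fix u u' h h' :: "real \<Rightarrow> complex"
  assume rel: "hardy_rel u u'" "hardy_rel h h'"
  have "fourier_fun (\<lambda>x. u x * cnj (h x)) k = fourier_fun (\<lambda>x. u' x * cnj (h' x)) k" for k
  proof -
    have cis: "(\<lambda>x. cis (- (of_int k * x))) \<in> borel_measurable circle"
      using square_integrable_cis[of "- of_int k"] by (simp add: square_integrable_def)
    have "integrable circle (\<lambda>x. u x * cnj (h x))" "integrable circle (\<lambda>x. u' x * cnj (h' x))"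
      using rel by (auto simp: hardy_rel_def hardy_fun_def
          intro!: square_integrable_mult square_integrable_cnj)
    from this[THEN borel_measurable_integrable]
    have meas: "(\<lambda>x. u x * cnj (h x)) \<in> borel_measurable circle"
      "(\<lambda>x. u' x * cnj (h' x)) \<in> borel_measurable circle" .
    have "AE x in circle. u x * cnj (h x) = u' x * cnj (h' x)"
      using rel by (auto simp: hardy_rel_def)
    then show ?thesis
      unfolding fourier_fun_def
      by (intro integral_cong_AE meas[THEN borel_measurable_times] cis) auto
  qed
  then show "szego (\<lambda>x. u x * cnj (h x)) = szego (\<lambda>x. u' x * cnj (h' x))"
    by (simp add: szego_def)
qed

lift_definition shift :: "hardy \<Rightarrow> hardy" is "\<lambda>f x. cis x * f x"
  by (auto simp: hardy_rel_def hardy_fun_shift)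

text \<open>\<open>K\<^sub>u = H\<^sub>u S\<close>, where \<open>S\<close> is \<^const>\<open>shift\<close>.\<close>

definition shifted_hankel :: "hardy \<Rightarrow> hardy \<Rightarrow> hardy" where
  "shifted_hankel u = hankel u \<circ> shift"

text \<open>The range of \<open>H\<^sub>u\<close> and of \<open>K\<^sub>u\<close> is a complex subspace although these operators are
  antilinear. The rank is its complex dimension, given by a finite basis, so that an operator
  of infinite rank has no rank in this sense (whereas \<^const>\<open>hardy.dim\<close> would return \<open>0\<close>).\<close>

definition has_rank :: "(hardy \<Rightarrow> hardy) \<Rightarrow> nat \<Rightarrow> bool" where
  "has_rank A r \<longleftrightarrow>
     (\<exists>B. finite B \<and> card B = r \<and> \<not> hardy.dependent B \<and> hardy.span B = range A)"

text \<open>The inverse of \<open>A - z\<close> is automatically complex linear if \<open>A\<close> is, so requiring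
  real linearity through \<^const>\<open>bounded_linear\<close> is enough.\<close>

definition spectrum :: "(hardy \<Rightarrow> hardy) \<Rightarrow> complex set" where
  "spectrum A = {z. \<not> (\<exists>R. bounded_linear R \<and>
     (\<forall>f. R (A f - scaleC z f) = f) \<and> (\<forall>f. A (R f) - scaleC z (R f) = f))}"

text \<open>\<open>H\<^sup>s\<^sub>+ = H\<^sup>s \<inter> L\<^sup>2\<^sub>+\<close> for \<open>s \<ge> 0\<close>. The infinite sum in the norm is \<open>0\<close> by convention when
  it diverges, so \<^term>\<open>sobolev_norm s u\<close> is meaningful for \<^term>\<open>u \<in> sobolev s\<close> only.\<close>

definition sobolev :: "real \<Rightarrow> hardy set" where
  "sobolev s = {u. (\<lambda>k::int. (1 + (of_int k)\<^sup>2) powr s * (cmod (fourier u k))\<^sup>2) summable_on UNIV}"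

definition sobolev_norm :: "real \<Rightarrow> hardy \<Rightarrow> real" where
  "sobolev_norm s u =
     sqrt (\<Sum>\<^sub>\<infinity>k::int. (1 + (of_int k)\<^sup>2) powr s * (cmod (fourier u k))\<^sup>2)"

definition sobolev_bounded :: "real \<Rightarrow> (nat \<Rightarrow> hardy) \<Rightarrow> bool" where
  "sobolev_bounded s v \<longleftrightarrow> (\<forall>n. v n \<in> sobolev s) \<and> (\<exists>C. \<forall>n. sobolev_norm s (v n) \<le> C)"

text \<open>Continuous complex linear functionals on \<open>H\<^sup>s\<^sub>+\<close>; the values of \<open>\<phi>\<close> outside \<open>H\<^sup>s\<^sub>+\<close> play
  no role.\<close>

definition sobolev_functional :: "real \<Rightarrow> (hardy \<Rightarrow> complex) \<Rightarrow> bool" where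
  "sobolev_functional s \<phi> \<longleftrightarrow>
     (\<forall>f\<in>sobolev s. \<forall>g\<in>sobolev s. \<phi> (f + g) = \<phi> f + \<phi> g) \<and>
     (\<forall>c. \<forall>f\<in>sobolev s. \<phi> (scaleC c f) = c * \<phi> f) \<and>
     (\<exists>C. \<forall>f\<in>sobolev s. cmod (\<phi> f) \<le> C * sobolev_norm s f)"

definition sobolev_weakly_converges :: "real \<Rightarrow> (nat \<Rightarrow> hardy) \<Rightarrow> hardy \<Rightarrow> bool" where
  "sobolev_weakly_converges s v w \<longleftrightarrow>
     (\<forall>n. v n \<in> sobolev s) \<and> w \<in> sobolev s \<and>
     (\<forall>\<phi>. sobolev_functional s \<phi> \<longrightarrow> (\<lambda>n. \<phi> (v n)) \<longlonglongrightarrow> \<phi> w)"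

text \<open>The set \<open>\<V>(d)\<close>.\<close>

definition rank_class :: "nat \<Rightarrow> hardy set" where
  "rank_class d = {u \<in> sobolev (1/2).
     \<exists>p q. has_rank (hankel u) p \<and> has_rank (shifted_hankel u) q \<and> p + q = d}"

end

theory Submission
  imports Defs "HOL-Computational_Algebra.Fundamental_Theorem_Algebra" "HOL-Real_Asymp.Real_Asymp"
begin

text \<open>Write \<open>N = d div 2\<close>. Since \<open>K\<^sub>u = S\<^sup>*H\<^sub>u\<close>, the rank of \<open>K\<^sub>u\<close> is \<open>N\<close> for \<open>u \<in> \<V>(d)\<close>, and the
  bound on \<open>d'\<close> says exactly that the rank of \<open>K\<close> drops in the weak limit.

  Weak convergence in \<open>H\<^sup>1\<^sup>/\<^sup>2\<close> gives convergence of all coordinates of \<open>K\<^sub>v h\<close>, so the rank of \<open>K\<close> is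
  lower semicontinuous. If the limit still has rank \<open>N\<close>, images of \<open>N\<close> fixed vectors stay a
  uniformly good basis of the range of \<open>K\<^sub>v\<close>; a fixed power of the backward shift is a strict contraction
  on the range for the limit, hence uniformly along the sequence, so the Fourier coefficients decay
  exponentially at a uniform rate and the sequence is bounded in every \<open>H\<^sup>s\<close>.

  Conversely, a bound in \<open>H\<^sup>s\<close> with \<open>s > 1/2\<close> turns weak into strong convergence in \<open>H\<^sup>1\<^sup>/\<^sup>2\<close>, hence into
  convergence of \<open>K\<close> in operator norm. As the spectrum of \<open>K\<^sup>2\<close> is fixed and finite, \<open>K\<close> is bounded below on its
  range uniformly along the sequence, and therefore no rank can be lost.\<close>

section \<open>Fourier uniqueness\<close>

text \<open>Only a real inner product and the definite description \<open>szego\<close> are given.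
  Uniqueness of Fourier coefficients turns operator identities into identities of coefficients, and
  completeness supplies elements with prescribed coefficients, so that \<open>szego\<close> takes
  its intended value. From then on \<open>H_u\<close> is the matrix \<open>u_{j+k}\<close> and
  \<open>K_u\<close> the matrix \<open>u_{j+k+1}\<close>, applied to conjugated coefficients. The
  obstacle is that weak convergence of symbols gives no convergence of \<open>K\<close> in norm,
  only of each coefficient of \<open>K h\<close> for fixed \<open>h\<close>. Whatever has to pass to
  the limit is therefore measured by functionals that are continuous for coordinatewise convergence.
  The lower bound for \<open>K\<close> on its range comes from a product of at most \<open>N\<close>
  factors \<open>K^2 - l\<close> that annihilates the range. Its constant depends only on
  \<open>N\<close>, on the norm of \<open>K\<close> and on the smallest nonzero modulus in the
  spectrum, which are exactly the data that are uniform along the sequence.\<close>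

definition fourier_null :: "(real \<Rightarrow> complex) \<Rightarrow> bool" where
  "fourier_null f \<longleftrightarrow> square_integrable f \<and> (\<forall>k. fourier_fun f k = 0)"

lemma square_integrable_cis_mult:
  assumes "square_integrable f"
  shows "square_integrable (\<lambda>x. cis (a * x) * f x)"
  using assms square_integrable_cis[of a] by (auto simp: square_integrable_def norm_mult)

lemma integrable_if_square_integrable: "square_integrable f \<Longrightarrow> integrable circle f"
  using integrable_fourier[of f 0] by simp

lemma fourier_fun_cis_mult: "fourier_fun (\<lambda>x. cis (of_int m * x) * f x) k = fourier_fun f (k - m)"
proof -
  have "cis (of_int m * x) * f x * cis (- (of_int k * x)) = f x * cis (- (of_int (k - m) * x))" for x
    by (simp add: cis_mult mult.assoc mult.left_commute algebra_simps)
  then show ?thesis by (simp only: fourier_fun_def)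
qed

lemma fourier_null_closed:
  assumes "fourier_null f" "fourier_null g"
  shows "fourier_null (\<lambda>x. c * f x)" "fourier_null (\<lambda>x. f x + g x)"
    "fourier_null (\<lambda>x. cis (of_int m * x) * f x)"
  using assms unfolding fourier_null_def
  by (auto simp: square_integrable_cmult square_integrable_add fourier_fun_add fourier_fun_cmult
      square_integrable_cis_mult fourier_fun_cis_mult)

text \<open>Multiplication by a character only shifts the Fourier coefficients, so the null
  functions form a module over the trigonometric polynomials, and every real polynomial function
  restricts to one of these on the unit circle.\<close>

lemma fourier_null_polynomial:
  assumes "real_polynomial_function p" "fourier_null f"
  shows "fourier_null (\<lambda>x. complex_of_real (p (cis x)) * f x)"
  using assms
proof (induction p arbitrary: f rule: real_polynomial_function.induct)
  case (linear L)
  interpret L: bounded_linear L by fact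
  have "L (cis x) = L 1 * cos x + L \<i> * sin x" for x
  proof -
    have "cis x = cos x *\<^sub>R 1 + sin x *\<^sub>R \<i>" by (simp add: complex_eq_iff)
    then show ?thesis by (simp only: L.add L.scaleR) simp
  qed
  \<comment> \<open>A real linear form on \<complex> is a combination of cosine and sine on the
    circle, hence of the characters of index 1 and -1.\<close>
  then have "complex_of_real (L (cis x)) * f x =
      ((L 1 - \<i> * L \<i>) / 2) * (cis (of_int 1 * x) * f x) +
      ((L 1 + \<i> * L \<i>) / 2) * (cis (of_int (-1) * x) * f x)" for x
    by (simp add: complex_eq_iff field_simps)
  then show ?case
    by (simp only:) (rule fourier_null_closed(2); rule fourier_null_closed(1); rule fourier_null_closed(3); rule linear)
next
  case (const c)
  then show ?case by (intro fourier_null_closed)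
next
  case (add p q)
  have "complex_of_real (p (cis x) + q (cis x)) * f x =
     complex_of_real (p (cis x)) * f x + complex_of_real (q (cis x)) * f x" for x
    by (simp add: algebra_simps)
  then show ?case using add by (simp only:) (rule fourier_null_closed(2); blast)
next
  case (mult p q)
  have "fourier_null (\<lambda>x. complex_of_real (p (cis x)) * (complex_of_real (q (cis x)) * f x))"
    using mult by blast
  then show ?case by (simp add: mult.assoc)
qed

text \<open>Stone-Weierstrass on the unit circle: replacing \<open>G\<close> by a polynomial within
  \<open>e\<close> changes the integral by at most \<open>e\<close> times the L1 norm of
  \<open>f\<close>, and the integral with the polynomial vanishes. Writing the test function as
  \<open>G (cis x)\<close> makes it periodic.\<close>

lemma fourier_null_continuous:
  fixes G :: "complex \<Rightarrow> real"
  assumes "continuous_on UNIV G" and f: "fourier_null f"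
  shows "(LINT x|circle. complex_of_real (G (cis x)) * f x) = 0"
proof -
  let ?I = "LINT x|circle. complex_of_real (G (cis x)) * f x"
  have fi: "integrable circle f"
    using f by (simp add: fourier_null_def integrable_if_square_integrable)
  have meas: "(\<lambda>x. complex_of_real (H (cis x))) \<in> borel_measurable circle"
    if "continuous_on UNIV H" for H :: "complex \<Rightarrow> real"
    unfolding measurable_circle
    by (intro borel_measurable_continuous_onI continuous_on_of_real
        continuous_on_compose2[OF that] continuous_intros) auto
  have bound: "cmod ?I \<le> e * (LINT x|circle. cmod (f x))" if e: "e > 0" for e
  proof -
    obtain p where p: "real_polynomial_function p" "\<And>z. z \<in> sphere 0 1 \<Longrightarrow> \<bar>G z - p z\<bar> < e"
      using Stone_Weierstrass_real_polynomial_function[of "sphere 0 1" G e] assms(1) e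
      by (auto intro: continuous_on_subset)
    have close: "\<bar>G (cis x) - p (cis x)\<bar> \<le> e" for x
      using p(2)[of "cis x"] by (simp add: less_imp_le)
    have contp: "continuous_on UNIV p"
      using p(1) by (simp add: continuous_on_polymonial_function real_polynomial_function_eq)
    have pf: "fourier_null (\<lambda>x. complex_of_real (p (cis x)) * f x)"
      by (rule fourier_null_polynomial[OF p(1) f])
    then have p0: "(LINT x|circle. complex_of_real (p (cis x)) * f x) = 0"
      by (auto simp: fourier_null_def fourier_fun_def dest: spec[of _ 0])
    have pint: "integrable circle (\<lambda>x. complex_of_real (p (cis x)) * f x)"
      using pf by (simp add: fourier_null_def integrable_if_square_integrable)
    have dint: "integrable circle (\<lambda>x. complex_of_real (G (cis x) - p (cis x)) * f x)"
    proof (rule Bochner_Integration.integrable_bound)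
      show "integrable circle (\<lambda>x. e * cmod (f x))" using fi by simp
      have "continuous_on UNIV (\<lambda>z. G z - p z)" by (intro continuous_intros assms(1) contp)
      from meas[OF this] show "(\<lambda>x. complex_of_real (G (cis x) - p (cis x)) * f x) \<in> borel_measurable circle"
        using fi by (intro borel_measurable_times) auto
      show "AE x in circle. norm (complex_of_real (G (cis x) - p (cis x)) * f x) \<le> norm (e * cmod (f x))"
      proof (rule AE_I2)
        fix x
        show "norm (complex_of_real (G (cis x) - p (cis x)) * f x) \<le> norm (e * cmod (f x))"
          using close[of x] e unfolding norm_mult norm_of_real by (simp add: mult_right_mono)
      qed
    qed
    have "?I = (LINT x|circle. complex_of_real (G (cis x) - p (cis x)) * f x +
        complex_of_real (p (cis x)) * f x)"
      by (simp add: algebra_simps)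
    also have "\<dots> = (LINT x|circle. complex_of_real (G (cis x) - p (cis x)) * f x)"
      by (subst Bochner_Integration.integral_add[OF dint pint]) (simp add: p0)
    also have "cmod \<dots> \<le> (LINT x|circle. e * cmod (f x))"
    proof (rule Bochner_Integration.integral_norm_bound_integral[OF dint])
      show "integrable circle (\<lambda>x. e * cmod (f x))" using fi by simp
      show "norm (complex_of_real (G (cis x) - p (cis x)) * f x) \<le> e * cmod (f x)" for x
        unfolding norm_mult norm_of_real by (intro mult_right_mono close) simp
    qed
    finally show ?thesis by simp
  qed
  have "((\<lambda>e. e * (LINT x|circle. cmod (f x))) \<longlongrightarrow> 0 * (LINT x|circle. cmod (f x))) (at_right 0)"
    by (intro tendsto_intros)
  then have "cmod ?I \<le> 0"
    using bound by (intro tendsto_lowerbound[where F = "at_right 0"])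
      (auto simp: eventually_at_filter)
  then show ?thesis by simp
qed

lemma fourier_null_open:
  fixes U :: "complex set"
  assumes "open U" and f: "fourier_null f"
  shows "(LINT x|circle. indicator U (cis x) *\<^sub>R f x) = 0"
proof (cases "U = UNIV")
  case True
  have "(LINT x|circle. f x) = 0"
    using f by (auto simp: fourier_null_def fourier_fun_def dest: spec[of _ 0])
  then show ?thesis using True by simp
next
  case False
  \<comment> \<open>By openness these functions increase to the indicator of \<open>U\<close>. The
    distance to the empty set is 0 by convention, which is why \<open>U = UNIV\<close> is treated
    apart.\<close>
  define G where "G m z = min 1 (real m * infdist z (- U))" for m z
  have fi: "integrable circle f"
    using f by (simp add: fourier_null_def integrable_if_square_integrable)
  have Gcont: "continuous_on UNIV (G m)" for m
    unfolding G_def by (intro continuous_intros continuous_on_infdist)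
  have G0: "(LINT x|circle. complex_of_real (G m (cis x)) * f x) = 0" for m
    by (rule fourier_null_continuous[OF Gcont f])
  have cisU: "(\<lambda>x. indicator U (cis x) :: real) \<in> borel_measurable circle"
  proof -
    have "cis -` U \<in> sets borel"
      by (intro borel_open open_vimage \<open>open U\<close> continuous_intros)
    then have "(indicator (cis -` U) :: real \<Rightarrow> real) \<in> borel_measurable borel" by simp
    also have "(indicator (cis -` U) :: real \<Rightarrow> real) = (\<lambda>x. indicator U (cis x))"
      by (auto simp: indicator_def)
    finally show ?thesis by (simp add: measurable_circle)
  qed
  have "(\<lambda>m. LINT x|circle. complex_of_real (G m (cis x)) * f x) \<longlonglongrightarrow>
      (LINT x|circle. indicator U (cis x) *\<^sub>R f x)"
  proof (rule integral_dominated_convergence[where w = "\<lambda>x. cmod (f x)"])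
    show "(\<lambda>x. indicator U (cis x) *\<^sub>R f x) \<in> borel_measurable circle"
      using fi cisU by (intro borel_measurable_scaleR) auto
    show "(\<lambda>x. complex_of_real (G m (cis x)) * f x) \<in> borel_measurable circle" for m
    proof (intro borel_measurable_times)
      show "(\<lambda>x. complex_of_real (G m (cis x))) \<in> borel_measurable circle"
        unfolding measurable_circle
        by (intro borel_measurable_continuous_onI continuous_on_of_real
            continuous_on_compose2[OF Gcont] continuous_intros) auto
    qed (use fi in simp)
    show "integrable circle (\<lambda>x. cmod (f x))" using fi by simp
    show "AE x in circle. norm (complex_of_real (G m (cis x)) * f x) \<le> cmod (f x)" for m
    proof (rule AE_I2)
      fix x
      have "0 \<le> G m (cis x)" "G m (cis x) \<le> 1" by (simp_all add: G_def infdist_nonneg)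
      then show "norm (complex_of_real (G m (cis x)) * f x) \<le> cmod (f x)"
        unfolding norm_mult norm_of_real by (intro mult_left_le_one_le) auto
    qed
    have "(\<lambda>m. G m z) \<longlonglongrightarrow> indicator U z" for z
    proof (cases "z \<in> U")
      case True
      have "infdist z (- U) > 0"
        using True False \<open>open U\<close>
        by (metis Compl_UNIV_eq ComplD closed_Compl double_complement in_closed_iff_infdist_zero infdist_nonneg
            order_less_le)
      then have "filterlim (\<lambda>m. real m * infdist z (- U)) at_top sequentially"
        by (intro filterlim_at_top_mult_tendsto_pos[OF tendsto_const] filterlim_real_sequentially) auto
      then have "eventually (\<lambda>m. real m * infdist z (- U) \<ge> 1) sequentially"
        by (simp add: filterlim_at_top)
      then have "eventually (\<lambda>m. indicator U z = G m z) sequentially"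
        by eventually_elim (use True in \<open>simp add: G_def\<close>)
      then show ?thesis by (rule Lim_transform_eventually[OF tendsto_const])
    next
      case False
      then show ?thesis by (simp add: G_def)
    qed
    then show "AE x in circle. (\<lambda>m. complex_of_real (G m (cis x)) * f x) \<longlonglongrightarrow> indicator U (cis x) *\<^sub>R f x"
      unfolding scaleR_conv_of_real by (intro AE_I2 tendsto_intros)
  qed
  then show ?thesis using G0 by (simp add: LIMSEQ_unique)
qed

section \<open>Arcs of the circle and intervals of the period\<close>

lemma AE_circle: "AE x in circle. x \<in> {0..2 * pi}"
  unfolding circle_def by (rule AE_uniform_measureI) auto

lemma sets_circle [simp]: "sets circle = sets borel" and space_circle [simp]: "space circle = UNIV"
  by (simp_all add: circle_def)

text \<open>The cosine decreases with the angular distance from the midpoint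
  \<open>(a + b) / 2\<close>, so an arc is cut out of the circle by an open half plane. A distance
  \<open>t\<close> above \<open>pi\<close> stands for the angle \<open>2 * pi - t\<close>, which is
  still at least the half width because \<open>x\<close>, \<open>a\<close> and \<open>b\<close> lie
  in one period.\<close>

lemma cos_gt_iff_arc:
  assumes "0 \<le> a" "a < b" "b \<le> 2 * pi" "x \<in> {0..2 * pi}"
  shows "cos (x - (a + b) / 2) > cos ((b - a) / 2) \<longleftrightarrow> x \<in> {a<..<b}"
proof -
  define t where "t = \<bar>x - (a + b) / 2\<bar>"
  define w where "w = (b - a) / 2"
  have w: "0 \<le> w" "w \<le> pi" using assms by (auto simp: w_def)
  have cost: "cos (x - (a + b) / 2) = cos t" by (simp add: t_def)
  have xt: "x \<in> {a<..<b} \<longleftrightarrow> t < w" unfolding t_def w_def by (auto simp: abs_if field_simps)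
  show ?thesis
  proof (cases "t \<le> pi")
    case True
    have "cos w < cos t \<longleftrightarrow> t < w"
      by (rule cos_mono_less_eq) (use True w in \<open>auto simp: t_def\<close>)
    then show ?thesis unfolding xt cost w_def[symmetric] .
  next
    case False
    have "cos t = cos (2 * pi - t)" by (simp add: cos_diff)
    moreover have "2 * pi - t \<le> pi" "w \<le> 2 * pi - t"
      using assms False by (auto simp: t_def w_def abs_if field_simps)
    ultimately have "cos t \<le> cos w" using w cos_monotone_0_pi_le[of w "2 * pi - t"] by simp
    moreover have "\<not> t < w" using False w by simp
    ultimately show ?thesis unfolding xt cost w_def[symmetric] by simp
  qed
qed

lemma borel_real_eq_intervals: "sets borel = sigma_sets UNIV (range (\<lambda>(a, b). {a <..< b::real}))"
  by (subst borel_eq_box) (simp add: case_prod_unfold)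

text \<open>Open intervals are stable under intersection and generate the Borel sets, so it suffices
  that \<open>f\<close> integrates to 0 over each of them. Inside the period an interval is the
  preimage under \<open>cis\<close> of an open half plane, where \<open>fourier_null_open\<close>
  applies.\<close>

lemma fourier_null_AE_zero:
  assumes f: "fourier_null f"
  shows "AE x in circle. f x = 0"
proof (rule sigma_finite_measure.density_zero)
  show "sigma_finite_measure circle"
    using finite_measure_circle by (rule finite_measure.axioms)
next
  show fi: "integrable circle f"
    using f by (simp add: fourier_null_def integrable_if_square_integrable)
  have setint: "set_integrable circle A f" if "A \<in> sets borel" for A
    using that fi unfolding set_integrable_def by (intro integrable_mult_indicator) auto
  have full: "(LINT x|circle. f x) = 0"
    using f by (auto simp: fourier_null_def fourier_fun_def dest: spec[of _ 0])
  fix A assume "A \<in> sets circle"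
  then have A: "A \<in> sigma_sets UNIV (range (\<lambda>(a, b). {a <..< b::real}))"
    by (simp add: borel_real_eq_intervals)
  have Int: "Int_stable (range (\<lambda>(a, b). {a <..< b::real}))"
  proof (rule Int_stableI)
    fix A B assume "A \<in> range (\<lambda>(a, b). {a <..< b::real})" "B \<in> range (\<lambda>(a, b). {a <..< b::real})"
    then obtain a b c d where "A = {a<..<b}" "B = {c<..<d}" by auto
    then have "A \<inter> B = {max a c<..<min b d}" by auto
    then show "A \<inter> B \<in> range (\<lambda>(a, b). {a <..< b::real})" by auto
  qed
  have Pow: "range (\<lambda>(a, b). {a <..< b::real}) \<subseteq> Pow UNIV" by simp
  from Int Pow A show "set_lebesgue_integral circle A f = 0"
  proof (induction rule: sigma_sets_induct_disjoint)
    case (basic A)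
    then obtain a b :: real where A: "A = {a<..<b}" by auto
    define a' b' where "a' = max a 0" and "b' = min b (2 * pi)"
    \<comment> \<open>Clipping changes the interval only outside the period or at its endpoints 0
      and \<open>2 * pi\<close>, on a null set of \<open>circle\<close>.\<close>
    have ae: "AE x in circle. x \<in> {a<..<b} \<longleftrightarrow> x \<in> {a'<..<b'}"
    proof -
      have "AE x in lborel. x \<noteq> 0 \<and> x \<noteq> 2 * pi" by (intro AE_conjI AE_lborel_singleton)
      then have "AE x in circle. x \<noteq> 0 \<and> x \<noteq> 2 * pi"
        unfolding circle_def by (intro AE_uniform_measureI) auto
      with AE_circle show ?thesis
        by eventually_elim (auto simp: a'_def b'_def)
    qed
    show ?case
    proof (cases "a' < b'")
      case False
      then have "AE x in circle. indicator A x *\<^sub>R f x = 0"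
        using ae by (auto simp: A)
      then show ?thesis unfolding set_lebesgue_integral_def by (rule integral_eq_zero_AE)
    next
      case True
      define U where "U = {z. Re (z * cis (- ((a' + b') / 2))) > cos ((b' - a') / 2)}"
      have "open U" unfolding U_def by (intro open_Collect_less continuous_intros)
      have mem: "cis x \<in> U \<longleftrightarrow> cos (x - (a' + b') / 2) > cos ((b' - a') / 2)" for x
        unfolding U_def mem_Collect_eq cis_mult by simp
      have "AE x in circle. indicator A x *\<^sub>R f x = indicator U (cis x) *\<^sub>R f x"
        using ae AE_circle
      proof eventually_elim
        case (elim x)
        have "cis x \<in> U \<longleftrightarrow> x \<in> {a'<..<b'}"
          unfolding mem by (rule cos_gt_iff_arc) (use True elim in \<open>auto simp: a'_def b'_def\<close>)
        then show ?case using elim by (simp add: A indicator_def)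
      qed
      moreover have "(\<lambda>x. indicator U (cis x) *\<^sub>R f x) \<in> borel_measurable circle"
      proof -
        have "cis -` U \<in> sets borel"
          by (intro borel_open open_vimage \<open>open U\<close> continuous_intros)
        then have "(\<lambda>x. indicator (cis -` U) x *\<^sub>R f x) \<in> borel_measurable circle"
          using fi by (intro borel_measurable_scaleR borel_measurable_indicator) auto
        then show ?thesis by (simp add: indicator_def vimage_def)
      qed
      ultimately have "set_lebesgue_integral circle A f = (LINT x|circle. indicator U (cis x) *\<^sub>R f x)"
        using setint[of A] unfolding set_lebesgue_integral_def set_integrable_def
        by (intro integral_cong_AE) (auto simp: A)
      then show ?thesis using fourier_null_open[OF \<open>open U\<close> f] by simp
    qed
  next
    case empty
    show ?case by (simp add: set_lebesgue_integral_def)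
  next
    case (compl A)
    then have A: "A \<in> sets borel" by (simp add: borel_real_eq_intervals)
    have "(LINT x:UNIV|circle. f x) = (LINT x:A|circle. f x) + (LINT x:UNIV - A|circle. f x)"
      by (subst set_integral_Un[symmetric]) (use A setint in auto)
    then show ?case using compl full by (simp add: set_lebesgue_integral_def)
  next
    case (union A)
    then have A: "A i \<in> sets borel" for i by (auto simp: borel_real_eq_intervals)
    have "(LINT x:(\<Union>i. A i)|circle. f x) = (\<Sum>i. LINT x:A i|circle. f x)"
      by (rule lebesgue_integral_countable_add)
        (use A union setint in \<open>auto simp: disjoint_family_on_def\<close>)
    then show ?case using union by simp
  qed
qed

section \<open>The Hardy space as a Hilbert space\<close>

lemma circle_density: "circle = density lborel (\<lambda>x. ennreal (indicator {0..2 * pi} x / (2 * pi)))"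
  unfolding circle_def uniform_measure_def
  by (intro density_cong)
    (auto simp: indicator_def emeasure_lborel_Icc_eq divide_ennreal simp flip: ennreal_1)

lemma integral_circle:
  fixes f :: "real \<Rightarrow> complex"
  assumes "f \<in> borel_measurable borel"
  shows "(LINT x|circle. f x) = (LINT x|lborel. indicator {0..2 * pi} x *\<^sub>R f x) / (2 * pi)"
proof -
  have "(LINT x|circle. f x) = (LINT x|lborel. (indicator {0..2 * pi} x / (2 * pi)) *\<^sub>R f x)"
    unfolding circle_density using assms by (intro integral_density) auto
  also have "\<dots> = (LINT x|lborel. (1 / (2 * pi)) *\<^sub>R (indicator {0..2 * pi} x *\<^sub>R f x))"
    by (intro Bochner_Integration.integral_cong) auto
  finally show ?thesis by (simp add: scaleR_conv_of_real)
qed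

lemma integral_circle_cis:
  "(LINT x|circle. cis (of_int m * x)) = (if m = 0 then 1 else 0)"
proof -
  have meas: "(\<lambda>x. cis (of_int m * x)) \<in> borel_measurable borel"
    by (intro borel_measurable_continuous_onI continuous_intros)
  show ?thesis
  proof (cases "m = 0")
    case True
    interpret finite_measure circle by (rule finite_measure_circle)
    have "measure circle UNIV = 1"
      unfolding circle_def by (subst measure_uniform_measure) (auto simp: emeasure_lborel_Icc_eq)
    then show ?thesis using True by simp
  next
    case False
    let ?F = "\<lambda>x::real. cis (of_int m * x) / (\<i> * of_int m)"
    have "(LINT x|lborel. indicator {0..2 * pi} x *\<^sub>R cis (of_int m * x)) = ?F (2 * pi) - ?F 0"
    proof (rule integral_FTC_Icc)
      show "(?F has_vector_derivative cis (of_int m * x)) (at x within {0..2 * pi})" for x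
      proof -
        have "((\<lambda>z. exp (\<i> * of_int m * z) / (\<i> * of_int m)) has_field_derivative
            exp (\<i> * of_int m * of_real x)) (at (of_real x))"
          using False by (auto intro!: derivative_eq_intros)
        from has_vector_derivative_real_field[OF this] show ?thesis
          by (simp add: cis_conv_exp mult.assoc)
      qed
      show "continuous_on {0..2 * pi} (\<lambda>x. cis (of_int m * x))"
        by (intro continuous_intros)
    qed simp
    also have "cis (of_int m * (2 * pi)) = 1"
      using cis_multiple_2pi[of "of_int m"] by (simp add: mult.commute mult.left_commute)
    finally show ?thesis using False meas by (subst integral_circle) auto
  qed
qed

lemma fourier_fun_cis: "fourier_fun (\<lambda>x. cis (of_int m * x)) k = (if k = m then 1 else 0)"
proof -
  have "cis (of_int m * x) * cis (- (of_int k * x)) = cis (of_int (m - k) * x)" for x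
    by (simp add: cis_mult algebra_simps)
  then show ?thesis by (simp only: fourier_fun_def integral_circle_cis) auto
qed

lift_definition basis_fun :: "nat \<Rightarrow> hardy" is "\<lambda>k x. cis (of_int (int k) * x)"
  unfolding hardy_rel_def hardy_fun_def
  using square_integrable_cis by (auto simp only: fourier_fun_cis square_integrable_cis) auto

lemma fourier_basis_fun: "fourier (basis_fun k) j = (if j = int k then 1 else 0)"
  by transfer (rule fourier_fun_cis)

lemma fourier_add [simp]: "fourier (f + g) k = fourier f k + fourier g k"
  by transfer (simp add: hardy_rel_def hardy_fun_def fourier_fun_add)

lemma fourier_scaleC [simp]: "fourier (scaleC c f) k = c * fourier f k"
  by transfer (rule fourier_fun_cmult)

lemma fourier_zero [simp]: "fourier 0 k = 0"
  using fourier_scaleC[of 0 0 k] by simp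

lemma fourier_uminus [simp]: "fourier (- f) k = - fourier f k"
  by (metis add.right_inverse add_eq_0_iff fourier_add fourier_zero)

lemma fourier_diff [simp]: "fourier (f - g) k = fourier f k - fourier g k"
  by (metis add_uminus_conv_diff fourier_add fourier_uminus)

lemma fourier_sum [simp]: "fourier (\<Sum>i\<in>I. f i) k = (\<Sum>i\<in>I. fourier (f i) k)"
  by (induction I rule: infinite_finite_induct) auto

lemma fourier_neg: "k < 0 \<Longrightarrow> fourier f k = 0"
  by transfer (simp add: hardy_rel_def hardy_fun_def)

lemma fourier_shift: "fourier (shift f) k = fourier f (k - 1)"
  by transfer (rule fourier_fun_shift)

lemma fourier_eq_0_imp:
  assumes "\<And>k. fourier f (int k) = 0"
  shows "f = 0"
proof -
  have "\<And>k. fourier f k = 0"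
    by (metis assms fourier_neg linorder_not_less zero_le_imp_eq_int)
  then show ?thesis
  proof transfer
    fix f assume f: "hardy_rel f f" and 0: "\<And>k. fourier_fun f k = 0"
    then have "fourier_null f" by (simp add: fourier_null_def hardy_rel_def hardy_fun_def)
    from fourier_null_AE_zero[OF this] show "hardy_rel f (\<lambda>x. 0)"
      using f by (simp add: hardy_rel_def hardy_fun_zero)
  qed
qed

text \<open>The extensionality rule by which identities between Hankel operators are checked, one
  coefficient of nonnegative index at a time.\<close>

lemma hardy_eqI:
  assumes "\<And>k. fourier f (int k) = fourier g (int k)"
  shows "f = g"
  using fourier_eq_0_imp[of "f - g"] assms by simp

lemma norm_hardy_sq:
  assumes "hardy_fun f"
  shows "(norm (abs_hardy f))\<^sup>2 = (LINT x|circle. (cmod (f x))\<^sup>2)"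
proof -
  have "hardy_rel f f" using assms by (simp add: hardy_rel_def)
  then have "(norm (abs_hardy f))\<^sup>2 = Re (LINT x|circle. f x * cnj (f x))"
    by (simp add: power2_norm_eq_inner inner_hardy.abs_eq)
  also have "\<dots> = (LINT x|circle. (cmod (f x))\<^sup>2)"
    by (simp add: complex_norm_square[symmetric] del: of_real_power)
  finally show ?thesis .
qed

lemma abs_hardy_diff:
  assumes "hardy_fun f" "hardy_fun g"
  shows "abs_hardy f - abs_hardy g = abs_hardy (\<lambda>x. f x - g x)" "hardy_fun (\<lambda>x. f x - g x)"
proof -
  have "hardy_rel f f" "hardy_rel g g" "hardy_rel (\<lambda>x. - 1 * g x) (\<lambda>x. - 1 * g x)"
    using assms hardy_fun_cmult[of g "- 1"] by (simp_all add: hardy_rel_def)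
  then show "abs_hardy f - abs_hardy g = abs_hardy (\<lambda>x. f x - g x)"
    unfolding minus_hardy_def
    by (simp add: plus_hardy.abs_eq uminus_hardy.abs_eq)
  show "hardy_fun (\<lambda>x. f x - g x)"
    using hardy_fun_add[OF assms(1) hardy_fun_cmult[OF assms(2), of "- 1"]] by simp
qed

lemma abs_rep_hardy: "abs_hardy (rep_hardy x) = x" "hardy_fun (rep_hardy x)"
  using Quotient_hardy by (auto simp: Quotient_def hardy_rel_def)

lemma inner_basis_fun: "inner f (basis_fun k) = Re (fourier f (int k))"
  by transfer (simp add: fourier_fun_def cis_cnj)

lemma inner_scaleC: "inner f (scaleC c g) = inner (scaleC (cnj c) f) g"
  by transfer (auto intro!: arg_cong[where f = Re] Bochner_Integration.integral_cong)

lemma scaleR_hardy_eq: "r *\<^sub>R (f::hardy) = scaleC (complex_of_real r) f"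
  by (simp add: scaleR_hardy_def)

lemma norm_scaleC [simp]: "norm (scaleC c f) = cmod c * norm f"
proof -
  have "inner (scaleC c f) (scaleC c f) = inner (scaleC (complex_of_real ((cmod c)\<^sup>2)) f) f"
    by (simp add: inner_scaleC complex_norm_square mult.commute del: of_real_power)
  also have "\<dots> = (cmod c)\<^sup>2 * inner f f"
    by (simp only: scaleR_hardy_eq[symmetric] inner_scaleR_left)
  finally show ?thesis by (simp add: norm_eq_sqrt_inner real_sqrt_mult)
qed

lemma norm_basis_fun [simp]: "norm (basis_fun k) = 1"
  by (simp add: norm_eq_sqrt_inner inner_basis_fun fourier_basis_fun)

lemma norm_fourier_le: "cmod (fourier f k) \<le> norm f"
proof (cases "k < 0")
  case True
  then show ?thesis by (simp add: fourier_neg)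
next
  case False
  then obtain j where j: "k = int j" by (metis nonneg_int_cases not_less)
  let ?a = "fourier f (int j)"
  \<comment> \<open>The real inner product sees only real parts; testing against the character
    multiplied by the coefficient itself recovers the full modulus.\<close>
  have "inner f (scaleC ?a (basis_fun j)) = (cmod ?a)\<^sup>2"
    by (simp only: inner_scaleC inner_basis_fun fourier_scaleC)
      (simp add: cmod_power2, simp add: power2_eq_square)
  moreover have "inner f (scaleC ?a (basis_fun j)) \<le> norm f * cmod ?a"
    using norm_cauchy_schwarz[of f "scaleC ?a (basis_fun j)"] by simp
  ultimately have "cmod ?a * cmod ?a \<le> norm f * cmod ?a" by (simp add: power2_eq_square)
  then show ?thesis unfolding j by (metis mult_right_le_imp_le norm_ge_zero less_eq_real_def)
qed

lemma bounded_linear_fourier: "bounded_linear (\<lambda>f. fourier f k)"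
  by (rule bounded_linear_intro[where K = 1])
    (auto simp: scaleR_hardy_eq scaleR_conv_of_real norm_fourier_le)

section \<open>Completeness of the Hardy space\<close>

lemma measure_circle: "measure circle UNIV = 1"
  unfolding circle_def by (subst measure_uniform_measure) (auto simp: emeasure_lborel_Icc_eq)

text \<open>Meant for functions not yet known to lie in the Hardy space. The pointwise bound
  \<open>|g| <= c/2 + |g|^2/(2c)\<close>, integrated against a probability measure, turns the L2
  bound into an L1 bound.\<close>

lemma norm_fourier_fun_le:
  assumes g: "square_integrable g" and c: "c > 0" and le: "(LINT x|circle. (cmod (g x))\<^sup>2) \<le> c\<^sup>2"
  shows "cmod (fourier_fun g k) \<le> c"
proof -
  interpret finite_measure circle by (rule finite_measure_circle)
  have int: "integrable circle (\<lambda>x. cmod (g x))" "integrable circle (\<lambda>x. (cmod (g x))\<^sup>2)"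
    using g by (auto simp: square_integrable_def intro: integrable_if_square_integrable[OF g])
  have pt: "cmod (g x) \<le> c / 2 + (cmod (g x))\<^sup>2 / (2 * c)" for x
  proof -
    have "0 \<le> (cmod (g x) - c)\<^sup>2 / (2 * c)" using c by simp
    also have "\<dots> = (cmod (g x))\<^sup>2 / (2 * c) - cmod (g x) + c / 2"
      using c by (simp add: power2_eq_square field_simps)
    finally show ?thesis by simp
  qed
  have "cmod (fourier_fun g k) \<le> (LINT x|circle. cmod (g x * cis (- (of_int k * x))))"
    unfolding fourier_fun_def by (rule integral_norm_bound)
  also have "\<dots> = (LINT x|circle. cmod (g x))"
    by (simp only: norm_mult norm_cis mult_1_right)
  also have "\<dots> \<le> (LINT x|circle. c / 2 + (cmod (g x))\<^sup>2 / (2 * c))"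
    by (rule Bochner_Integration.integral_mono) (use int pt in auto)
  also have "\<dots> = c / 2 + (LINT x|circle. (cmod (g x))\<^sup>2) / (2 * c)"
    by (subst Bochner_Integration.integral_add) (use int in \<open>auto simp: measure_circle\<close>)
  also have "\<dots> \<le> c / 2 + c\<^sup>2 / (2 * c)"
    by (intro add_left_mono divide_right_mono le) (use c in auto)
  also have "\<dots> = c" using c by (simp add: power2_eq_square)
  finally show ?thesis .
qed

text \<open>The differences have summable L1 norms, so representatives converge almost everywhere;
  Fatou's lemma then bounds the L2 distance from the limit to each term. The same distances control
  the negative coefficients of the limit, which therefore vanish.\<close>

lemma Riesz_Fischer_fast:
  fixes X :: "nat \<Rightarrow> hardy"
  assumes fast: "\<And>j. norm (X (Suc j) - X j) \<le> (1/2) ^ j"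
  shows "\<exists>x. X \<longlonglongrightarrow> x"
proof -
  interpret finite_measure circle by (rule finite_measure_circle)
  define F where "F j = rep_hardy (X j)" for j
  have F: "hardy_fun (F j)" "abs_hardy (F j) = X j" for j
    by (simp_all add: F_def abs_rep_hardy)
  have sq: "square_integrable (\<lambda>x. F i x - F j x)" for i j
    using abs_hardy_diff(2)[OF F(1) F(1)] by (simp add: hardy_fun_def)
  have meas [measurable]: "F j \<in> borel_measurable circle" for j
    using F(1) by (simp add: hardy_fun_def square_integrable_def)
  have normF: "(norm (X i - X j))\<^sup>2 = (LINT x|circle. (cmod (F i x - F j x))\<^sup>2)" for i j
    using norm_hardy_sq[OF abs_hardy_diff(2)[OF F(1) F(1)]] by (simp add: abs_hardy_diff(1)[OF F(1) F(1), symmetric] F)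
  have int: "integrable circle (\<lambda>x. (cmod (F i x - F j x))\<^sup>2)" for i j
    using sq by (simp add: square_integrable_def)
  have nnF: "(\<integral>\<^sup>+x. ennreal ((cmod (F i x - F j x))\<^sup>2) \<partial>circle) = ennreal ((norm (X i - X j))\<^sup>2)" for i j
    unfolding normF by (intro nn_integral_eq_integral int) auto
  have em1: "emeasure circle UNIV = 1" using measure_circle by (simp add: emeasure_eq_measure)
  define G where "G j x = cmod (F (Suc j) x - F j x)" for j x
  have Gint: "(\<integral>\<^sup>+x. ennreal (G j x) \<partial>circle) \<le> ennreal ((1/2) ^ j)" for j
  proof -
    \<comment> \<open>Arithmetic-geometric mean with the weight \<open>2^j\<close>, chosen so that
      an L2 norm of size \<open>(1/2)^j\<close> gives an L1 norm of the same size.\<close>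
    have le: "G j x \<le> (1/2) ^ j / 2 + 2 ^ j / 2 * (cmod (F (Suc j) x - F j x))\<^sup>2" for x
    proof -
      have "0 \<le> 2 ^ j * (G j x - (1/2) ^ j)\<^sup>2" by simp
      also have "\<dots> = 2 ^ j * (G j x)\<^sup>2 - 2 * G j x + (1/2) ^ j"
        by (simp add: power2_eq_square algebra_simps power_divide)
      finally show ?thesis by (simp add: G_def)
    qed
    have "(\<integral>\<^sup>+x. ennreal (G j x) \<partial>circle)
        \<le> (\<integral>\<^sup>+x. ennreal ((1/2) ^ j / 2) + ennreal (2 ^ j / 2) * ennreal ((cmod (F (Suc j) x - F j x))\<^sup>2) \<partial>circle)"
      by (intro nn_integral_mono) (use le in \<open>auto simp flip: ennreal_mult ennreal_plus intro!: ennreal_leI\<close>)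
    also have "\<dots> = ennreal ((1/2) ^ j / 2) + ennreal (2 ^ j / 2) * ennreal ((norm (X (Suc j) - X j))\<^sup>2)"
      by (subst nn_integral_add) (auto simp: nn_integral_cmult nnF em1)
    also have "\<dots> = ennreal ((1/2) ^ j / 2 + 2 ^ j / 2 * (norm (X (Suc j) - X j))\<^sup>2)"
      by (simp flip: ennreal_mult ennreal_plus)
    also have "\<dots> \<le> ennreal ((1/2) ^ j / 2 + 2 ^ j / 2 * ((1/2) ^ j)\<^sup>2)"
      by (intro ennreal_leI add_left_mono mult_left_mono power_mono fast) auto
    also have "(1/2) ^ j / 2 + 2 ^ j / 2 * ((1/2) ^ j)\<^sup>2 = (1/2::real) ^ j"
      by (simp add: power2_eq_square power_divide)
    finally show ?thesis .
  qed
  have Gmeas [measurable]: "G j \<in> borel_measurable circle" for j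
    unfolding G_def by measurable
  have "(\<integral>\<^sup>+x. (\<Sum>j. ennreal (G j x)) \<partial>circle) = (\<Sum>j. \<integral>\<^sup>+x. ennreal (G j x) \<partial>circle)"
    by (rule nn_integral_suminf) measurable
  also have "\<dots> \<le> (\<Sum>j. ennreal ((1/2) ^ j))"
    by (intro suminf_le Gint) auto
  also have "\<dots> = ennreal 2"
    by (subst suminf_ennreal2) (auto simp: suminf_geometric)
  finally have "(\<integral>\<^sup>+x. (\<Sum>j. ennreal (G j x)) \<partial>circle) \<noteq> \<infinity>"
    by (metis ennreal_less_top infinity_ennreal_def le_less_trans less_irrefl)
  then have "AE x in circle. (\<Sum>j. ennreal (G j x)) \<noteq> \<infinity>"
    by (intro nn_integral_PInf_AE) auto
  then have conv: "AE x in circle. convergent (\<lambda>j. F j x)"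
  proof eventually_elim
    case (elim x)
    have "summable (\<lambda>j. G j x)"
      using elim by (intro summable_suminf_not_top) (auto simp: G_def)
    then have "summable (\<lambda>j. F (Suc j) x - F j x)"
      unfolding G_def by (rule summable_norm_cancel)
    then have "convergent (\<lambda>n. F n x - F 0 x)"
      unfolding summable_iff_convergent using sum_lessThan_telescope[of "\<lambda>n. F n x"] by simp
    from convergent_add[OF this convergent_const[of "F 0 x"]] show ?case by simp
  qed
  define f where "f x = lim (\<lambda>j. F j x)" for x
  have fmeas [measurable]: "f \<in> borel_measurable circle"
    unfolding f_def by measurable
  have lim: "AE x in circle. (\<lambda>j. F j x) \<longlonglongrightarrow> f x"
    using conv by eventually_elim (simp add: f_def convergent_LIMSEQ_iff)
  have XX: "norm (X (j + i) - X j) \<le> 2 * (1/2) ^ j" for i j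
  proof -
    have "norm (X (j + i) - X j) \<le> (\<Sum>k<i. norm (X (Suc (j + k)) - X (j + k)))"
      using norm_sum[of "\<lambda>k. X (Suc (j + k)) - X (j + k)" "{..<i}"]
        sum_lessThan_telescope[of "\<lambda>k. X (j + k)" i] by simp
    also have "\<dots> \<le> (\<Sum>k<i. (1/2) ^ j * (1/2) ^ k)"
      by (intro sum_mono) (use fast in \<open>auto simp flip: power_add\<close>)
    also have "\<dots> = (1/2) ^ j * (\<Sum>k<i. (1/2) ^ k)" by (simp add: sum_distrib_left)
    also have "\<dots> \<le> (1/2) ^ j * 2"
      by (intro mult_left_mono) (auto simp: sum_gp_strict)
    finally show ?thesis by simp
  qed
  have fatou: "(\<integral>\<^sup>+x. ennreal ((cmod (f x - F j x))\<^sup>2) \<partial>circle) \<le> ennreal ((2 * (1/2) ^ j)\<^sup>2)" for j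
  proof -
    have "(\<integral>\<^sup>+x. ennreal ((cmod (f x - F j x))\<^sup>2) \<partial>circle)
        = (\<integral>\<^sup>+x. liminf (\<lambda>i. ennreal ((cmod (F (j + i) x - F j x))\<^sup>2)) \<partial>circle)"
    proof (rule nn_integral_cong_AE, use lim in eventually_elim)
      case (elim x)
      from LIMSEQ_ignore_initial_segment[OF elim, of j]
      have "(\<lambda>i. F (j + i) x) \<longlonglongrightarrow> f x" by (simp add: add.commute)
      then have "(\<lambda>i. ennreal ((cmod (F (j + i) x - F j x))\<^sup>2)) \<longlonglongrightarrow> ennreal ((cmod (f x - F j x))\<^sup>2)"
        by (intro tendsto_intros)
      then show ?case by (metis lim_imp_Liminf trivial_limit_sequentially)
    qed
    also have "\<dots> \<le> liminf (\<lambda>i. \<integral>\<^sup>+x. ennreal ((cmod (F (j + i) x - F j x))\<^sup>2) \<partial>circle)"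
      by (rule nn_integral_liminf) measurable
    also have "\<dots> \<le> liminf (\<lambda>i::nat. ennreal ((2 * (1/2) ^ j)\<^sup>2))"
      unfolding nnF by (intro Liminf_mono always_eventually allI ennreal_leI power_mono XX) auto
    also have "\<dots> = ennreal ((2 * (1/2) ^ j)\<^sup>2)" by (simp add: Liminf_const)
    finally show ?thesis .
  qed
  have sqf: "square_integrable (\<lambda>x. f x - F j x)" for j
    unfolding square_integrable_def
  proof
    show "integrable circle (\<lambda>x. (cmod (f x - F j x))\<^sup>2)"
      by (rule integrableI_bounded)
        (use fatou[of j] in \<open>auto intro: le_less_trans\<close>)
  qed measurable
  have err: "(LINT x|circle. (cmod (f x - F j x))\<^sup>2) \<le> (2 * (1/2) ^ j)\<^sup>2" for j
  proof -
    have "(LINT x|circle. (cmod (f x - F j x))\<^sup>2) = enn2real (\<integral>\<^sup>+x. ennreal ((cmod (f x - F j x))\<^sup>2) \<partial>circle)"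
      by (rule integral_eq_nn_integral) auto
    also have "\<dots> \<le> enn2real (ennreal ((2 * (1/2) ^ j)\<^sup>2))"
      by (intro enn2real_mono fatou) auto
    finally show ?thesis by simp
  qed
  have sf: "square_integrable f"
    using square_integrable_add[OF sqf[of 0], of "F 0"] F(1)[of 0] by (simp add: hardy_fun_def)
  have "fourier_fun f k = 0" if k: "k < 0" for k
  proof -
    have "cmod (fourier_fun f k) \<le> 2 * (1/2) ^ j" for j
    proof -
      have "fourier_fun f k = fourier_fun (\<lambda>x. (f x - F j x) + F j x) k" by simp
      also have "\<dots> = fourier_fun (\<lambda>x. f x - F j x) k + fourier_fun (F j) k"
        by (rule fourier_fun_add) (use sqf F(1) in \<open>auto simp: hardy_fun_def\<close>)
      also have "fourier_fun (F j) k = 0" using F(1)[of j] k by (simp add: hardy_fun_def)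
      finally have "cmod (fourier_fun f k) = cmod (fourier_fun (\<lambda>x. f x - F j x) k)" by simp
      also have "\<dots> \<le> 2 * (1/2) ^ j"
        by (rule norm_fourier_fun_le) (use sqf err in auto)
      finally show ?thesis .
    qed
    moreover have "(\<lambda>j. 2 * (1/2::real) ^ j) \<longlonglongrightarrow> 2 * 0"
      by (intro tendsto_mult tendsto_const LIMSEQ_realpow_zero) auto
    ultimately have "cmod (fourier_fun f k) \<le> 2 * 0"
      by (intro LIMSEQ_le_const[of "\<lambda>j. 2 * (1/2) ^ j"]) auto
    then show ?thesis by simp
  qed
  then have f: "hardy_fun f" using sf by (simp add: hardy_fun_def)
  have "norm (abs_hardy f - X j) \<le> 2 * (1/2) ^ j" for j
  proof -
    have "(norm (abs_hardy f - X j))\<^sup>2 = (LINT x|circle. (cmod (f x - F j x))\<^sup>2)"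
      using norm_hardy_sq[OF abs_hardy_diff(2)[OF f F(1)]] by (simp add: abs_hardy_diff(1)[OF f F(1), symmetric] F)
    also have "\<dots> \<le> (2 * (1/2) ^ j)\<^sup>2" by (rule err)
    finally show ?thesis by (rule power2_le_imp_le) simp
  qed
  then have b: "norm (X j - abs_hardy f) \<le> 2 * (1/2) ^ j" for j
    by (simp add: norm_minus_commute)
  have "(\<lambda>j. 2 * (1/2::real) ^ j) \<longlonglongrightarrow> 2 * 0"
    by (intro tendsto_mult tendsto_const LIMSEQ_realpow_zero) auto
  then have "(\<lambda>j. X j - abs_hardy f) \<longlonglongrightarrow> 0"
    by (intro Lim_null_comparison[OF always_eventually[OF allI[OF b]]]) simp
  then show ?thesis using LIM_zero_cancel by blast
qed

instance hardy :: complete_space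
proof
  fix X :: "nat \<Rightarrow> hardy"
  assume X: "Cauchy X"
  have "\<exists>N. \<forall>m\<ge>N. \<forall>n\<ge>N. norm (X m - X n) < (1/2) ^ j" for j :: nat
    using CauchyD[OF X, of "(1/2) ^ j"] by simp
  then obtain N where N: "\<And>j m n. m \<ge> N j \<Longrightarrow> n \<ge> N j \<Longrightarrow> norm (X m - X n) < (1/2) ^ j"
    by metis
  \<comment> \<open>Adding up the thresholds gives \<open>N j <= r j\<close>, and the summand
    \<open>j\<close> makes \<open>r\<close> strictly increasing.\<close>
  define r where "r j = (\<Sum>i\<le>j. N i) + j" for j
  have r: "N j \<le> r j" "r j \<le> r (Suc j)" for j
    by (auto simp: r_def intro: order_trans[OF member_le_sum[of j "{..j}" N]])
  have "norm (X (r (Suc j)) - X (r j)) \<le> (1/2) ^ j" for j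
    using N[of j "r (Suc j)" "r j"] r[of j] by simp
  then obtain x where x: "(\<lambda>j. X (r j)) \<longlonglongrightarrow> x"
    using Riesz_Fischer_fast[of "\<lambda>j. X (r j)"] by auto
  have "strict_mono r" by (intro strict_monoI_Suc) (simp add: r_def)
  then have "X \<longlonglongrightarrow> x"
    using Cauchy_converges_subseq[OF X, of r x] x by (simp add: comp_def)
  then show "convergent X" by (auto simp: convergent_def)
qed

section \<open>Parseval's identity and Hankel operators\<close>

instance hardy :: banach ..

lemma le_if_mult_self_le:
  fixes x y :: real
  assumes "x * x \<le> y * x" "0 \<le> x" "0 \<le> y"
  shows "x \<le> y"
  using assms mult_right_le_imp_le[of x x y] by (cases "x = 0") auto

lemma inner_scaleC_basis_fun:
  "inner f (scaleC c (basis_fun k)) = Re (fourier f (int k) * cnj c)"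
  by (simp add: inner_scaleC inner_basis_fun mult.commute)

lemma norm_trig_poly_sq:
  assumes "finite A"
  shows "(norm (\<Sum>k\<in>A. scaleC (a k) (basis_fun k)))\<^sup>2 = (\<Sum>k\<in>A. (cmod (a k))\<^sup>2)"
proof -
  have "(norm (\<Sum>k\<in>A. scaleC (a k) (basis_fun k)))\<^sup>2
      = (\<Sum>j\<in>A. Re (fourier (\<Sum>k\<in>A. scaleC (a k) (basis_fun k)) (int j) * cnj (a j)))"
    unfolding power2_norm_eq_inner by (subst inner_sum_right) (simp add: inner_scaleC_basis_fun)
  also have "\<dots> = (\<Sum>j\<in>A. Re (a j * cnj (a j)))"
    by (intro sum.cong refl) (simp add: fourier_basis_fun assms if_distrib cong: if_cong)
  also have "\<dots> = (\<Sum>k\<in>A. (cmod (a k))\<^sup>2)"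
    by (simp add: complex_norm_square[symmetric] del: of_real_power)
  finally show ?thesis .
qed

text \<open>The partial sums are Cauchy by Pythagoras. This is the source of every element built
  from prescribed coefficients: Hankel images, backward shifts and weak limits.\<close>

lemma hardy_series_exists:
  assumes a: "summable (\<lambda>k. (cmod (a k))\<^sup>2)"
  obtains f where "(\<lambda>k. scaleC (a k) (basis_fun k)) sums f" "\<And>k. fourier f (int k) = a k"
proof -
  have "summable (\<lambda>k. scaleC (a k) (basis_fun k))"
    unfolding summable_Cauchy
  proof (intro allI impI)
    fix e :: real assume "e > 0"
    then have "e\<^sup>2 > 0" by simp
    with a obtain N where N: "\<And>m n. m \<ge> N \<Longrightarrow> norm (\<Sum>k=m..<n. (cmod (a k))\<^sup>2) < e\<^sup>2"
      unfolding summable_Cauchy by blast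
    have "norm (\<Sum>k=m..<n. scaleC (a k) (basis_fun k)) < e" if "m \<ge> N" for m n
    proof (rule power2_less_imp_less)
      show "(norm (\<Sum>k=m..<n. scaleC (a k) (basis_fun k)))\<^sup>2 < e\<^sup>2"
        using N[OF that, of n] by (simp add: norm_trig_poly_sq)
    qed (use \<open>e > 0\<close> in simp)
    then show "\<exists>N. \<forall>m\<ge>N. \<forall>n. norm (\<Sum>k=m..<n. scaleC (a k) (basis_fun k)) < e" by blast
  qed
  then obtain f where f: "(\<lambda>k. scaleC (a k) (basis_fun k)) sums f" by (auto simp: summable_def)
  have "fourier f (int j) = a j" for j
  proof -
    have "(\<lambda>k. fourier (scaleC (a k) (basis_fun k)) (int j)) sums fourier f (int j)"
      using f by (rule bounded_linear.sums[OF bounded_linear_fourier])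
    moreover have "(\<lambda>k. fourier (scaleC (a k) (basis_fun k)) (int j)) sums
        (\<Sum>k\<in>{j}. fourier (scaleC (a k) (basis_fun k)) (int j))"
      by (rule sums_finite) (auto simp: fourier_basis_fun)
    ultimately show ?thesis by (auto simp: fourier_basis_fun dest: sums_unique2)
  qed
  with f show thesis by (rule that)
qed

text \<open>Bessel's inequality makes the coefficients square summable, so the series has a sum; it
  has the coefficients of \<open>f\<close> and thus equals \<open>f\<close>.\<close>

lemma fourier_series_sums: "(\<lambda>k. scaleC (fourier f (int k)) (basis_fun k)) sums f"
proof -
  let ?s = "\<lambda>n. \<Sum>k<n. scaleC (fourier f (int k)) (basis_fun k)"
  have Bessel: "(\<Sum>k<n. (cmod (fourier f (int k)))\<^sup>2) \<le> (norm f)\<^sup>2" for n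
  proof -
    have "(norm (?s n))\<^sup>2 = inner f (?s n)"
      by (simp add: norm_trig_poly_sq inner_sum_right inner_scaleC_basis_fun complex_norm_square[symmetric] del: of_real_power)
    also have "\<dots> \<le> norm f * norm (?s n)" by (rule norm_cauchy_schwarz)
    finally have "norm (?s n) \<le> norm f"
      by (intro le_if_mult_self_le[of "norm (?s n)"]) (simp_all add: power2_eq_square)
    then have "(norm (?s n))\<^sup>2 \<le> (norm f)\<^sup>2" by (intro power_mono) auto
    then show ?thesis by (simp add: norm_trig_poly_sq)
  qed
  have "summable (\<lambda>k. (cmod (fourier f (int k)))\<^sup>2)"
    by (rule bounded_imp_summable[where B = "(norm f)\<^sup>2"])
      (use Bessel[of "Suc _"] in \<open>auto simp: lessThan_Suc_atMost\<close>)
  then obtain g where g: "(\<lambda>k. scaleC (fourier f (int k)) (basis_fun k)) sums g"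
      "\<And>k. fourier g (int k) = fourier f (int k)"
    using hardy_series_exists[where a = "\<lambda>k. fourier f (int k)"] by blast
  then have "g = f" by (auto intro: hardy_eqI)
  then show ?thesis using g by simp
qed

text \<open>The complex inner product: as \<open><f, i g> = - i <f, g>\<close>, the real part of the
  left side is the imaginary part of \<open><f, g>\<close>.\<close>

definition cinner :: "hardy \<Rightarrow> hardy \<Rightarrow> complex" where
  "cinner f g = Complex (inner f g) (inner f (scaleC \<i> g))"

lemma scaleC_scaleC [simp]: "scaleC a (scaleC b f) = scaleC (a * b) f"
  by (rule hardy.scale_scale)

lemma inner_sums: "(\<lambda>k. Re (fourier f (int k) * cnj (fourier g (int k)))) sums inner f g"
proof -
  have "(\<lambda>k. inner f (scaleC (fourier g (int k)) (basis_fun k))) sums inner f g"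
    by (rule bounded_linear.sums[OF bounded_linear_inner_right fourier_series_sums])
  then show ?thesis by (simp add: inner_scaleC_basis_fun)
qed

lemma cinner_sums: "(\<lambda>k. fourier f (int k) * cnj (fourier g (int k))) sums cinner f g"
proof -
  have "(\<lambda>k. Im (fourier f (int k) * cnj (fourier g (int k)))) sums inner f (scaleC \<i> g)"
    using inner_sums[of f "scaleC \<i> g"] by (simp add: algebra_simps)
  with inner_sums[of f g] show ?thesis by (simp add: sums_complex_iff cinner_def)
qed

lemma Parseval: "(\<lambda>k. (cmod (fourier f (int k)))\<^sup>2) sums (norm f)\<^sup>2"
  using inner_sums[of f f]
  by (simp add: power2_norm_eq_inner complex_norm_square[symmetric] del: of_real_power)

text \<open>Multiplying \<open>g\<close> by the value \<open>z\<close> of the product makes the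
  product real, and the real Cauchy-Schwarz inequality applies.\<close>

lemma norm_cinner_le: "cmod (cinner f g) \<le> norm f * norm g"
proof -
  define z where "z = cinner f g"
  have "(\<lambda>k. Re (cnj z * (fourier f (int k) * cnj (fourier g (int k))))) sums Re (cnj z * z)"
    unfolding z_def by (intro bounded_linear.sums[OF bounded_linear_Re] sums_mult cinner_sums)
  moreover have "(\<lambda>k. Re (cnj z * (fourier f (int k) * cnj (fourier g (int k))))) sums inner f (scaleC z g)"
    using inner_sums[of f "scaleC z g"] by (simp add: mult.left_commute)
  ultimately have "Re (cnj z * z) = inner f (scaleC z g)" by (rule sums_unique2)
  then have "(cmod z)\<^sup>2 \<le> norm f * (cmod z * norm g)"
    using norm_cauchy_schwarz[of f "scaleC z g"]
    by (simp add: cmod_power2 power2_eq_square[of "Re z"] power2_eq_square[of "Im z"])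
  then have "cmod z * cmod z \<le> (norm f * norm g) * cmod z" by (simp add: power2_eq_square mult_ac)
  then show ?thesis unfolding z_def[symmetric] by (rule le_if_mult_self_le) auto
qed

lemma cinner_eq_integral:
  assumes "hardy_fun f" "hardy_fun g"
  shows "cinner (abs_hardy f) (abs_hardy g) = (LINT x|circle. f x * cnj (g x))"
proof -
  have rel: "hardy_rel f f" "hardy_rel g g" "hardy_rel (\<lambda>x. \<i> * g x) (\<lambda>x. \<i> * g x)"
    using assms hardy_fun_cmult[of g \<i>] by (simp_all add: hardy_rel_def)
  have "(LINT x|circle. f x * cnj (\<i> * g x)) = (LINT x|circle. - \<i> * (f x * cnj (g x)))"
    by (intro Bochner_Integration.integral_cong) auto
  then show ?thesis
    by (simp add: cinner_def complex_eq_iff inner_hardy.abs_eq scaleC.abs_eq rel)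
qed

section \<open>Powers of the shift and pairing with characters\<close>

lemma fourier_shift_pow: "fourier ((shift ^^ m) f) k = fourier f (k - int m)"
  by (induction m arbitrary: k) (simp_all add: fourier_shift algebra_simps)

lemma shift_pow_abs_hardy:
  assumes "hardy_fun f"
  shows "(shift ^^ m) (abs_hardy f) = abs_hardy (\<lambda>x. cis (real m * x) * f x)"
    "hardy_fun (\<lambda>x. cis (real m * x) * f x)"
proof -
  have "(shift ^^ m) (abs_hardy f) = abs_hardy (\<lambda>x. cis (real m * x) * f x) \<and>
    hardy_fun (\<lambda>x. cis (real m * x) * f x)"
  proof (induction m)
    case (Suc m)
    have eq: "(\<lambda>x. cis x * (cis (real m * x) * f x)) = (\<lambda>x. cis (real (Suc m) * x) * f x)"
      by (simp only: mult.assoc[symmetric] cis_mult) (simp add: distrib_right)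
    have "hardy_rel (\<lambda>x. cis (real m * x) * f x) (\<lambda>x. cis (real m * x) * f x)"
      using Suc by (simp add: hardy_rel_def)
    from shift.abs_eq[OF this] show ?case
      using Suc hardy_fun_shift[of "\<lambda>x. cis (real m * x) * f x"] by (simp add: eq)
  qed (use assms in simp)
  then show "(shift ^^ m) (abs_hardy f) = abs_hardy (\<lambda>x. cis (real m * x) * f x)"
    "hardy_fun (\<lambda>x. cis (real m * x) * f x)" by auto
qed

lemma fourier_fun_mult_cnj:
  assumes "hardy_fun u" "hardy_fun h"
  shows "fourier_fun (\<lambda>x. u x * cnj (h x)) (int k) = cinner (abs_hardy u) ((shift ^^ k) (abs_hardy h))"
  unfolding shift_pow_abs_hardy(1)[OF assms(2)]
  by (subst cinner_eq_integral[OF assms(1) shift_pow_abs_hardy(2)[OF assms(2)]])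
    (auto simp: fourier_fun_def cis_cnj mult.commute mult.left_commute intro!: Bochner_Integration.integral_cong)

section \<open>Sobolev norms as series over nonnegative frequencies\<close>

lemma sobolev_term_neutral:
  fixes u s
  defines "f \<equiv> \<lambda>k::int. (1 + (of_int k)\<^sup>2) powr s * (cmod (fourier u k))\<^sup>2"
  shows "f summable_on UNIV \<longleftrightarrow> summable (\<lambda>k. f (int k))" "infsum f UNIV = infsum (\<lambda>k. f (int k)) UNIV"
proof -
  have 0: "f k = 0" if "k \<notin> range int" for k
  proof -
    have "k < 0" using that by (metis int_nat_eq linorder_not_less rangeI)
    then show ?thesis by (simp add: f_def fourier_neg)
  qed
  have "f summable_on UNIV \<longleftrightarrow> f summable_on range int"
    by (rule summable_on_cong_neutral) (use 0 in auto)
  also have "\<dots> \<longleftrightarrow> (\<lambda>k. f (int k)) summable_on UNIV"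
    by (subst summable_on_reindex) (auto simp: o_def)
  also have "\<dots> \<longleftrightarrow> summable (\<lambda>k. f (int k))"
    by (rule summable_on_UNIV_nonneg_real_iff) (simp add: f_def)
  finally show "f summable_on UNIV \<longleftrightarrow> summable (\<lambda>k. f (int k))" .
  have "infsum f UNIV = infsum f (range int)"
    by (rule infsum_cong_neutral) (use 0 in auto)
  also have "\<dots> = infsum (\<lambda>k. f (int k)) UNIV"
    by (subst infsum_reindex) (auto simp: o_def)
  finally show "infsum f UNIV = infsum (\<lambda>k. f (int k)) UNIV" .
qed

definition sobolev_term :: "real \<Rightarrow> hardy \<Rightarrow> nat \<Rightarrow> real" where
  "sobolev_term s u k = (1 + (real k)\<^sup>2) powr s * (cmod (fourier u (int k)))\<^sup>2"

lemma sobolev_term_nonneg [simp]: "0 \<le> sobolev_term s u k"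
  by (simp add: sobolev_term_def)

lemma sobolev_iff: "u \<in> sobolev s \<longleftrightarrow> summable (sobolev_term s u)"
  unfolding sobolev_def mem_Collect_eq sobolev_term_neutral(1) sobolev_term_def by simp

lemma sobolev_norm_sq:
  assumes "u \<in> sobolev s"
  shows "sobolev_term s u sums (sobolev_norm s u)\<^sup>2"
proof -
  have sm: "summable (sobolev_term s u)" using assms by (simp add: sobolev_iff)
  have "(sobolev_term s u has_sum suminf (sobolev_term s u)) UNIV"
    by (rule norm_summable_imp_has_sum) (use sm in \<open>auto intro: summable_sums\<close>)
  then have "infsum (sobolev_term s u) UNIV = suminf (sobolev_term s u)" by (rule infsumI)
  then have "sobolev_norm s u = sqrt (suminf (sobolev_term s u))"
    unfolding sobolev_norm_def sobolev_term_neutral(2) by (simp add: sobolev_term_def[abs_def])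
  then have "(sobolev_norm s u)\<^sup>2 = suminf (sobolev_term s u)"
    by (simp add: suminf_nonneg[OF sm])
  then show ?thesis using sm by (simp add: summable_sums)
qed

lemma sobolev_norm_nonneg [simp]: "0 \<le> sobolev_norm s u"
  by (auto simp: sobolev_norm_def intro!: infsum_nonneg)

section \<open>The Hilbert-Schmidt bound and the matrix of a Hankel operator\<close>

lemma sum_tails_eq:
  fixes c T :: "nat \<Rightarrow> real"
  assumes "\<And>k. T k = c k + T (Suc k)"
  shows "(\<Sum>k<n. T k) = (\<Sum>k<n. (real k + 1) * c k) + real n * T n"
proof (induction n)
  case (Suc n)
  then show ?case using assms[of n] by (simp add: algebra_simps)
qed simp

text \<open>Each \<open>c i\<close> occurs in the tails starting at \<open>0, ..., i\<close>, hence
  \<open>i + 1\<close> times. After \<open>n\<close> tails the correction is \<open>n\<close> times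
  the next tail, which the weighted tail dominates.\<close>

lemma sum_tails_le:
  fixes c :: "nat \<Rightarrow> real"
  assumes nn: "\<And>k. 0 \<le> c k" and sm: "summable (\<lambda>k. (real k + 1) * c k)"
  shows "(\<Sum>k<n. \<Sum>j. c (j + k)) \<le> (\<Sum>k. (real k + 1) * c k)"
proof -
  have "summable c"
    by (rule summable_comparison_test'[OF sm, of 0]) (use nn in \<open>auto intro!: mult_left_le simp: algebra_simps\<close>)
  then have sc: "summable (\<lambda>j. c (j + k))" for k by (rule summable_ignore_initial_segment)
  have "(\<Sum>j. c (j + k)) = c k + (\<Sum>j. c (j + Suc k))" for k
    using suminf_split_head[OF sc[of k]] by simp
  then have "(\<Sum>k<n. \<Sum>j. c (j + k)) = (\<Sum>k<n. (real k + 1) * c k) + real n * (\<Sum>j. c (j + n))"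
    by (rule sum_tails_eq)
  also have "real n * (\<Sum>j. c (j + n)) = (\<Sum>j. real n * c (j + n))"
    by (rule suminf_mult[symmetric, OF sc])
  also have "\<dots> \<le> (\<Sum>j. (real (j + n) + 1) * c (j + n))"
    by (intro suminf_le mult_right_mono nn summable_mult sc summable_ignore_initial_segment[OF sm]) auto
  also have "(\<Sum>k<n. (real k + 1) * c k) + \<dots> = (\<Sum>k. (real k + 1) * c k)"
    using suminf_split_initial_segment[OF sm, of n] by simp
  finally show ?thesis by simp
qed

text \<open>Compares the multiplicity \<open>k + 1\<close> of a coefficient in the Hankel matrix
  with the weight of order 1/2; the factor 2 reappears in
  \<open>sum_cinner_shift_pow_le\<close>.\<close>

lemma sobolev_half_weight: "real k + 1 \<le> 2 * (1 + (real k)\<^sup>2) powr (1/2)"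
proof -
  have "(real k + 1)\<^sup>2 \<le> 4 * (1 + (real k)\<^sup>2)"
    using zero_le_power2[of "real k - 1"] by (simp add: power2_eq_square algebra_simps)
  then have "real k + 1 \<le> sqrt (4 * (1 + (real k)\<^sup>2))" by (rule real_le_rsqrt)
  then show ?thesis unfolding real_sqrt_mult by (simp add: powr_half_sqrt)
qed

text \<open>Pairing \<open>u\<close> with the \<open>k\<close>-fold shift of \<open>h\<close> is
  pairing the \<open>k\<close>-fold backward shift \<open>g\<close> of \<open>u\<close> with
  \<open>h\<close>, and the squared norm of \<open>g\<close> is a tail of the coefficients of
  \<open>u\<close>.\<close>

lemma cinner_shift_pow_le:
  "(cmod (cinner u ((shift ^^ k) h)))\<^sup>2 \<le> (norm h)\<^sup>2 * (\<Sum>j. (cmod (fourier u (int (j + k))))\<^sup>2)"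
proof -
  have sm: "summable (\<lambda>j. (cmod (fourier u (int (j + k))))\<^sup>2)"
    by (rule summable_ignore_initial_segment[OF sums_summable[OF Parseval[of u]]])
  then obtain g where g: "\<And>j. fourier g (int j) = fourier u (int (j + k))"
    using hardy_series_exists[where a = "\<lambda>j. fourier u (int (j + k))"] by blast
  have "(\<lambda>j. fourier u (int (j + k)) * cnj (fourier ((shift ^^ k) h) (int (j + k)))) sums cinner u ((shift ^^ k) h)"
    using cinner_sums[of u "(shift ^^ k) h"]
    by (subst sums_iff_shift[of "\<lambda>j. fourier u (int j) * cnj (fourier ((shift ^^ k) h) (int j))"])
      (simp add: fourier_shift_pow fourier_neg)
  then have "(\<lambda>j. fourier g (int j) * cnj (fourier h (int j))) sums cinner u ((shift ^^ k) h)"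
    by (simp add: fourier_shift_pow g)
  with cinner_sums[of g h] have "cinner u ((shift ^^ k) h) = cinner g h" by (rule sums_unique2[symmetric])
  then have "(cmod (cinner u ((shift ^^ k) h)))\<^sup>2 \<le> (norm g * norm h)\<^sup>2"
    by (simp add: norm_cinner_le power_mono)
  also have "\<dots> = (norm h)\<^sup>2 * (norm g)\<^sup>2" by (simp add: power_mult_distrib)
  also have "(norm g)\<^sup>2 = (\<Sum>j. (cmod (fourier u (int (j + k))))\<^sup>2)"
    using Parseval[of g] by (simp add: g sums_iff)
  finally show ?thesis .
qed

lemma sum_cinner_shift_pow_le:
  assumes "u \<in> sobolev (1/2)"
  shows "(\<Sum>k<n. (cmod (cinner u ((shift ^^ k) h)))\<^sup>2) \<le> 2 * (sobolev_norm (1/2) u * norm h)\<^sup>2"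
proof -
  let ?c = "\<lambda>k. (cmod (fourier u (int k)))\<^sup>2"
  have su: "summable (sobolev_term (1/2) u)" using assms by (simp add: sobolev_iff)
  have le: "(real k + 1) * ?c k \<le> 2 * sobolev_term (1/2) u k" for k
    using mult_right_mono[OF sobolev_half_weight[of k], of "?c k"] by (simp add: sobolev_term_def)
  have sm: "summable (\<lambda>k. (real k + 1) * ?c k)"
    by (rule summable_comparison_test'[OF summable_mult[OF su, of 2], of 0]) (use le in auto)
  have "(\<Sum>k<n. (cmod (cinner u ((shift ^^ k) h)))\<^sup>2) \<le> (\<Sum>k<n. (norm h)\<^sup>2 * (\<Sum>j. ?c (j + k)))"
    by (intro sum_mono cinner_shift_pow_le)
  also have "\<dots> = (norm h)\<^sup>2 * (\<Sum>k<n. \<Sum>j. ?c (j + k))" by (simp add: sum_distrib_left)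
  also have "\<dots> \<le> (norm h)\<^sup>2 * (\<Sum>k. (real k + 1) * ?c k)"
    by (intro mult_left_mono sum_tails_le sm) auto
  also have "\<dots> \<le> (norm h)\<^sup>2 * (\<Sum>k. 2 * sobolev_term (1/2) u k)"
    by (intro mult_left_mono suminf_le le sm summable_mult su) auto
  also have "(\<Sum>k. 2 * sobolev_term (1/2) u k) = 2 * (sobolev_norm (1/2) u)\<^sup>2"
    using sobolev_norm_sq[OF assms] by (simp add: suminf_mult sums_iff)
  finally show ?thesis by (simp add: power_mult_distrib mult_ac)
qed

text \<open>As \<open>szego\<close> is a definite description, an element with the required
  coefficients has to be exhibited. The Hilbert-Schmidt bound makes them square summable although
  the product \<open>u * cnj h\<close> need not be square integrable; this is where the regularity
  1/2 enters.\<close>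

lemma fourier_hankel_cinner:
  assumes u: "u \<in> sobolev (1/2)"
  shows "fourier (hankel u h) (int k) = cinner u ((shift ^^ k) h)"
proof -
  have "summable (\<lambda>k. (cmod (cinner u ((shift ^^ k) h)))\<^sup>2)"
    by (rule bounded_imp_summable[where B = "2 * (sobolev_norm (1/2) u * norm h)\<^sup>2"])
      (use sum_cinner_shift_pow_le[OF u, of h "Suc _"] in \<open>auto simp: lessThan_Suc_atMost\<close>)
  then obtain g where g: "\<And>k. fourier g (int k) = cinner u ((shift ^^ k) h)"
    using hardy_series_exists[where a = "\<lambda>k. cinner u ((shift ^^ k) h)"] by blast
  have rel: "hardy_rel (rep_hardy u) (rep_hardy u)" "hardy_rel (rep_hardy h) (rep_hardy h)"
    using abs_rep_hardy by (simp_all add: hardy_rel_def)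
  have "hankel u h = szego (\<lambda>x. rep_hardy u x * cnj (rep_hardy h x))"
    using hankel.abs_eq[OF rel] by (simp add: abs_rep_hardy)
  moreover have "fourier_fun (\<lambda>x. rep_hardy u x * cnj (rep_hardy h x)) (int k) = fourier g (int k)" for k
    by (simp add: fourier_fun_mult_cnj abs_rep_hardy g)
  then have "szego (\<lambda>x. rep_hardy u x * cnj (rep_hardy h x)) = g"
    unfolding szego_def
    by (intro the_equality) (auto intro!: hardy_eqI dest: zero_le_imp_eq_int)
  ultimately show ?thesis using g by simp
qed

lemma fourier_hankel:
  assumes u: "u \<in> sobolev (1/2)"
  shows "(\<lambda>j. fourier u (int (j + k)) * cnj (fourier h (int j))) sums fourier (hankel u h) (int k)"
proof -
  have "(\<lambda>j. fourier u (int (j + k)) * cnj (fourier ((shift ^^ k) h) (int (j + k)))) sums cinner u ((shift ^^ k) h)"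
    using cinner_sums[of u "(shift ^^ k) h"]
    by (subst sums_iff_shift[of "\<lambda>j. fourier u (int j) * cnj (fourier ((shift ^^ k) h) (int j))"])
      (simp add: fourier_shift_pow fourier_neg)
  then show ?thesis by (simp add: fourier_shift_pow fourier_hankel_cinner[OF u])
qed

lemma norm_hankel_le:
  assumes u: "u \<in> sobolev (1/2)"
  shows "norm (hankel u h) \<le> 2 * sobolev_norm (1/2) u * norm h"
proof (rule power2_le_imp_le)
  have "(norm (hankel u h))\<^sup>2 \<le> 2 * (sobolev_norm (1/2) u * norm h)\<^sup>2"
    using Parseval[of "hankel u h"] sum_cinner_shift_pow_le[OF u, of h]
    by (intro LIMSEQ_le_const2[of "\<lambda>n. \<Sum>k<n. (cmod (fourier (hankel u h) (int k)))\<^sup>2"])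
      (auto simp: sums_def fourier_hankel_cinner[OF u])
  \<comment> \<open>The constant \<open>sqrt 2\<close> is rounded up to 2.\<close>
  also have "\<dots> \<le> 4 * (sobolev_norm (1/2) u * norm h)\<^sup>2" by simp
  finally show "(norm (hankel u h))\<^sup>2 \<le> (2 * sobolev_norm (1/2) u * norm h)\<^sup>2"
    by (simp add: power_mult_distrib)
qed (simp add: sobolev_norm_nonneg)

text \<open>One shift of \<open>h\<close> before pairing is one more shift in the pairing of
  \<open>u\<close> with the \<open>k\<close>-fold shift of \<open>h\<close>.\<close>

lemma fourier_shifted_hankel:
  assumes u: "u \<in> sobolev (1/2)"
  shows "fourier (shifted_hankel u h) (int k) = fourier (hankel u h) (int (Suc k))"
  using u by (simp add: shifted_hankel_def fourier_hankel_cinner funpow_swap1 del: of_nat_Suc)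

lemma hankel_add:
  assumes u: "u \<in> sobolev (1/2)"
  shows "hankel u (f + g) = hankel u f + hankel u g"
proof (rule hardy_eqI)
  fix k
  show "fourier (hankel u (f + g)) (int k) = fourier (hankel u f + hankel u g) (int k)"
    using sums_add[OF fourier_hankel[OF u, of k f] fourier_hankel[OF u, of k g]] fourier_hankel[OF u, of k "f + g"]
    by (auto simp: algebra_simps dest: sums_unique2)
qed

lemma hankel_scaleC:
  assumes u: "u \<in> sobolev (1/2)"
  shows "hankel u (scaleC c f) = scaleC (cnj c) (hankel u f)"
proof (rule hardy_eqI)
  fix k
  show "fourier (hankel u (scaleC c f)) (int k) = fourier (scaleC (cnj c) (hankel u f)) (int k)"
    using sums_mult[OF fourier_hankel[OF u, of k f], of "cnj c"] fourier_hankel[OF u, of k "scaleC c f"]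
    by (auto simp: algebra_simps dest: sums_unique2)
qed

section \<open>Ranks\<close>

lemma sobolev_term_add_le: "sobolev_term s (f + g) k \<le> 2 * (sobolev_term s f k + sobolev_term s g k)"
proof -
  have "(cmod (a + b))\<^sup>2 \<le> 2 * ((cmod a)\<^sup>2 + (cmod b)\<^sup>2)" for a b
  proof -
    have "(cmod (a + b))\<^sup>2 \<le> (cmod a + cmod b)\<^sup>2" by (intro power_mono norm_triangle_ineq) simp
    moreover have "0 \<le> (cmod a - cmod b)\<^sup>2" by simp
    ultimately show ?thesis unfolding power2_diff power2_sum by argo
  qed
  from mult_left_mono[OF this[of "fourier f (int k)" "fourier g (int k)"], of "(1 + (real k)\<^sup>2) powr s"]
  show ?thesis by (simp add: sobolev_term_def algebra_simps)
qed

lemma sobolev_add: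
  assumes "f \<in> sobolev s" "g \<in> sobolev s"
  shows "f + g \<in> sobolev s"
  unfolding sobolev_iff
proof (rule summable_comparison_test')
  show "summable (\<lambda>k. 2 * (sobolev_term s f k + sobolev_term s g k))"
    using assms by (intro summable_mult summable_add) (simp_all add: sobolev_iff)
qed (use sobolev_term_add_le in auto)

lemma sobolev_term_scaleC: "sobolev_term s (scaleC c f) k = (cmod c)\<^sup>2 * sobolev_term s f k"
  by (simp add: sobolev_term_def norm_mult power_mult_distrib)

lemma sobolev_scaleC:
  assumes "f \<in> sobolev s"
  shows "scaleC c f \<in> sobolev s"
  using assms unfolding sobolev_iff sobolev_term_scaleC[abs_def] by (rule summable_mult)

lemma sobolev_norm_eqI:
  assumes "sobolev_term s u sums S"
  shows "u \<in> sobolev s" "sobolev_norm s u = sqrt S"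
proof -
  show *: "u \<in> sobolev s" using assms by (auto simp: sobolev_iff summable_def)
  have "(sobolev_norm s u)\<^sup>2 = S" by (rule sums_unique2[OF sobolev_norm_sq[OF *] assms])
  then show "sobolev_norm s u = sqrt S" using sobolev_norm_nonneg[of s u] by (metis real_sqrt_unique)
qed

lemma uminus_hardy_eq: "- f = scaleC (- 1) f"
  by (rule hardy_eqI) simp

lemma sobolev_uminus: "f \<in> sobolev s \<Longrightarrow> - f \<in> sobolev s"
  unfolding uminus_hardy_eq by (rule sobolev_scaleC)

lemma sobolev_diff:
  assumes "f \<in> sobolev s" "g \<in> sobolev s"
  shows "f - g \<in> sobolev s"
  using sobolev_add[OF assms(1) sobolev_uminus[OF assms(2)]] by simp

lemma sobolev_finite_support:
  assumes "\<And>k. k \<ge> N \<Longrightarrow> fourier f (int k) = 0"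
  shows "sobolev_term s f sums (\<Sum>k<N. sobolev_term s f k)" "f \<in> sobolev s"
proof -
  show *: "sobolev_term s f sums (\<Sum>k<N. sobolev_term s f k)"
    by (rule sums_finite) (use assms in \<open>auto simp: sobolev_term_def\<close>)
  then show "f \<in> sobolev s" by (auto simp: sobolev_iff summable_def)
qed

lemma sobolev_basis_fun: "basis_fun k \<in> sobolev s"
  by (rule sobolev_finite_support[where N = "Suc k"]) (auto simp: fourier_basis_fun)

lemma sobolev_zero: "0 \<in> sobolev s"
  by (rule sobolev_finite_support[where N = 0]) auto

lemma sobolev_sum: "(\<And>i. i \<in> I \<Longrightarrow> f i \<in> sobolev s) \<Longrightarrow> (\<Sum>i\<in>I. f i) \<in> sobolev s"
  by (induction I rule: infinite_finite_induct) (auto simp: sobolev_zero sobolev_add)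

section \<open>Algebra of the two operators in symbol and argument\<close>

lemma hankel_diff_symbol:
  assumes "u \<in> sobolev (1/2)" "w \<in> sobolev (1/2)"
  shows "hankel (u - w) h = hankel u h - hankel w h"
proof (rule hardy_eqI)
  fix k
  show "fourier (hankel (u - w) h) (int k) = fourier (hankel u h - hankel w h) (int k)"
    using sums_diff[OF fourier_hankel[OF assms(1), of k h] fourier_hankel[OF assms(2), of k h]]
      fourier_hankel[OF sobolev_diff[OF assms], of k h]
    by (auto simp: algebra_simps dest: sums_unique2)
qed

lemma shift_add: "shift (f + g) = shift f + shift g"
  and shift_scaleC: "shift (scaleC c f) = scaleC c (shift f)"
  by (rule hardy_eqI; simp add: fourier_shift)+

lemma norm_shift [simp]: "norm (shift f) = norm f"
proof -
  have "(\<lambda>k. (cmod (fourier (shift f) (int k)))\<^sup>2) sums (norm (shift f))\<^sup>2" by (rule Parseval)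
  then have "(\<lambda>k. (cmod (fourier (shift f) (int (Suc k))))\<^sup>2) sums (norm (shift f))\<^sup>2"
    by (subst sums_Suc_iff) (simp add: fourier_shift fourier_neg)
  then have "(\<lambda>k. (cmod (fourier f (int k)))\<^sup>2) sums (norm (shift f))\<^sup>2"
    by (simp add: fourier_shift)
  then have "(norm (shift f))\<^sup>2 = (norm f)\<^sup>2" by (rule sums_unique2[OF _ Parseval])
  then show ?thesis by simp
qed

context
  fixes u :: hardy
  assumes u: "u \<in> sobolev (1/2)"
begin

lemma shifted_hankel_add: "shifted_hankel u (f + g) = shifted_hankel u f + shifted_hankel u g"
  by (simp add: shifted_hankel_def shift_add hankel_add[OF u])

lemma shifted_hankel_scaleC: "shifted_hankel u (scaleC c f) = scaleC (cnj c) (shifted_hankel u f)"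
  by (simp add: shifted_hankel_def shift_scaleC hankel_scaleC[OF u])

lemma norm_shifted_hankel_le: "norm (shifted_hankel u h) \<le> 2 * sobolev_norm (1/2) u * norm h"
  using norm_hankel_le[OF u, of "shift h"] by (simp add: shifted_hankel_def)

text \<open>This is \<open>K S^m = T^m K\<close> for the backward shift \<open>T\<close>. The range
  of \<open>K\<close> is thus invariant under \<open>T\<close>, and \<open>T\<close> acts on an
  image by shifting the preimage, which is how decay along the range is tracked.\<close>

lemma fourier_shifted_hankel_shift_pow:
  "fourier (shifted_hankel u ((shift ^^ m) h)) (int k) = fourier (shifted_hankel u h) (int (k + m))"
proof -
  have "(shift ^^ Suc k) ((shift ^^ m) h) = (shift ^^ Suc (k + m)) h"
    by (simp add: funpow_add)
  then show ?thesis by (simp only: fourier_shifted_hankel[OF u] fourier_hankel_cinner[OF u])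
qed

lemma fourier_hankel_basis_fun: "fourier (hankel u (basis_fun i)) (int k) = fourier u (int (i + k))"
proof -
  have "(\<lambda>j. fourier u (int (j + k)) * cnj (fourier (basis_fun i) (int j))) sums
      (\<Sum>j\<in>{i}. fourier u (int (j + k)) * cnj (fourier (basis_fun i) (int j)))"
    by (rule sums_finite) (auto simp: fourier_basis_fun)
  from sums_unique2[OF fourier_hankel[OF u] this] show ?thesis by (simp add: fourier_basis_fun)
qed

lemma fourier_shifted_hankel_basis_fun:
  "fourier (shifted_hankel u (basis_fun i)) (int k) = fourier u (int (Suc (i + k)))"
  by (simp only: fourier_shifted_hankel[OF u] fourier_hankel_basis_fun add_Suc_right)

lemma bounded_linear_shifted_hankel: "bounded_linear (shifted_hankel u)"
  by (rule bounded_linear_intro[where K = "2 * sobolev_norm (1/2) u"])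
    (auto simp: shifted_hankel_add scaleR_hardy_eq shifted_hankel_scaleC norm_shifted_hankel_le mult.commute[of "norm _"])

text \<open>The matrix entries \<open>u_{i+j+1}\<close> are symmetric, which settles multiples of
  characters; Fourier expansion extends this one argument at a time. For the antilinear
  \<open>K\<close> it amounts to symmetry with respect to the real inner product.\<close>

lemma shifted_hankel_symmetric: "inner (shifted_hankel u f) g = inner (shifted_hankel u g) f"
proof -
  interpret K: bounded_linear "shifted_hankel u" by (rule bounded_linear_shifted_hankel)
  let ?e = "\<lambda>f k. scaleC (fourier f (int k)) (basis_fun k)"
  have basis: "inner (shifted_hankel u (?e f i)) (?e g j) = inner (shifted_hankel u (?e g j)) (?e f i)" for i j
    by (simp add: inner_scaleC_basis_fun shifted_hankel_scaleC fourier_shifted_hankel_basis_fun add.commute mult_ac del: of_nat_Suc of_nat_add)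
  have step: "inner (shifted_hankel u (?e f i)) g = inner (shifted_hankel u g) (?e f i)" for i
  proof (rule sums_unique2)
    show "(\<lambda>j. inner (shifted_hankel u (?e f i)) (?e g j)) sums inner (shifted_hankel u (?e f i)) g"
      by (rule bounded_linear.sums[OF bounded_linear_inner_right fourier_series_sums])
    show "(\<lambda>j. inner (shifted_hankel u (?e f i)) (?e g j)) sums inner (shifted_hankel u g) (?e f i)"
      unfolding basis
      by (rule bounded_linear.sums[OF bounded_linear_compose[OF bounded_linear_inner_left bounded_linear_shifted_hankel] fourier_series_sums])
  qed
  show ?thesis
  proof (rule sums_unique2)
    show "(\<lambda>i. inner (shifted_hankel u (?e f i)) g) sums inner (shifted_hankel u f) g"
      by (rule bounded_linear.sums[OF bounded_linear_compose[OF bounded_linear_inner_left bounded_linear_shifted_hankel] fourier_series_sums])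
    show "(\<lambda>i. inner (shifted_hankel u (?e f i)) g) sums inner (shifted_hankel u g) f"
      unfolding step by (rule bounded_linear.sums[OF bounded_linear_inner_right fourier_series_sums])
  qed
qed

text \<open>By symmetry the squared norm of \<open>K f\<close> is the inner product of
  \<open>K (K f)\<close> with \<open>f\<close>.\<close>

lemma shifted_hankel_inj_on_range:
  assumes "shifted_hankel u (shifted_hankel u f) = 0"
  shows "shifted_hankel u f = 0"
  using shifted_hankel_symmetric[of f "shifted_hankel u f"] assms by simp

lemma subspace_range_shifted_hankel: "hardy.subspace (range (shifted_hankel u))"
proof -
  interpret K: bounded_linear "shifted_hankel u" by (rule bounded_linear_shifted_hankel)
  show ?thesis
    unfolding hardy.subspace_def
  proof safe
    show "0 \<in> range (shifted_hankel u)" by (rule range_eqI[of _ _ 0]) (simp add: K.zero)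
    show "shifted_hankel u f + shifted_hankel u g \<in> range (shifted_hankel u)" for f g
      by (simp flip: shifted_hankel_add)
    show "scaleC c (shifted_hankel u f) \<in> range (shifted_hankel u)" for c f
      by (rule range_eqI[of _ _ "scaleC (cnj c) f"]) (simp add: shifted_hankel_scaleC)
  qed
qed

lemma subspace_range_hankel: "hardy.subspace (range (hankel u))"
  unfolding hardy.subspace_def
proof safe
  have "hankel u 0 = 0" using hankel_scaleC[OF u, of 0 0] by simp
  then show "0 \<in> range (hankel u)" by (metis rangeI)
  show "hankel u f + hankel u g \<in> range (hankel u)" for f g
    by (simp flip: hankel_add[OF u])
  show "scaleC c (hankel u f) \<in> range (hankel u)" for c f
    by (rule range_eqI[of _ _ "scaleC (cnj c) f"]) (simp add: hankel_scaleC[OF u])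
qed

end

section \<open>Comparing the ranks of the two operators\<close>

lemma has_rank_unique:
  assumes "has_rank A p" "has_rank A q"
  shows "p = q"
  using assms hardy.dim_span_eq_card_independent unfolding has_rank_def by metis

lemma has_rank_leI:
  assumes "hardy.subspace (range A)" "finite T" "range A \<subseteq> hardy.span T"
  shows "\<exists>p\<le>card T. has_rank A p"
proof -
  obtain B where B: "B \<subseteq> range A" "\<not> hardy.dependent B" "range A \<subseteq> hardy.span B"
    by (rule hardy.maximal_independent_subset)
  have "finite B \<and> card B \<le> card T"
    using B assms by (intro hardy.independent_span_bound) auto
  moreover have "hardy.span B = range A"
    using B assms(1) by (metis hardy.span_minimal subset_antisym)
  ultimately show ?thesis using B unfolding has_rank_def by blast
qed

lemma has_rank_mono:
  assumes "has_rank A p" "has_rank B q" "range A \<subseteq> range B"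
  shows "p \<le> q"
proof -
  obtain S T where S: "card S = p" "\<not> hardy.dependent S" "hardy.span S = range A"
    and T: "finite T" "card T = q" "hardy.span T = range B"
    using assms(1,2) unfolding has_rank_def by blast
  have "S \<subseteq> hardy.span T" using S(3) T(3) assms(3) hardy.span_superset[of S] by blast
  then show ?thesis using hardy.independent_span_bound[OF T(1) S(2)] S T by simp
qed

text \<open>The backward shift maps the range of \<open>H\<close> onto that of \<open>K\<close> and
  kills only constants, so lifts of a basis of the range of \<open>K\<close>, together with the
  constant function, span at least the range of \<open>H\<close>.\<close>

lemma has_rank_hankel_exists:
  assumes u: "u \<in> sobolev (1/2)" and K: "has_rank (shifted_hankel u) q"
  shows "\<exists>p. has_rank (hankel u) p \<and> q \<le> p \<and> p \<le> q + 1"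
proof -
  obtain B where B: "finite B" "card B = q" "hardy.span B = range (shifted_hankel u)"
    using K unfolding has_rank_def by blast
  have "\<forall>b\<in>B. \<exists>h. b = shifted_hankel u h"
    using B(3) hardy.span_superset[of B] by (auto simp: image_iff)
  then obtain h where h: "\<And>b. b \<in> B \<Longrightarrow> b = shifted_hankel u (h b)" by metis
  let ?T = "insert (basis_fun 0) ((\<lambda>b. hankel u (h b)) ` B)"
  have "hankel u f \<in> hardy.span ?T" for f
  proof -
    have "shifted_hankel u f \<in> hardy.span B" using B by simp
    then obtain a where a: "shifted_hankel u f = (\<Sum>b\<in>B. scaleC (a b) b)"
      using hardy.span_finite[OF B(1)] by auto
    let ?g = "\<Sum>b\<in>B. scaleC (a b) (hankel u (h b))"
    \<comment> \<open>What remains of \<open>hankel u f\<close> after removing the lift of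
      \<open>shifted_hankel u f\<close>; its backward shift is 0, so it is constant.\<close>
    define r where "r = hankel u f - ?g"
    have "fourier (hankel u f - ?g) (int (Suc k)) = 0" for k
    proof -
      have "fourier (hankel u f - ?g) (int (Suc k)) = fourier (shifted_hankel u f) (int k)
          - (\<Sum>b\<in>B. a b * fourier (shifted_hankel u (h b)) (int k))"
        by (simp add: fourier_shifted_hankel[OF u])
      also have "(\<Sum>b\<in>B. a b * fourier (shifted_hankel u (h b)) (int k)) = (\<Sum>b\<in>B. a b * fourier b (int k))"
        by (intro sum.cong refl) (simp flip: h)
      also have "fourier (shifted_hankel u f) (int k) - \<dots> = 0" by (simp add: a)
      finally show ?thesis .
    qed
    then have r: "fourier r (int (Suc k)) = 0" for k unfolding r_def by blast
    have "r - scaleC (fourier r 0) (basis_fun 0) = 0"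
    proof (rule fourier_eq_0_imp)
      show "fourier (r - scaleC (fourier r 0) (basis_fun 0)) (int k) = 0" for k
        by (cases k) (simp_all only: fourier_diff fourier_scaleC fourier_basis_fun r, auto)
    qed
    then have "hankel u f = ?g + scaleC (fourier r 0) (basis_fun 0)"
      by (simp add: r_def algebra_simps)
    also have "\<dots> \<in> hardy.span ?T"
      by (intro hardy.span_add hardy.span_sum hardy.span_scale hardy.span_base) auto
    finally show ?thesis .
  qed
  then obtain p where p: "p \<le> card ?T" "has_rank (hankel u) p"
    using has_rank_leI[OF subspace_range_hankel[OF u], of ?T] B(1) by blast
  have "card ?T \<le> q + 1"
    using card_insert_le_m1 B card_image_le[OF B(1), of "\<lambda>b. hankel u (h b)"]
    by (metis Suc_eq_plus1 card_insert_if finite_imageI le_SucI not_less_eq_eq)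
  moreover have "q \<le> p"
    using K p(2) by (rule has_rank_mono) (auto simp: shifted_hankel_def)
  ultimately show ?thesis using p by auto
qed

text \<open>With \<open>q <= p <= q + 1\<close> the sum \<open>d = p + q\<close> determines both
  ranks, and \<open>q\<close> is \<open>d div 2\<close>.\<close>

lemma rank_class_iff:
  "u \<in> rank_class d \<longleftrightarrow> u \<in> sobolev (1/2) \<and>
     (\<exists>p. has_rank (hankel u) p \<and> has_rank (shifted_hankel u) (d div 2) \<and> p + d div 2 = d)"
proof
  assume "u \<in> rank_class d"
  then obtain p q where u: "u \<in> sobolev (1/2)" and pq: "has_rank (hankel u) p" "has_rank (shifted_hankel u) q" "p + q = d"
    by (auto simp: rank_class_def)
  obtain p' where "has_rank (hankel u) p'" "q \<le> p'" "p' \<le> q + 1"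
    using has_rank_hankel_exists[OF u pq(2)] by blast
  then have "q \<le> p" "p \<le> q + 1" using has_rank_unique[OF pq(1)] by auto
  then have "q = d div 2" using pq(3) by linarith
  then show "u \<in> sobolev (1/2) \<and>
     (\<exists>p. has_rank (hankel u) p \<and> has_rank (shifted_hankel u) (d div 2) \<and> p + d div 2 = d)"
    using u pq by auto
qed (auto simp: rank_class_def)

lemma rank_class_exists:
  assumes "u \<in> sobolev (1/2)" "has_rank (shifted_hankel u) q"
  shows "\<exists>d. u \<in> rank_class d \<and> d \<le> 2 * q + 1"
proof -
  obtain p where "has_rank (hankel u) p" "p \<le> q + 1"
    using has_rank_hankel_exists[OF assms] by blast
  then show ?thesis using assms unfolding rank_class_def by (intro exI[of _ "p + q"]) auto
qed

section \<open>Spectra of finite rank operators\<close>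

text \<open>Stated for a family because the iterates to which it is applied may repeat: a repetition
  is itself a linear relation, and without one the family is a set too large to be
  independent.\<close>

lemma family_dependent:
  assumes "finite B" "card B \<le> n" "\<And>k. k \<le> n \<Longrightarrow> x k \<in> hardy.span B"
  obtains c where "\<exists>k\<le>n. c k \<noteq> 0" "(\<Sum>k\<le>n. scaleC (c k) (x k)) = 0"
proof (cases "inj_on x {..n}")
  case True
  have "hardy.dependent (x ` {..n})"
  proof (rule ccontr)
    assume "\<not> hardy.dependent (x ` {..n})"
    then have "card (x ` {..n}) \<le> card B"
      using hardy.independent_span_bound[OF assms(1)] assms(3) by (metis atMost_iff image_subsetI)
    then show False using card_image[OF True] assms(2) by simp
  qed
  then obtain a where a: "\<exists>y\<in>x ` {..n}. a y \<noteq> 0" "(\<Sum>y\<in>x ` {..n}. scaleC (a y) y) = 0"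
    by (subst (asm) hardy.dependent_finite) auto
  show thesis
    by (rule that[of "a \<circ> x"]) (use a in \<open>auto simp: sum.reindex[OF True]\<close>)
next
  case False
  then obtain i j where ij: "i \<le> n" "j \<le> n" "i \<noteq> j" "x i = x j" by (auto simp: inj_on_def)
  define c where "c k = (if k = i then 1 else 0) - (if k = j then 1 else 0 :: complex)" for k
  have "(\<Sum>k\<le>n. scaleC (c k) (x k))
      = (\<Sum>k\<le>n. if k = i then x i else 0) - (\<Sum>k\<le>n. if k = j then x j else 0)"
    unfolding sum_subtractf[symmetric]
    by (intro sum.cong refl) (auto simp: c_def hardy.scale_left_diff_distrib)
  then show thesis using ij by (intro that[of c]) (auto simp: c_def)
qed

text \<open>The product of the factors \<open>A - l\<close>. The head acts first, so that peeling
  off one factor replaces a subspace by its image under \<open>A - l\<close>.\<close>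

primrec factor_op :: "(hardy \<Rightarrow> hardy) \<Rightarrow> complex list \<Rightarrow> hardy \<Rightarrow> hardy" where
  "factor_op A [] h = h"
| "factor_op A (l # ls) h = factor_op A ls (A h - scaleC l h)"

text \<open>The constant in a lower bound for \<open>A\<close> on vectors killed by \<open>n\<close>
  factors. If \<open>|g| <= D |A g|\<close> for \<open>g = A h - l h\<close>, with
  \<open>c <= |l| <= C\<close> and \<open>C\<close> bounding the norm of \<open>A\<close>, then
  \<open>|A g| <= 2 C |A h|\<close>, and \<open>c |h| <= |A h| + |g|\<close> gives the next value
  \<open>(1 + 2 C D) / c\<close>. The empty product kills only 0, whence the initial value.\<close>

primrec gap_const :: "real \<Rightarrow> real \<Rightarrow> nat \<Rightarrow> real" where
  "gap_const C c 0 = 0"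
| "gap_const C c (Suc n) = (1 + 2 * C * gap_const C c n) / c"

lemma gap_const_nonneg: "0 \<le> C \<Longrightarrow> 0 < c \<Longrightarrow> 0 \<le> gap_const C c n"
  by (induction n) auto

section \<open>Polynomials in a linear operator, eigenvectors and spectrum\<close>

context
  fixes A :: "hardy \<Rightarrow> hardy"
  assumes A_add: "\<And>f g. A (f + g) = A f + A g"
    and A_scaleC: "\<And>c f. A (scaleC c f) = scaleC c (A f)"
begin

lemma linear_op_zero: "A 0 = 0"
  using A_scaleC[of 0 0] by simp

lemma linear_op_diff: "A (f - g) = A f - A g"
proof -
  have "A (- g) = - A g" by (simp only: uminus_hardy_eq A_scaleC)
  then show ?thesis using A_add[of f "- g"] by simp
qed

lemma linear_op_sum: "A (\<Sum>i\<in>I. f i) = (\<Sum>i\<in>I. A (f i))"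
  by (induction I rule: infinite_finite_induct) (auto simp: linear_op_zero A_add)

text \<open>The cut-off \<open>n\<close> only has to dominate the degree; keeping it fixed makes a
  polynomial and its factors sums over the same range.\<close>

definition poly_op :: "nat \<Rightarrow> complex poly \<Rightarrow> hardy \<Rightarrow> hardy" where
  "poly_op n p w = (\<Sum>i\<le>n. scaleC (coeff p i) ((A ^^ i) w))"

lemma poly_op_linear_factor:
  assumes "degree q < n"
  shows "poly_op n ([:- z, 1:] * q) w = A (poly_op n q w) - scaleC z (poly_op n q w)"
proof -
  obtain m where m: "n = Suc m" using assms by (cases n) auto
  have qn: "coeff q n = 0" using assms by (simp add: coeff_eq_0)
  have "poly_op n ([:- z, 1:] * q) w
      = (\<Sum>i\<le>n. scaleC (coeff (pCons 0 q) i) ((A ^^ i) w)) - scaleC z (poly_op n q w)"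
    unfolding poly_op_def hardy.scale_sum_right sum_subtractf[symmetric]
    by (intro sum.cong refl) (simp add: algebra_simps flip: hardy.scale_left_diff_distrib)
  also have "(\<Sum>i\<le>n. scaleC (coeff (pCons 0 q) i) ((A ^^ i) w)) = (\<Sum>i\<le>m. scaleC (coeff q i) ((A ^^ Suc i) w))"
    unfolding m by (subst sum.atMost_Suc_shift) simp
  also have "\<dots> = A (poly_op n q w)"
    using qn unfolding poly_op_def m by (simp add: linear_op_sum A_scaleC A_add linear_op_zero)
  finally show ?thesis .
qed

text \<open>A root \<open>z\<close> splits \<open>p\<close> as \<open>(X - z) q\<close>. Either
  \<open>q\<close> in \<open>A\<close> sends \<open>w\<close> to a nonzero vector, which is an
  eigenvector for \<open>z\<close>, or \<open>q\<close> also annihilates \<open>w\<close> and has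
  smaller degree; a nonzero constant cannot annihilate \<open>w\<close>.\<close>

lemma eigenvector_of_annihilator:
  assumes "p \<noteq> 0" "degree p \<le> n" "poly_op n p w = 0" "w \<noteq> 0" "w \<in> W"
    and W: "hardy.subspace W" "\<And>f. f \<in> W \<Longrightarrow> A f \<in> W"
  shows "\<exists>l f. f \<in> W \<and> f \<noteq> 0 \<and> A f = scaleC l f"
  using assms(1-3)
proof (induction "degree p" arbitrary: p)
  case 0
  then obtain c where c: "p = [:c:]" by (metis degree_eq_zeroE)
  have "poly_op n p w = (\<Sum>i\<le>n. if i = 0 then scaleC c w else 0)"
    unfolding poly_op_def c by (intro sum.cong refl) (auto simp: coeff_pCons split: nat.split)
  then have "scaleC c w = 0" using 0 by simp
  then show ?case using c 0 assms(4) by (simp add: hardy.scale_eq_0_iff)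
next
  case (Suc d)
  then have "\<not> constant (poly p)" by (simp add: constant_degree)
  then obtain z where "poly p z = 0" using fundamental_theorem_of_algebra by blast
  then obtain q where q: "p = [:- z, 1:] * q" by (metis dvdE poly_eq_0_iff_dvd)
  have q0: "q \<noteq> 0" using q Suc.prems by auto
  then have deg: "degree p = Suc (degree q)" unfolding q by (subst degree_mult_eq) auto
  define g where "g = poly_op n q w"
  have powW: "(A ^^ i) w \<in> W" for i
    by (induction i) (use assms(5) W(2) in auto)
  have "g \<in> W" unfolding g_def poly_op_def
    by (intro hardy.subspace_sum[OF W(1)] hardy.subspace_scale[OF W(1)] powW)
  moreover have "A g - scaleC z g = 0"
    using poly_op_linear_factor[of q n z w] Suc.prems deg q by (simp add: g_def)
  ultimately show ?case
  proof (cases "g = 0")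
    case True
    then show ?thesis using Suc.hyps(1)[of q] Suc.hyps(2) Suc.prems deg q0 by (simp add: g_def)
  qed auto
qed

text \<open>The \<open>card B + 1\<close> vectors \<open>w, A w, A (A w), ...\<close> are dependent
  in the span of \<open>B\<close>, and a relation among them is a polynomial annihilating
  \<open>w\<close>.\<close>

lemma eigenvector_exists:
  assumes W: "hardy.subspace W" "\<And>f. f \<in> W \<Longrightarrow> A f \<in> W"
    and B: "finite B" "W \<subseteq> hardy.span B" and w: "w \<in> W" "w \<noteq> 0"
  shows "\<exists>l f. f \<in> W \<and> f \<noteq> 0 \<and> A f = scaleC l f"
proof -
  have powW: "(A ^^ i) w \<in> W" for i
    by (induction i) (use w W(2) in auto)
  obtain c where c: "\<exists>k\<le>card B. c k \<noteq> 0" "(\<Sum>k\<le>card B. scaleC (c k) ((A ^^ k) w)) = 0"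
    by (rule family_dependent[OF B(1) order_refl, of "\<lambda>k. (A ^^ k) w"]) (use powW B(2) in auto)
  define p where "p = (\<Sum>k\<le>card B. monom (c k) k)"
  have co: "coeff p i = (if i \<le> card B then c i else 0)" for i
    by (simp add: p_def coeff_sum)
  have "p \<noteq> 0" using c(1) co by (metis coeff_0)
  moreover have "degree p \<le> card B" by (rule degree_le) (simp add: co)
  moreover have "poly_op (card B) p w = 0" using c(2) by (simp add: poly_op_def co)
  ultimately show ?thesis using eigenvector_of_annihilator w W by blast
qed

text \<open>Induction on the dimension: if \<open>f\<close> is an eigenvector for \<open>l\<close>,
  the image \<open>W'\<close> of \<open>W\<close> under \<open>A - l\<close> is invariant and of
  smaller dimension, because \<open>A - l\<close> kills \<open>f\<close>. A list for
  \<open>W'\<close>, preceded by \<open>l\<close>, serves for \<open>W\<close>, and eigenvectors in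
  \<open>W'\<close> lie in \<open>W\<close>.\<close>

lemma eigenvalue_factorization:
  assumes "hardy.subspace W" "\<And>f. f \<in> W \<Longrightarrow> A f \<in> W"
    and "finite B" "card B \<le> n" "W \<subseteq> hardy.span B"
  shows "\<exists>ls. length ls \<le> n \<and> (\<forall>h\<in>W. factor_op A ls h = 0) \<and>
    (\<forall>l\<in>set ls. \<exists>f\<in>W. f \<noteq> 0 \<and> A f = scaleC l f)"
  using assms
proof (induction n arbitrary: W B)
  case 0
  then have "B = {}" by simp
  then have "\<forall>h\<in>W. h = 0" using 0 by auto
  then show ?case by (intro exI[of _ "[]"]) auto
next
  case (Suc n)
  show ?case
  proof (cases "W \<subseteq> {0}")
    case True
    then show ?thesis by (intro exI[of _ "[]"]) auto
  next
    case False
    then obtain l f where f: "f \<in> W" "f \<noteq> 0" "A f = scaleC l f"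
      using eigenvector_exists[OF Suc.prems(1,2,3,5)] by blast
    let ?T = "\<lambda>h. A h - scaleC l h"
    have T: "?T (g + h) = ?T g + ?T h" "?T (scaleC c h) = scaleC c (?T h)" for g h c
      by (simp_all add: A_add A_scaleC hardy.scale_right_distrib hardy.scale_right_diff_distrib mult.commute)
    have T0: "?T 0 = 0" by (simp add: linear_op_zero)
    have Tsum: "?T (\<Sum>i\<in>I. g i) = (\<Sum>i\<in>I. ?T (g i))" for I and g :: "hardy \<Rightarrow> hardy"
      by (simp add: linear_op_sum hardy.scale_sum_right sum_subtractf)
    define W' where "W' = ?T ` W"
    have TW: "?T h \<in> W" if "h \<in> W" for h
      by (intro hardy.subspace_diff[OF Suc.prems(1)] hardy.subspace_scale[OF Suc.prems(1)] that Suc.prems(2))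
    have sub: "hardy.subspace W'"
      unfolding hardy.subspace_def W'_def
    proof safe
      show "0 \<in> ?T ` W" 
        by (rule image_eqI[where x = 0]) (simp_all only: T0 hardy.subspace_0[OF Suc.prems(1)])
      show "?T g + ?T h \<in> ?T ` W" if "g \<in> W" "h \<in> W" for g h
        by (rule image_eqI[where x = "g + h"]) (simp_all only: T(1) hardy.subspace_add[OF Suc.prems(1) that])
      show "scaleC c (?T h) \<in> ?T ` W" if "h \<in> W" for c h
        by (rule image_eqI[where x = "scaleC c h"]) (simp_all only: T(2) hardy.subspace_scale[OF Suc.prems(1) that])
    qed
    have inv: "A g \<in> W'" if "g \<in> W'" for g
    proof -
      obtain h where h: "h \<in> W" "g = ?T h" using \<open>g \<in> W'\<close> by (auto simp: W'_def)
      have "A g = ?T (A h)" using h(2) by (simp add: linear_op_diff A_scaleC)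
      then show ?thesis using Suc.prems(2)[OF h(1)] by (auto simp: W'_def)
    qed
    \<comment> \<open>A basis of \<open>W\<close> through \<open>f\<close> is chosen; the image is
      spanned by the images of its other elements.\<close>
    have "\<not> hardy.dependent {f}" using f(2) by simp
    then obtain B' where B': "{f} \<subseteq> B'" "B' \<subseteq> W" "\<not> hardy.dependent B'" "W \<subseteq> hardy.span B'"
      using hardy.maximal_independent_subset_extend[of "{f}" W] f(1) by auto
    have "B' \<subseteq> hardy.span B" using B'(2) Suc.prems(5) by blast
    from hardy.independent_span_bound[OF Suc.prems(3) B'(3) this]
    have fin: "finite B'" "card B' \<le> Suc n" using Suc.prems(4) by auto
    let ?C = "?T ` (B' - {f})"
    have "W' \<subseteq> hardy.span ?C"
    proof
      fix g assume "g \<in> W'"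
      then obtain h where h: "h \<in> W" "g = ?T h" by (auto simp: W'_def)
      obtain a where "h = (\<Sum>b\<in>B'. scaleC (a b) b)"
        using B'(4) h(1) hardy.span_finite[OF fin(1)] by auto
      then have "g = (\<Sum>b\<in>B'. scaleC (a b) (?T b))"
        using h(2) by (simp only: Tsum T(2))
      also have "\<dots> = (\<Sum>b\<in>B' - {f}. scaleC (a b) (?T b))"
        by (rule sum.mono_neutral_right) (use fin f in auto)
      also have "\<dots> \<in> hardy.span ?C"
        by (intro hardy.span_sum hardy.span_scale hardy.span_base) auto
      finally show "g \<in> hardy.span ?C" .
    qed
    moreover have "finite ?C" "card ?C \<le> n"
    proof -
      have "card ?C \<le> card (B' - {f})" by (rule card_image_le) (use fin in auto)
      then show "card ?C \<le> n" using fin B'(1) by (simp add: card_Diff_singleton_if split: if_splits)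
    qed (use fin in auto)
    ultimately obtain ls where ls: "length ls \<le> n" "\<forall>h\<in>W'. factor_op A ls h = 0"
        "\<forall>l\<in>set ls. \<exists>f\<in>W'. f \<noteq> 0 \<and> A f = scaleC l f"
      using Suc.IH[OF sub inv, of ?C] by blast
    have "W' \<subseteq> W" using TW by (auto simp: W'_def)
    then have "\<forall>l\<in>set ls. \<exists>f\<in>W. f \<noteq> 0 \<and> A f = scaleC l f" using ls(3) by blast
    moreover have "\<forall>h\<in>W. factor_op A (l # ls) h = 0" using ls(2) by (simp add: W'_def)
    ultimately show ?thesis
      using ls(1) f by (intro exI[of _ "l # ls"]) auto
  qed
qed

lemma eigenvalue_in_spectrum:
  assumes "f \<noteq> 0" "A f = scaleC l f"
  shows "l \<in> spectrum A"
proof -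
  have "f = 0" if "bounded_linear R" "\<forall>f. R (A f - scaleC l f) = f" for R
    using that assms(2) bounded_linear.bounded_linear linear_0 by (metis bounded_linear.linear diff_self)
  then show ?thesis using assms(1) by (auto simp: spectrum_def)
qed

lemma bounded_linear_scaleC: "bounded_linear (scaleC c)"
  by (rule bounded_linear_intro[where K = "cmod c"])
    (auto simp: hardy.scale_right_distrib scaleR_hardy_eq mult.commute)

text \<open>Division with remainder: the product of the \<open>A - l\<close> is the number obtained
  by putting \<open>z\<close> for \<open>A\<close>, plus \<open>(A - z) Q\<close> with
  \<open>Q\<close> a polynomial in \<open>A\<close>, hence bounded and commuting with
  \<open>A\<close>.\<close>

lemma factor_op_remainder:
  assumes "bounded_linear A"
  shows "\<exists>Q. bounded_linear Q \<and> (\<forall>c h. Q (scaleC c h) = scaleC c (Q h)) \<and> (\<forall>h. Q (A h) = A (Q h)) \<and>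
     (\<forall>h. factor_op A ls h = scaleC (\<Prod>l\<leftarrow>ls. z - l) h + (A (Q h) - scaleC z (Q h)))"
proof (induction ls)
  case Nil
  show ?case by (intro exI[of _ "\<lambda>_. 0"]) (auto simp: linear_op_zero bounded_linear_zero)
next
  case (Cons l ls)
  then obtain Q where Q: "bounded_linear Q" "\<And>c h. Q (scaleC c h) = scaleC c (Q h)" "\<And>h. Q (A h) = A (Q h)"
    "\<And>h. factor_op A ls h = scaleC (\<Prod>l\<leftarrow>ls. z - l) h + (A (Q h) - scaleC z (Q h))" by blast
  interpret Q: bounded_linear Q by fact
  let ?P = "\<Prod>l\<leftarrow>ls. z - l"
  \<comment> \<open>With \<open>P\<close> for \<open>?P\<close>: \<open>P (A - l) + (A - z) Q (A -
    l) = P (z - l) + (A - z) (P + Q (A - l))\<close>.\<close>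
  define Q' where "Q' h = scaleC ?P h + Q (A h - scaleC l h)" for h
  have "bounded_linear Q'" unfolding Q'_def[abs_def]
    by (intro bounded_linear_add bounded_linear_scaleC bounded_linear_compose[OF Q(1)] bounded_linear_sub assms)
  moreover have "Q' (scaleC c h) = scaleC c (Q' h)" for c h
    by (simp add: Q'_def A_scaleC Q(2) Q.diff hardy.scale_right_distrib hardy.scale_right_diff_distrib mult.commute)
  moreover have "Q' (A h) = A (Q' h)" for h
    by (simp add: Q'_def A_add linear_op_diff A_scaleC Q(2,3) Q.diff)
  moreover have "factor_op A (l # ls) h = scaleC (\<Prod>l\<leftarrow>l # ls. z - l) h + (A (Q' h) - scaleC z (Q' h))" for h
    by (simp add: Q(4) Q'_def A_add linear_op_diff A_scaleC Q(2,3) Q.diff hardy.scale_right_distrib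
        hardy.scale_right_diff_distrib hardy.scale_left_diff_distrib mult.commute algebra_simps)
  ultimately show ?case by blast
qed

text \<open>If the product vanishes and its value \<open>P\<close> at \<open>z\<close> does not,
  then \<open>- Q / P\<close> from the division with remainder is a bounded inverse of
  \<open>A - z\<close>.\<close>

lemma spectrum_subset_factors:
  assumes bl: "bounded_linear A" and 0: "\<And>h. factor_op A ls h = 0"
  shows "spectrum A \<subseteq> set ls"
proof
  fix z assume z: "z \<in> spectrum A"
  show "z \<in> set ls"
  proof (rule ccontr)
    assume "z \<notin> set ls"
    then have P: "(\<Prod>l\<leftarrow>ls. z - l) \<noteq> 0" (is "?P \<noteq> 0") by (auto simp: prod_list_zero_iff)
    obtain Q where Q: "bounded_linear Q" "\<And>c h. Q (scaleC c h) = scaleC c (Q h)" "\<And>h. Q (A h) = A (Q h)"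
      "\<And>h. scaleC ?P h + (A (Q h) - scaleC z (Q h)) = 0"
      using factor_op_remainder[OF bl, of ls z] 0 by auto
    interpret Q: bounded_linear Q by fact
    define r where "r = - 1 / ?P"
    define R where "R h = scaleC r (Q h)" for h
    have R1: "A (R h) - scaleC z (R h) = h" for h
    proof -
      have "A (R h) - scaleC z (R h) = scaleC r (A (Q h) - scaleC z (Q h))"
        by (simp add: R_def A_scaleC hardy.scale_right_diff_distrib mult.commute)
      also have "A (Q h) - scaleC z (Q h) = scaleC (- ?P) h"
        using Q(4)[of h] by (simp add: eq_neg_iff_add_eq_0 add.commute)
      finally show ?thesis using P by (simp add: r_def)
    qed
    have "R (A h - scaleC z h) = A (R h) - scaleC z (R h)" for h
      by (simp add: R_def A_scaleC Q.diff Q(2,3) hardy.scale_right_diff_distrib mult.commute)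
    then have "R (A h - scaleC z h) = h" for h using R1 by simp
    moreover have "bounded_linear R" unfolding R_def[abs_def]
      by (rule bounded_linear_compose[OF bounded_linear_scaleC Q(1)])
    ultimately have "z \<notin> spectrum A" using R1 by (auto simp: spectrum_def)
    then show False using z by simp
  qed
qed

text \<open>Induction along the recursion of \<open>gap_const\<close>. The factors enter the
  constant only through their number and the bounds \<open>c\<close> and \<open>C\<close>, so it is
  uniform over all operators sharing these.\<close>

lemma factor_op_lower_bound:
  assumes C: "0 \<le> C" "\<And>h. norm (A h) \<le> C * norm h" and c: "0 < c"
    and ls: "\<And>l. l \<in> set ls \<Longrightarrow> c \<le> cmod l \<and> cmod l \<le> C"
    and 0: "factor_op A ls h = 0"
  shows "norm h \<le> gap_const C c (length ls) * norm (A h)"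
  using ls 0
proof (induction ls arbitrary: h)
  case (Cons l ls)
  let ?D = "gap_const C c (length ls)"
  define g where "g = A h - scaleC l h"
  have "norm g \<le> ?D * norm (A g)" using Cons by (simp add: g_def)
  also have "A g = A (A h) - scaleC l (A h)" by (simp add: g_def linear_op_diff A_scaleC)
  also have "norm \<dots> \<le> C * norm (A h) + C * norm (A h)"
    using C(2)[of "A h"] Cons.prems(1)[of l] mult_right_mono[of "cmod l" C "norm (A h)"]
    by (intro order_trans[OF norm_triangle_ineq4] add_mono) auto
  finally have g: "norm g \<le> ?D * (2 * C * norm (A h))"
    using gap_const_nonneg[OF C(1) c, of "length ls"] by (simp add: mult_left_mono)
  have "c * norm h \<le> cmod l * norm h" using Cons.prems(1)[of l] by (intro mult_right_mono) auto
  also have "\<dots> = norm (A h - g)" by (simp add: g_def)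
  also have "\<dots> \<le> norm (A h) + norm g" by (rule norm_triangle_ineq4)
  finally have "c * norm h \<le> (1 + 2 * C * ?D) * norm (A h)" using g by (simp add: algebra_simps)
  then show ?case using c by (simp add: field_simps)
qed simp

end

section \<open>Perturbation of ranks\<close>

text \<open>Independence in terms of coefficients forces the family to be injective; then the
  exchange lemma applies, and a family of full cardinality already spans.\<close>

lemma family_independent_card_le:
  assumes "finite B" "\<And>x. (\<Sum>b\<in>B. scaleC (x b) (y b)) = 0 \<Longrightarrow> \<forall>b\<in>B. x b = 0"
    and "finite T" "y ` B \<subseteq> hardy.span T"
  shows "card B \<le> card T"
    "card B = card T \<Longrightarrow> f \<in> hardy.span T \<Longrightarrow> \<exists>x. f = (\<Sum>b\<in>B. scaleC (x b) (y b))"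
proof -
  have inj: "inj_on y B"
  proof (rule inj_onI, rule ccontr)
    fix b c assume bc: "b \<in> B" "c \<in> B" "y b = y c" "b \<noteq> c"
    have "(\<Sum>a\<in>B. scaleC ((if a = b then 1 else 0) - (if a = c then 1 else 0)) (y a))
        = (\<Sum>a\<in>B. if a = b then y b else 0) - (\<Sum>a\<in>B. if a = c then y c else 0)"
      unfolding sum_subtractf[symmetric]
      by (intro sum.cong refl) (auto simp: hardy.scale_left_diff_distrib)
    also have "\<dots> = 0" using bc assms(1) by simp
    finally show False using assms(2)[of "\<lambda>a. (if a = b then 1 else 0) - (if a = c then 1 else 0)"] bc by auto
  qed
  have ind: "\<not> hardy.dependent (y ` B)"
  proof (rule hardy.independent_if_scalars_zero)
    fix a z assume a: "(\<Sum>z\<in>y ` B. scaleC (a z) z) = 0" and z: "z \<in> y ` B"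
    then have "(\<Sum>b\<in>B. scaleC (a (y b)) (y b)) = 0" by (simp add: sum.reindex[OF inj])
    then show "a z = 0" using assms(2)[of "\<lambda>b. a (y b)"] z by auto
  qed (use assms(1) in simp)
  have card: "card (y ` B) = card B" by (rule card_image[OF inj])
  show "card B \<le> card T"
    using hardy.independent_span_bound[OF assms(3) ind assms(4)] card by simp
  assume eq: "card B = card T" and f: "f \<in> hardy.span T"
  have "f \<in> hardy.span (y ` B)"
  proof (rule ccontr)
    assume n: "f \<notin> hardy.span (y ` B)"
    then have fy: "f \<notin> y ` B" by (auto intro: hardy.span_base)
    have "\<not> hardy.dependent (insert f (y ` B))" using n ind by (rule hardy.independent_insertI)
    then have "card (insert f (y ` B)) \<le> card T"
      using hardy.independent_span_bound[OF assms(3)] f assms(4) by blast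
    then show False using fy card eq assms(1) by simp
  qed
  then obtain a where "f = (\<Sum>z\<in>y ` B. scaleC (a z) z)"
    using hardy.span_finite[of "y ` B"] assms(1) by auto
  then have "f = (\<Sum>b\<in>B. scaleC (a (y b)) (y b))" by (simp add: sum.reindex[OF inj])
  then show "\<exists>x. f = (\<Sum>b\<in>B. scaleC (x b) (y b))" by (rule exI[of _ "\<lambda>b. a (y b)"])
qed

lemma has_rank_card_le:
  assumes "has_rank A N" "finite B" "\<And>b. b \<in> B \<Longrightarrow> y b \<in> range A"
    and "\<And>x. (\<Sum>b\<in>B. scaleC (x b) (y b)) = 0 \<Longrightarrow> \<forall>b\<in>B. x b = 0"
  shows "card B \<le> N"
    "card B = N \<Longrightarrow> f \<in> range A \<Longrightarrow> \<exists>x. f = (\<Sum>b\<in>B. scaleC (x b) (y b))"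
proof -
  obtain T where T: "finite T" "card T = N" "hardy.span T = range A"
    using assms(1) unfolding has_rank_def by blast
  have yT: "y ` B \<subseteq> hardy.span T" using assms(3) T(3) by auto
  note * = family_independent_card_le[OF assms(2,4) T(1) yT]
  show "card B \<le> N" using *(1) T(2) by simp
  show "card B = N \<Longrightarrow> f \<in> range A \<Longrightarrow> \<exists>x. f = (\<Sum>b\<in>B. scaleC (x b) (y b))"
    using *(2) T by simp
qed

section \<open>Injectivity on ranges and the spectral gap\<close>

lemma shifted_hankel_zero: "u \<in> sobolev (1/2) \<Longrightarrow> shifted_hankel u 0 = 0"
  using shifted_hankel_scaleC[of u 0 0] by simp

lemma shifted_hankel_sum:
  assumes "u \<in> sobolev (1/2)"
  shows "shifted_hankel u (\<Sum>i\<in>I. f i) = (\<Sum>i\<in>I. shifted_hankel u (f i))"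
  by (induction I rule: infinite_finite_induct)
    (auto simp: assms shifted_hankel_zero shifted_hankel_add)

text \<open>The images under \<open>K\<close> of a basis of the range of \<open>A\<close> stay
  independent: by antilinearity a relation among them says that \<open>K\<close> vanishes at the
  combination with conjugated coefficients.\<close>

lemma rank_le_of_injective_on_range:
  assumes w: "w \<in> sobolev (1/2)" "has_rank (shifted_hankel w) q"
    and v: "has_rank A N"
    and inj: "\<And>h. h \<in> range A \<Longrightarrow> shifted_hankel w h = 0 \<Longrightarrow> h = 0"
  shows "N \<le> q"
proof -
  obtain B where B: "finite B" "card B = N" "\<not> hardy.dependent B" "hardy.span B = range A"
    using v unfolding has_rank_def by blast
  have "card B \<le> q"
  proof (rule has_rank_card_le(1)[OF w(2) B(1)])
    fix x assume "(\<Sum>b\<in>B. scaleC (x b) (shifted_hankel w b)) = 0"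
    then have "shifted_hankel w (\<Sum>b\<in>B. scaleC (cnj (x b)) b) = 0"
      by (simp add: shifted_hankel_sum[OF w(1)] shifted_hankel_scaleC[OF w(1)])
    moreover have "(\<Sum>b\<in>B. scaleC (cnj (x b)) b) \<in> range A"
      unfolding B(4)[symmetric] by (intro hardy.span_sum hardy.span_scale hardy.span_base)
    ultimately have 0: "(\<Sum>b\<in>B. scaleC (cnj (x b)) b) = 0" by (rule inj[rotated])
    show "\<forall>b\<in>B. x b = 0"
      using hardy.independentD[OF B(3) B(1) order_refl 0] by simp
  qed auto
  then show ?thesis using B(2) by simp
qed

text \<open>On its range \<open>K\<close> is injective, so the factors \<open>K^2 - l\<close>
  annihilating the range have \<open>l\<close> nonzero. These \<open>l\<close> lie in the common
  finite spectrum, whose nonzero elements stay away from 0. The bound for \<open>K^2\<close> passes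
  to \<open>K\<close> through \<open>|K (K h)| <= M |K h|\<close>.\<close>

lemma spectral_gap:
  fixes v :: "nat \<Rightarrow> hardy"
  assumes v: "\<And>n. v n \<in> sobolev (1/2)" and C: "\<And>n. sobolev_norm (1/2) (v n) \<le> C"
    and rank: "\<And>n. has_rank (shifted_hankel (v n)) N"
    and spec: "\<And>m n. spectrum (shifted_hankel (v m) \<circ> shifted_hankel (v m))
             = spectrum (shifted_hankel (v n) \<circ> shifted_hankel (v n))"
  shows "\<exists>D. \<forall>n. \<forall>h\<in>range (shifted_hankel (v n)). norm h \<le> D * norm (shifted_hankel (v n) h)"
proof -
  define K where "K n = shifted_hankel (v n)" for n
  define A where "A n = K n \<circ> K n" for n
  define M where "M = 2 * C"
  have M0: "0 \<le> M" using C[of 0] sobolev_norm_nonneg[of "1/2" "v 0"] unfolding M_def by linarith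
  have Kb: "norm (K n h) \<le> M * norm h" for n h
  proof -
    have "norm (K n h) \<le> 2 * sobolev_norm (1/2) (v n) * norm h"
      unfolding K_def by (rule norm_shifted_hankel_le[OF v])
    also have "\<dots> \<le> M * norm h" unfolding M_def by (intro mult_right_mono mult_left_mono C) auto
    finally show ?thesis .
  qed
  have Ab: "norm (A n h) \<le> M * norm (K n h)" for n h unfolding A_def o_def by (rule Kb)
  have Ab2: "norm (A n h) \<le> (M * M) * norm h" for n h
    using order_trans[OF Ab mult_left_mono[OF Kb M0]] by (simp add: mult.assoc)
  have Al: "A n (f + g) = A n f + A n g" "A n (scaleC c f) = scaleC c (A n f)" for n f g c
    by (simp_all add: A_def K_def shifted_hankel_add[OF v] shifted_hankel_scaleC[OF v])
  have Abl: "bounded_linear (A n)" for n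
    by (rule bounded_linear_intro[where K = "M * M"])
      (use Ab2 in \<open>auto simp: Al scaleR_hardy_eq mult.commute\<close>)
  have inj: "h = 0" if "h \<in> range (K n)" "A n h = 0" for n h
  proof -
    obtain g where g: "h = K n g" using \<open>h \<in> range (K n)\<close> by auto
    have "K n (K n h) = 0" using that by (simp add: A_def)
    then have "K n h = 0" unfolding K_def by (rule shifted_hankel_inj_on_range[OF v])
    then show "h = 0" unfolding g K_def by (rule shifted_hankel_inj_on_range[OF v])
  qed
  have "\<exists>ls. length ls \<le> N \<and> (\<forall>h\<in>range (K n). factor_op (A n) ls h = 0) \<and>
      (\<forall>l\<in>set ls. \<exists>f\<in>range (K n). f \<noteq> 0 \<and> A n f = scaleC l f)" for n
  proof -
    obtain B where B: "finite B" "card B = N" "hardy.span B = range (K n)"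
      using rank[of n] unfolding has_rank_def K_def by blast
    show ?thesis
      by (rule eigenvalue_factorization[OF Al, where B = B])
        (use B subspace_range_shifted_hankel[OF v] in \<open>auto simp: K_def A_def\<close>)
  qed
  then obtain ls where ls: "\<And>n. length (ls n) \<le> N"
    "\<And>n h. h \<in> range (K n) \<Longrightarrow> factor_op (A n) (ls n) h = 0"
    "\<And>n l. l \<in> set (ls n) \<Longrightarrow> \<exists>f\<in>range (K n). f \<noteq> 0 \<and> A n f = scaleC l f" by metis
  define S where "S = spectrum (A 0)"
  have S: "spectrum (A n) = S" for n unfolding S_def A_def K_def by (rule spec)
  \<comment> \<open>The additional root 0 lets \<open>A\<close> act first: it maps every vector into
    the range, where the remaining product vanishes, so the whole product is zero and the spectrum
    is finite.\<close>
  have "S \<subseteq> set (0 # ls 0)" unfolding S_def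
  proof (rule spectrum_subset_factors[OF Al Abl])
    show "factor_op (A 0) (0 # ls 0) h = 0" for h
      using ls(2)[of "A 0 h" 0] by (simp add: A_def)
  qed
  then have finS: "finite S" by (rule finite_subset) simp
  \<comment> \<open>The element 1 keeps the minimum defined when the spectrum has no nonzero
    element.\<close>
  define c where "c = Min (insert 1 (cmod ` (S - {0})))"
  have c: "0 < c" "\<And>l. l \<in> S \<Longrightarrow> l \<noteq> 0 \<Longrightarrow> c \<le> cmod l"
    unfolding c_def using finS by auto
  \<comment> \<open>The number of factors may vary with \<open>n\<close> but is at most
    \<open>N\<close>; the sum dominates all these constants.\<close>
  define D where "D = (\<Sum>k\<le>N. gap_const (M * M) c k)"
  have MM: "0 \<le> M * M" using M0 by simp
  have "norm h \<le> (D * M) * norm (K n h)" if h: "h \<in> range (K n)" for n h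
  proof -
    have "norm h \<le> gap_const (M * M) c (length (ls n)) * norm (A n h)"
    proof (rule factor_op_lower_bound[OF Al MM Ab2 c(1) _ ls(2)[OF h]])
      fix l assume "l \<in> set (ls n)"
      then obtain f where f: "f \<in> range (K n)" "f \<noteq> 0" "A n f = scaleC l f" using ls(3) by blast
      have "l \<noteq> 0" using inj[OF f(1)] f by auto
      moreover have "l \<in> S" using eigenvalue_in_spectrum[OF Al f(2,3)] S by simp
      moreover have "cmod l * norm f \<le> M * M * norm f" using Ab2[of n f] f(3) by simp
      ultimately show "c \<le> cmod l \<and> cmod l \<le> M * M" using c(2) f(2) by simp
    qed
    also have "\<dots> \<le> D * norm (A n h)" unfolding D_def
      by (intro mult_right_mono member_le_sum gap_const_nonneg MM c) (use ls(1) in auto)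
    also have "\<dots> \<le> D * (M * norm (K n h))"
      by (intro mult_left_mono Ab) (auto simp: D_def intro!: sum_nonneg gap_const_nonneg MM c)
    finally show ?thesis by simp
  qed
  then show ?thesis unfolding K_def by blast
qed

text \<open>Continuity is required for coordinatewise convergence, a stronger demand than
  boundedness, because this is the convergence of \<open>K h\<close> that weak convergence of the
  symbols provides.\<close>

definition coord_functional :: "(hardy \<Rightarrow> complex) \<Rightarrow> bool" where
  "coord_functional \<phi> \<longleftrightarrow> (\<forall>f g. \<phi> (f + g) = \<phi> f + \<phi> g) \<and> (\<forall>c f. \<phi> (scaleC c f) = c * \<phi> f) \<and>
     (\<forall>X x. (\<forall>k. (\<lambda>n. fourier (X n) (int k)) \<longlonglongrightarrow> fourier x (int k)) \<longrightarrow> (\<lambda>n::nat. \<phi> (X n)) \<longlonglongrightarrow> \<phi> x)"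

lemma coord_functional_coord: "coord_functional (\<lambda>f. fourier f (int k))"
  by (auto simp: coord_functional_def)

lemma coord_functional_cmult: "coord_functional \<phi> \<Longrightarrow> coord_functional (\<lambda>f. c * \<phi> f)"
  by (auto simp: coord_functional_def algebra_simps intro: tendsto_mult_left)

lemma coord_functional_diff: "coord_functional \<phi> \<Longrightarrow> coord_functional \<psi> \<Longrightarrow> coord_functional (\<lambda>f. \<phi> f - \<psi> f)"
  by (auto simp: coord_functional_def algebra_simps intro: tendsto_diff)

lemma coord_functional_sum:
  assumes "\<And>i. i \<in> I \<Longrightarrow> coord_functional (\<phi> i)"
  shows "coord_functional (\<lambda>f. \<Sum>i\<in>I. \<phi> i f)"
  using assms
  by (auto simp: coord_functional_def sum.distrib sum_distrib_left intro!: tendsto_sum sum.cong)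

lemma coord_functional_linear_sum:
  assumes "coord_functional \<phi>"
  shows "\<phi> (\<Sum>i\<in>I. scaleC (x i) (f i)) = (\<Sum>i\<in>I. x i * \<phi> (f i))"
proof -
  have "\<phi> 0 = 0" using assms unfolding coord_functional_def by (metis hardy.scale_zero_left mult_zero_left)
  then show ?thesis
    using assms by (induction I rule: infinite_finite_induct) (auto simp: coord_functional_def)
qed

text \<open>A dual basis made from coordinates. A new vector \<open>a\<close> outside the span
  leaves a nonzero remainder \<open>g\<close>, which some coordinate \<open>k\<close>
  detects.\<close>

lemma biorthogonal_functionals:
  assumes "finite B" "\<not> hardy.dependent B"
  shows "\<exists>\<phi>. (\<forall>b\<in>B. coord_functional (\<phi> b)) \<and> (\<forall>b\<in>B. \<forall>c\<in>B. \<phi> b c = (if b = c then 1 else 0))"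
  using assms
proof (induction B rule: finite_induct)
  case (insert a B)
  have ind: "\<not> hardy.dependent B" "a \<notin> hardy.span B"
    using insert.prems insert.hyps by (auto simp: hardy.independent_insert)
  then obtain \<phi> where \<phi>: "\<And>b. b \<in> B \<Longrightarrow> coord_functional (\<phi> b)"
    "\<And>b c. b \<in> B \<Longrightarrow> c \<in> B \<Longrightarrow> \<phi> b c = (if b = c then 1 else 0)"
    using insert.IH by blast
  define g where "g = a - (\<Sum>b\<in>B. scaleC (\<phi> b a) b)"
  have "(\<Sum>b\<in>B. scaleC (\<phi> b a) b) \<in> hardy.span B"
    by (intro hardy.span_sum hardy.span_scale hardy.span_base)
  then have "g \<noteq> 0" using ind(2) by (auto simp: g_def)
  then obtain k where k: "fourier g (int k) \<noteq> 0" using fourier_eq_0_imp by blast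
  \<comment> \<open>Coordinate \<open>k\<close> of the remainder of \<open>f\<close>, normalized by
    that of \<open>a\<close>: it is 1 at \<open>a\<close> and 0 on \<open>B\<close>.\<close>
  define \<psi> where "\<psi> f = (1 / fourier g (int k)) * (fourier f (int k) - (\<Sum>b\<in>B. fourier b (int k) * \<phi> b f))" for f
  have \<psi>: "coord_functional \<psi>" unfolding \<psi>_def[abs_def]
    by (intro coord_functional_cmult coord_functional_diff coord_functional_sum coord_functional_coord \<phi>(1))
  have \<psi>B: "\<psi> c = 0" if "c \<in> B" for c
  proof -
    have "(\<Sum>b\<in>B. fourier b (int k) * \<phi> b c) = (\<Sum>b\<in>B. if b = c then fourier c (int k) else 0)"
      using that \<phi>(2) by (intro sum.cong) auto
    then show ?thesis using that insert.hyps by (simp add: \<psi>_def)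
  qed
  have \<psi>a: "\<psi> a = 1" using k by (simp add: \<psi>_def g_def mult.commute)
  define \<phi>' where "\<phi>' b f = (if b = a then \<psi> f else \<phi> b f - \<phi> b a * \<psi> f)" for b f
  have "coord_functional (\<phi>' b)" if "b \<in> insert a B" for b
    using that \<psi> coord_functional_diff[OF \<phi>(1) coord_functional_cmult[OF \<psi>]]
    by (cases "b = a") (auto simp: \<phi>'_def[abs_def])
  moreover have "\<phi>' b c = (if b = c then 1 else 0)" if "b \<in> insert a B" "c \<in> insert a B" for b c
    using that \<psi>B \<psi>a \<phi>(2) insert.hyps by (auto simp: \<phi>'_def)
  ultimately show ?case by blast
qed simp

text \<open>The deviation from the identity matrix contributes at most half of the left side and is
  absorbed there.\<close>

lemma near_identity_estimate:
  fixes \<Phi> :: "'a \<Rightarrow> 'a \<Rightarrow> complex"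
  assumes "finite B" and small: "(\<Sum>b\<in>B. \<Sum>c\<in>B. cmod (\<Phi> b c - (if b = c then 1 else 0))) \<le> 1/2"
  shows "(\<Sum>b\<in>B. cmod (x b)) \<le> 2 * (\<Sum>b\<in>B. cmod (\<Sum>c\<in>B. x c * \<Phi> b c))"
proof -
  let ?e = "\<lambda>b c. \<Phi> b c - (if b = c then 1 else 0)"
  let ?S = "\<Sum>b\<in>B. cmod (x b)"
  have S: "cmod (x c) \<le> ?S" if "c \<in> B" for c
    using that assms(1) by (intro member_le_sum) auto
  have pt: "cmod (x b) \<le> cmod (\<Sum>c\<in>B. x c * \<Phi> b c) + (\<Sum>c\<in>B. ?S * cmod (?e b c))" if "b \<in> B" for b
  proof -
    have "(\<Sum>c\<in>B. x c * \<Phi> b c) = (\<Sum>c\<in>B. (if b = c then x b else 0) + x c * ?e b c)"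
      by (intro sum.cong) (auto simp: algebra_simps)
    also have "\<dots> = x b + (\<Sum>c\<in>B. x c * ?e b c)" using that assms(1) by (simp add: sum.distrib)
    finally have "x b = (\<Sum>c\<in>B. x c * \<Phi> b c) - (\<Sum>c\<in>B. x c * ?e b c)" by simp
    then have "cmod (x b) \<le> cmod (\<Sum>c\<in>B. x c * \<Phi> b c) + cmod (\<Sum>c\<in>B. x c * ?e b c)"
      by (metis norm_triangle_ineq4)
    also have "cmod (\<Sum>c\<in>B. x c * ?e b c) \<le> (\<Sum>c\<in>B. ?S * cmod (?e b c))"
      by (rule order_trans[OF norm_sum sum_mono]) (auto simp: norm_mult intro!: mult_right_mono S)
    finally show ?thesis by simp
  qed
  have "?S \<le> (\<Sum>b\<in>B. cmod (\<Sum>c\<in>B. x c * \<Phi> b c) + (\<Sum>c\<in>B. ?S * cmod (?e b c)))"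
    by (rule sum_mono) (rule pt)
  also have "\<dots> = (\<Sum>b\<in>B. cmod (\<Sum>c\<in>B. x c * \<Phi> b c)) + ?S * (\<Sum>b\<in>B. \<Sum>c\<in>B. cmod (?e b c))"
    by (simp only: sum.distrib sum_distrib_left)
  also have "?S * (\<Sum>b\<in>B. \<Sum>c\<in>B. cmod (?e b c)) \<le> ?S * (1/2)"
    by (intro mult_left_mono small sum_nonneg) auto
  finally show ?thesis by simp
qed

text \<open>Quantitative independence of the family \<open>y\<close>. The factor 2 is the same for
  all families, so estimates based on it are uniform along a sequence of operators.\<close>

definition coeffs_controlled :: "'a set \<Rightarrow> ('a \<Rightarrow> hardy \<Rightarrow> complex) \<Rightarrow> ('a \<Rightarrow> hardy) \<Rightarrow> bool" where
  "coeffs_controlled B \<phi> y \<longleftrightarrow>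
     (\<forall>x. (\<Sum>b\<in>B. cmod (x b)) \<le> 2 * (\<Sum>b\<in>B. cmod (\<phi> b (\<Sum>c\<in>B. scaleC (x c) (y c)))))"

text \<open>In the limit the functionals \<open>\<phi> b\<close> form the identity matrix on the
  images of the \<open>h c\<close>; each of the finitely many entries converges, so along the
  sequence the matrix is eventually close to the identity.\<close>

lemma biorthogonal_perturbation:
  assumes conv: "\<And>h k. (\<lambda>n. fourier (shifted_hankel (v n) h) (int k)) \<longlonglongrightarrow> fourier (shifted_hankel w h) (int k)"
    and B: "finite B" "\<not> hardy.dependent B" "B \<subseteq> range (shifted_hankel w)"
  shows "\<exists>h \<phi>. (\<forall>b\<in>B. shifted_hankel w (h b) = b) \<and> (\<forall>b\<in>B. coord_functional (\<phi> b)) \<and>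
    eventually (\<lambda>n. coeffs_controlled B \<phi> (\<lambda>b. shifted_hankel (v n) (h b))) sequentially"
proof -
  have "\<forall>b\<in>B. \<exists>h. shifted_hankel w h = b" using B(3) by (auto simp: image_iff)
  then obtain h where h: "\<And>b. b \<in> B \<Longrightarrow> shifted_hankel w (h b) = b" by metis
  obtain \<phi> where \<phi>: "\<And>b. b \<in> B \<Longrightarrow> coord_functional (\<phi> b)"
    "\<And>b c. b \<in> B \<Longrightarrow> c \<in> B \<Longrightarrow> \<phi> b c = (if b = c then 1 else 0)"
    using biorthogonal_functionals[OF B(1,2)] by blast
  let ?s = "\<lambda>n. \<Sum>b\<in>B. \<Sum>c\<in>B. cmod (\<phi> b (shifted_hankel (v n) (h c)) - (if b = c then 1 else 0))"
  have "?s \<longlonglongrightarrow> (\<Sum>b\<in>B. \<Sum>c\<in>B. cmod (\<phi> b (shifted_hankel w (h c)) - (if b = c then 1 else 0)))"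
    using \<phi>(1) conv by (intro tendsto_intros) (auto simp: coord_functional_def)
  also have "(\<Sum>b\<in>B. \<Sum>c\<in>B. cmod (\<phi> b (shifted_hankel w (h c)) - (if b = c then 1 else 0))) = 0"
    by (intro sum.neutral ballI) (simp add: h \<phi>(2))
  finally have "eventually (\<lambda>n. ?s n < 1/2) sequentially" by (rule order_tendstoD(2)) simp
  then have "eventually (\<lambda>n. coeffs_controlled B \<phi> (\<lambda>b. shifted_hankel (v n) (h b))) sequentially"
  proof (rule eventually_mono, unfold coeffs_controlled_def, intro allI)
    fix n x assume "?s n < 1/2"
    then have "(\<Sum>b\<in>B. cmod (x b)) \<le> 2 * (\<Sum>b\<in>B. cmod (\<Sum>c\<in>B. x c * \<phi> b (shifted_hankel (v n) (h c))))"
      by (intro near_identity_estimate B(1)) simp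
    then show "(\<Sum>b\<in>B. cmod (x b)) \<le>
       2 * (\<Sum>b\<in>B. cmod (\<phi> b (\<Sum>c\<in>B. scaleC (x c) (shifted_hankel (v n) (h c)))))"
      by (simp add: coord_functional_linear_sum[OF \<phi>(1)])
  qed
  with h \<phi>(1) show ?thesis by blast
qed

lemma coeffs_controlled_independent:
  assumes "coeffs_controlled B \<phi> y"
    and "finite B" "\<And>b. b \<in> B \<Longrightarrow> coord_functional (\<phi> b)" "(\<Sum>c\<in>B. scaleC (x c) (y c)) = 0"
  shows "\<forall>b\<in>B. x b = 0"
proof -
  have "\<phi> b 0 = 0" if "b \<in> B" for b
    using coord_functional_linear_sum[OF assms(3)[OF that], of "\<lambda>_. 0" "\<lambda>_. 0" "{}"] by simp
  then have "(\<Sum>b\<in>B. cmod (x b)) \<le> 0" using assms(1,4) unfolding coeffs_controlled_def by (auto dest!: spec[of _ x])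
  then have "(\<Sum>b\<in>B. cmod (x b)) = 0" by (intro antisym sum_nonneg) auto
  then show ?thesis using sum_nonneg_eq_0_iff[OF assms(2), of "\<lambda>b. cmod (x b)"] by simp
qed

text \<open>A finite independent set in the range of the limit has preimages whose images under some
  \<open>shifted_hankel (v n)\<close> are still independent, so it has at most \<open>N\<close>
  elements. This also yields that the range of the limit has finite dimension.\<close>

lemma rank_lower_semicontinuous:
  assumes w: "w \<in> sobolev (1/2)"
    and rank: "\<And>n. has_rank (shifted_hankel (v n)) N"
    and conv: "\<And>h k. (\<lambda>n. fourier (shifted_hankel (v n) h) (int k)) \<longlonglongrightarrow> fourier (shifted_hankel w h) (int k)"
  shows "\<exists>q\<le>N. has_rank (shifted_hankel w) q"
proof -
  have card: "card B \<le> N" if B: "finite B" "\<not> hardy.dependent B" "B \<subseteq> range (shifted_hankel w)" for B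
  proof -
    obtain h \<phi> where \<phi>: "\<And>b. b \<in> B \<Longrightarrow> coord_functional (\<phi> b)" and
      ev: "eventually (\<lambda>n. coeffs_controlled B \<phi> (\<lambda>b. shifted_hankel (v n) (h b))) sequentially"
      using biorthogonal_perturbation[OF conv B] by blast
    from eventually_happens[OF ev] obtain n where n: "coeffs_controlled B \<phi> (\<lambda>b. shifted_hankel (v n) (h b))" by auto
    show ?thesis
      by (rule has_rank_card_le(1)[OF rank[of n] B(1), of "\<lambda>c. shifted_hankel (v n) (h c)"])
        (use coeffs_controlled_independent[OF n B(1) \<phi>] in auto)
  qed
  obtain B where B: "B \<subseteq> range (shifted_hankel w)" "\<not> hardy.dependent B" "range (shifted_hankel w) \<subseteq> hardy.span B"
    by (rule hardy.maximal_independent_subset)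
  have fin: "finite B"
  proof (rule ccontr)
    assume "infinite B"
    then obtain B' where B': "B' \<subseteq> B" "finite B'" "card B' = Suc N"
      using infinite_arbitrarily_large by metis
    then have "card B' \<le> N" using B hardy.independent_mono by (intro card) blast+
    then show False using B'(3) by simp
  qed
  have "hardy.span B = range (shifted_hankel w)"
    using B hardy.span_minimal[OF B(1) subspace_range_shifted_hankel[OF w]] by blast
  then have "has_rank (shifted_hankel w) (card B)" using fin B unfolding has_rank_def by blast
  then show ?thesis using card[OF fin B(2,1)] by blast
qed

section \<open>Exponential decay of the coefficients at a uniform rate\<close>

lemma fourier_tendsto_zero: "(\<lambda>k. fourier f (int k)) \<longlonglongrightarrow> 0"
proof -
  have "(\<lambda>k. (cmod (fourier f (int k)))\<^sup>2) \<longlonglongrightarrow> 0"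
    using Parseval[of f] by (intro summable_LIMSEQ_zero) (rule sums_summable)
  then have "(\<lambda>k. sqrt ((cmod (fourier f (int k)))\<^sup>2)) \<longlonglongrightarrow> sqrt 0" by (intro tendsto_intros)
  then show ?thesis by (simp add: tendsto_norm_zero_iff)
qed

text \<open>The contraction is measured by \<open>p\<close>, the sum of the moduli of the dual
  functionals, because \<open>p\<close> passes to the limit under coordinatewise convergence; on the
  range it controls the coefficients in the basis of images, hence the vectors.\<close>

lemma uniform_exponential_decay:
  assumes v: "\<And>n. v n \<in> sobolev (1/2)" and C: "\<And>n. sobolev_norm (1/2) (v n) \<le> C"
    and w: "w \<in> sobolev (1/2)"
    and rank: "\<And>n. has_rank (shifted_hankel (v n)) N" "has_rank (shifted_hankel w) N"
    and conv: "\<And>h k. (\<lambda>n. fourier (shifted_hankel (v n) h) (int k)) \<longlonglongrightarrow> fourier (shifted_hankel w h) (int k)"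
  shows "\<exists>m\<ge>1. \<exists>E. eventually (\<lambda>n. \<forall>k j. cmod (fourier (v n) (int (Suc (j + m * k)))) \<le> E * (1/2) ^ k) sequentially"
proof -
  obtain B where B: "finite B" "card B = N" "\<not> hardy.dependent B" "hardy.span B = range (shifted_hankel w)"
    using rank(2) unfolding has_rank_def by blast
  have Bsub: "B \<subseteq> range (shifted_hankel w)" using B(4) hardy.span_superset by blast
  obtain h \<phi> where h: "\<And>b. b \<in> B \<Longrightarrow> shifted_hankel w (h b) = b"
    and \<phi>: "\<And>b. b \<in> B \<Longrightarrow> coord_functional (\<phi> b)" and
    ev: "eventually (\<lambda>n. coeffs_controlled B \<phi> (\<lambda>b. shifted_hankel (v n) (h b))) sequentially"
    using biorthogonal_perturbation[OF conv B(1,3) Bsub] by blast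
  define p where "p f = (\<Sum>b\<in>B. cmod (\<phi> b f))" for f
  \<comment> \<open>By the intertwining relation this measures the \<open>m\<close>-fold backward
    shift on the basis of images.\<close>
  define \<tau> where "\<tau> u m = (\<Sum>c\<in>B. p (shifted_hankel u ((shift ^^ m) (h c))))" for u m
  have p0: "0 \<le> p f" for f by (simp add: p_def sum_nonneg)
  have p_tendsto: "(\<lambda>n. p (X n)) \<longlonglongrightarrow> p x"
    if "\<And>k. (\<lambda>n. fourier (X n) (int k)) \<longlonglongrightarrow> fourier x (int k)" for X :: "nat \<Rightarrow> hardy" and x
    unfolding p_def using that \<phi> by (intro tendsto_intros) (auto simp: coord_functional_def)
  have "p 0 = 0"
  proof -
    have "\<phi> b 0 = 0" if "b \<in> B" for b
      using coord_functional_linear_sum[OF \<phi>[OF that], of "\<lambda>_. 0" "\<lambda>_. 0" "{}"] by simp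
    then show ?thesis by (simp add: p_def)
  qed
  have "(\<lambda>m. \<tau> w m) \<longlonglongrightarrow> (\<Sum>c\<in>B. p 0)" unfolding \<tau>_def
  proof (intro tendsto_sum p_tendsto)
    fix c k
    have "(\<lambda>m. fourier (shifted_hankel w (h c)) (int (m + k))) \<longlonglongrightarrow> 0"
      by (rule LIMSEQ_ignore_initial_segment[OF fourier_tendsto_zero])
    then show "(\<lambda>m. fourier (shifted_hankel w ((shift ^^ m) (h c))) (int k)) \<longlonglongrightarrow> fourier 0 (int k)"
      by (simp add: fourier_shifted_hankel_shift_pow[OF w] add.commute)
  qed
  \<comment> \<open>Recovering coefficients costs a factor 2, so the threshold 1/4 makes the
    \<open>m\<close>-fold backward shift halve \<open>p\<close>.\<close>
  then have "eventually (\<lambda>m. \<tau> w m < 1/4) sequentially"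
    by (intro order_tendstoD(2)) (auto simp: \<open>p 0 = 0\<close>)
  then obtain m where m: "m \<ge> 1" "\<tau> w m < 1/4"
    unfolding eventually_sequentially by (metis max.cobounded1 max.cobounded2)
  have "(\<lambda>n. \<tau> (v n) m) \<longlonglongrightarrow> \<tau> w m" unfolding \<tau>_def by (intro tendsto_sum p_tendsto conv)
  then have ev2: "eventually (\<lambda>n. \<tau> (v n) m < 1/4) sequentially" using m(2) by (rule order_tendstoD(2))
  have "(\<lambda>n. p (shifted_hankel (v n) (basis_fun 0))) \<longlonglongrightarrow> p (shifted_hankel w (basis_fun 0))"
    by (intro p_tendsto conv)
  then have ev3: "eventually (\<lambda>n. p (shifted_hankel (v n) (basis_fun 0)) < p (shifted_hankel w (basis_fun 0)) + 1) sequentially"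
    by (rule order_tendstoD(2)) simp
  define H where "H = (\<Sum>b\<in>B. norm (h b))"
  define E where "E = 4 * C * H * (p (shifted_hankel w (basis_fun 0)) + 1)"
  have C0: "0 \<le> C" using C[of 0] sobolev_norm_nonneg[of "1/2" "v 0"] by linarith
  have H0: "0 \<le> H" by (simp add: H_def sum_nonneg)
  have "eventually (\<lambda>n. \<forall>k j. cmod (fourier (v n) (int (Suc (j + m * k)))) \<le> E * (1/2) ^ k) sequentially"
    using ev ev2 ev3
  proof eventually_elim
    case (elim n)
    define K where "K = shifted_hankel (v n)"
    \<comment> \<open>The equality of the ranks enters here: \<open>N\<close> independent vectors of
      the range span it.\<close>
    have expand: "\<exists>x. K g = (\<Sum>b\<in>B. scaleC (x b) (K (h b)))" for g
      by (rule has_rank_card_le(2)[OF rank(1)[of n] B(1)])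
        (use coeffs_controlled_independent[OF elim(1) B(1) \<phi>] B(2) in \<open>auto simp: K_def\<close>)
    have est: "(\<Sum>b\<in>B. cmod (x b)) \<le> 2 * p (K g)" if "K g = (\<Sum>b\<in>B. scaleC (x b) (K (h b)))" for g x
      unfolding that p_def using elim(1) unfolding K_def coeffs_controlled_def by blast
    have contr: "p (K ((shift ^^ m) g)) \<le> (1/2) * p (K g)" for g
    proof -
      obtain x where x: "K g = (\<Sum>b\<in>B. scaleC (x b) (K (h b)))" using expand by blast
      have "K ((shift ^^ m) g) = (\<Sum>b\<in>B. scaleC (x b) (K ((shift ^^ m) (h b))))"
      proof (rule hardy_eqI)
        fix k
        have "fourier (K ((shift ^^ m) g)) (int k) = fourier (K g) (int (k + m))"
          unfolding K_def by (rule fourier_shifted_hankel_shift_pow[OF v])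
        also have "\<dots> = (\<Sum>b\<in>B. x b * fourier (K (h b)) (int (k + m)))" by (simp only: x fourier_sum fourier_scaleC)
        also have "\<dots> = fourier (\<Sum>b\<in>B. scaleC (x b) (K ((shift ^^ m) (h b)))) (int k)"
          unfolding K_def fourier_sum fourier_scaleC fourier_shifted_hankel_shift_pow[OF v] ..
        finally show "fourier (K ((shift ^^ m) g)) (int k) = fourier (\<Sum>b\<in>B. scaleC (x b) (K ((shift ^^ m) (h b)))) (int k)" .
      qed
      then have "p (K ((shift ^^ m) g)) = (\<Sum>c\<in>B. cmod (\<Sum>b\<in>B. x b * \<phi> c (K ((shift ^^ m) (h b)))))"
        by (simp add: p_def coord_functional_linear_sum[OF \<phi>])
      also have "\<dots> \<le> (\<Sum>c\<in>B. \<Sum>b\<in>B. cmod (x b) * cmod (\<phi> c (K ((shift ^^ m) (h b)))))"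
        by (intro sum_mono order_trans[OF norm_sum]) (simp add: norm_mult)
      also have "\<dots> = (\<Sum>b\<in>B. cmod (x b) * p (K ((shift ^^ m) (h b))))"
        unfolding p_def sum_distrib_left by (rule sum.swap)
      also have "\<dots> \<le> (\<Sum>b\<in>B. cmod (x b) * \<tau> (v n) m)"
        unfolding \<tau>_def K_def by (intro sum_mono mult_left_mono member_le_sum B(1) p0) auto
      also have "\<dots> = (\<Sum>b\<in>B. cmod (x b)) * \<tau> (v n) m" by (simp add: sum_distrib_right)
      also have "\<dots> \<le> (2 * p (K g)) * (1/4)"
        using elim(2) by (intro mult_mono est x) (auto simp: p0 \<tau>_def intro!: sum_nonneg)
      finally show ?thesis by simp
    qed
    have iter: "p (K ((shift ^^ (m * k)) g)) \<le> (1/2) ^ k * p (K g)" for k g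
    proof (induction k arbitrary: g)
      case (Suc k)
      have "p (K ((shift ^^ (m * Suc k)) g)) = p (K ((shift ^^ (m * k)) ((shift ^^ m) g)))"
        by (simp add: funpow_add[symmetric, unfolded o_def fun_eq_iff, rule_format] add.commute)
      also have "\<dots> \<le> (1/2) ^ k * p (K ((shift ^^ m) g))" by (rule Suc)
      also have "\<dots> \<le> (1/2) ^ k * ((1/2) * p (K g))" by (intro mult_left_mono contr) auto
      finally show ?case by simp
    qed simp
    have coord: "cmod (fourier (K g) (int j)) \<le> 4 * C * H * p (K g)" for g j
    proof -
      obtain x where x: "K g = (\<Sum>b\<in>B. scaleC (x b) (K (h b)))" using expand by blast
      have "cmod (fourier (K g) (int j)) \<le> (\<Sum>b\<in>B. cmod (x b) * cmod (fourier (K (h b)) (int j)))"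
        unfolding x fourier_sum fourier_scaleC by (intro order_trans[OF norm_sum]) (simp add: norm_mult)
      also have "\<dots> \<le> (\<Sum>b\<in>B. cmod (x b) * (2 * C * H))"
      proof (intro sum_mono mult_left_mono)
        fix b assume b: "b \<in> B"
        have "cmod (fourier (K (h b)) (int j)) \<le> norm (K (h b))" by (rule norm_fourier_le)
        also have "\<dots> \<le> 2 * sobolev_norm (1/2) (v n) * norm (h b)"
          unfolding K_def by (rule norm_shifted_hankel_le[OF v])
        also have "\<dots> \<le> 2 * C * H"
          unfolding H_def using C0 by (intro mult_mono C member_le_sum b B(1)) auto
        finally show "cmod (fourier (K (h b)) (int j)) \<le> 2 * C * H" .
      qed auto
      also have "\<dots> = (\<Sum>b\<in>B. cmod (x b)) * (2 * C * H)" by (simp add: sum_distrib_right)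
      also have "\<dots> \<le> (2 * p (K g)) * (2 * C * H)" using C0 H0 by (intro mult_right_mono est x) auto
      finally show ?thesis by (simp add: mult_ac)
    qed
    show ?case
    proof (intro allI)
      fix k j
      \<comment> \<open>From index 1 on, the coefficients of \<open>v n\<close> are those of
        \<open>K\<close> at the constant function; \<open>m * k\<close> backward shifts bring the
        index down to \<open>j\<close>.\<close>
      have "fourier (v n) (int (Suc (j + m * k))) = fourier (K ((shift ^^ (m * k)) (basis_fun 0))) (int j)"
        unfolding K_def fourier_shifted_hankel_shift_pow[OF v] fourier_shifted_hankel_basis_fun[OF v] by simp
      then have "cmod (fourier (v n) (int (Suc (j + m * k)))) \<le> 4 * C * H * p (K ((shift ^^ (m * k)) (basis_fun 0)))"
        using coord by simp
      also have "\<dots> \<le> 4 * C * H * ((1/2) ^ k * p (K (basis_fun 0)))"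
        using C0 H0 by (intro mult_left_mono iter) auto
      also have "\<dots> \<le> 4 * C * H * ((1/2) ^ k * (p (shifted_hankel w (basis_fun 0)) + 1))"
        using C0 H0 elim(3) unfolding K_def by (intro mult_left_mono) auto
      finally show "cmod (fourier (v n) (int (Suc (j + m * k)))) \<le> E * (1/2) ^ k"
        by (simp only: E_def mult_ac)
    qed
  qed
  then show ?thesis using m(1) by blast
qed

text \<open>Halving once per block of length \<open>m\<close> is geometric decay with ratio
  \<open>\<rho> = (1/2)^(1/m)\<close>, which beats the polynomial weight for every \<open>s\<close>.
  The bound \<open>M\<close> is fixed before \<open>u\<close>.\<close>

lemma sobolev_bound_of_decay:
  assumes m: "m \<ge> 1"
  shows "\<exists>M. \<forall>u. (\<forall>k j. cmod (fourier u (int (Suc (j + m * k)))) \<le> E * (1/2) ^ k) \<and> cmod (fourier u 0) \<le> E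
    \<longrightarrow> u \<in> sobolev s \<and> sobolev_norm s u \<le> M"
proof -
  define \<rho> :: real where "\<rho> = (1/2) powr (1 / real m)"
  have \<rho>: "0 < \<rho>" "\<rho> < 1"
    using m powr_less_mono'[of "1/2" 0 "1 / real m"] by (auto simp: \<rho>_def)
  define g where "g i = (1 + (real i)\<^sup>2) powr s * (16 * E\<^sup>2 * (\<rho>\<^sup>2) ^ i)" for i :: nat
  have sg: "summable g"
  proof (rule summable_comparison_test_ev)
    \<comment> \<open>Of the two factors \<open>\<rho> ^ i\<close>, one absorbs the weight and the
      other leaves a convergent geometric series.\<close>
    have "(\<lambda>i::nat. (1 + (real i)\<^sup>2) powr s * \<rho> ^ i) \<longlonglongrightarrow> 0" using \<rho> by real_asymp
    then have "eventually (\<lambda>i. (1 + (real i)\<^sup>2) powr s * \<rho> ^ i < 1) sequentially"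
      by (rule order_tendstoD(2)) simp
    then show "eventually (\<lambda>i. norm (g i) \<le> 16 * E\<^sup>2 * \<rho> ^ i) sequentially"
    proof eventually_elim
      case (elim i)
      have "g i = 16 * E\<^sup>2 * \<rho> ^ i * ((1 + (real i)\<^sup>2) powr s * \<rho> ^ i)"
        by (simp add: g_def power2_eq_square power_mult_distrib)
      also have "\<dots> \<le> 16 * E\<^sup>2 * \<rho> ^ i * 1" using elim \<rho> by (intro mult_left_mono) auto
      finally show ?case by (simp add: g_def)
    qed
    show "summable (\<lambda>i. 16 * E\<^sup>2 * \<rho> ^ i)" using \<rho> by (intro summable_mult summable_geometric) auto
  qed
  \<comment> \<open>Rounding loses at most two blocks, \<open>(i - 1) div m > i / m - 2\<close>,
    whence the factor 4; its square is the 16 in \<open>g\<close>.\<close>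
  have half: "(1/2::real) ^ ((i - 1) div m) \<le> 4 * \<rho> ^ i" for i
  proof -
    let ?q = "(i - 1) div m"
    have "i - 1 < m + m * ?q" using m by (intro dividend_less_times_div) simp
    then have "real (i - 1) < real m + real m * real ?q"
      by (metis of_nat_add of_nat_less_iff of_nat_mult)
    moreover have "real i \<le> real (i - 1) + 1" "1 \<le> real m" using m by auto
    ultimately have "real i < (real ?q + 2) * real m" by (simp add: algebra_simps)
    then have "real i / real m < real ?q + 2" using m by (simp add: pos_divide_less_eq)
    then have "(1/2::real) powr (real ((i - 1) div m)) \<le> (1/2) powr (real i / real m - 2)"
      by (intro powr_mono') auto
    also have "\<dots> = 4 * (1/2) powr (real i / real m)"
      by (simp add: powr_diff power2_eq_square)
    also have "(1/2) powr (real i / real m) = \<rho> ^ i"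
      using powr_realpow[OF \<rho>(1), of i] by (simp add: \<rho>_def powr_powr)
    finally show ?thesis by (simp add: powr_realpow)
  qed
  show ?thesis
  proof (intro exI[of _ "sqrt (suminf g)"] allI impI)
    fix u assume u: "(\<forall>k j. cmod (fourier u (int (Suc (j + m * k)))) \<le> E * (1/2) ^ k) \<and> cmod (fourier u 0) \<le> E"
    have E0: "0 \<le> E" by (rule order_trans[OF norm_ge_zero conjunct2[OF u]])
    have "cmod (fourier u (int i)) \<le> E * (1/2) ^ ((i - 1) div m)" for i
    proof (cases i)
      case (Suc i')
      have "i = Suc (i' mod m + m * (i' div m))" using Suc by simp
      then show ?thesis using u Suc by (metis diff_Suc_1)
    qed (use u in simp)
    then have b: "cmod (fourier u (int i)) \<le> E * (4 * \<rho> ^ i)" for i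
      using mult_left_mono[OF half[of i] E0] order_trans by blast
    have le: "sobolev_term s u i \<le> g i" for i
    proof -
      have "(cmod (fourier u (int i)))\<^sup>2 \<le> (E * (4 * \<rho> ^ i))\<^sup>2" by (intro power_mono b) simp
      also have "\<dots> = 16 * E\<^sup>2 * (\<rho>\<^sup>2) ^ i" by (simp add: power_mult_distrib power_mult[symmetric] mult.commute)
      finally show ?thesis unfolding sobolev_term_def g_def by (intro mult_left_mono) auto
    qed
    have su: "summable (sobolev_term s u)"
      by (rule summable_comparison_test'[OF sg, of 0]) (use le in auto)
    moreover have "(sobolev_norm s u)\<^sup>2 \<le> suminf g"
      using sobolev_norm_sq[of u s] suminf_le[OF le su sg] su by (simp add: sobolev_iff sums_iff)
    ultimately show "u \<in> sobolev s \<and> sobolev_norm s u \<le> sqrt (suminf g)"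
      by (simp add: sobolev_iff real_le_rsqrt)
  qed
qed

section \<open>Weak compactness\<close>

lemma sobolev_weight_pos: "0 < (1 + (real k)\<^sup>2) powr s"
proof -
  have "0 < 1 + (real k)\<^sup>2" by (rule add_pos_nonneg) auto
  then show ?thesis by (simp only: powr_gt_zero)
qed

lemma hankel_add_symbol:
  assumes "u \<in> sobolev (1/2)" "w \<in> sobolev (1/2)"
  shows "hankel (u + w) h = hankel u h + hankel w h"
proof (rule hardy_eqI)
  fix k
  show "fourier (hankel (u + w) h) (int k) = fourier (hankel u h + hankel w h) (int k)"
    using sums_add[OF fourier_hankel[OF assms(1), of k h] fourier_hankel[OF assms(2), of k h]]
      fourier_hankel[OF sobolev_add[OF assms], of k h]
    by (auto simp: algebra_simps dest: sums_unique2)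
qed

lemma hankel_scaleC_symbol:
  assumes "u \<in> sobolev (1/2)"
  shows "hankel (scaleC c u) h = scaleC c (hankel u h)"
proof (rule hardy_eqI)
  fix k
  show "fourier (hankel (scaleC c u) h) (int k) = fourier (scaleC c (hankel u h)) (int k)"
    using sums_mult[OF fourier_hankel[OF assms, of k h], of c]
      fourier_hankel[OF sobolev_scaleC[OF assms], of c k h]
    by (auto simp: algebra_simps dest: sums_unique2)
qed

text \<open>For fixed \<open>h\<close> the coefficient is linear in the symbol and bounded by the
  Hankel norm estimate, so weak convergence can be tested on it.\<close>

lemma sobolev_functional_hankel: "sobolev_functional (1/2) (\<lambda>u. fourier (hankel u h) (int k))"
  unfolding sobolev_functional_def
proof (intro conjI ballI allI exI)
  fix f :: hardy assume f: "f \<in> sobolev (1/2)"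
  have "cmod (fourier (hankel f h) (int k)) \<le> norm (hankel f h)" by (rule norm_fourier_le)
  also have "\<dots> \<le> 2 * sobolev_norm (1/2) f * norm h" by (rule norm_hankel_le[OF f])
  finally show "cmod (fourier (hankel f h) (int k)) \<le> (2 * norm h) * sobolev_norm (1/2) f"
    by (simp add: mult_ac)
qed (simp_all add: hankel_add_symbol hankel_scaleC_symbol)

lemma weakly_converges_hankel:
  assumes "sobolev_weakly_converges (1/2) v w"
  shows "(\<lambda>n. fourier (hankel (v n) h) (int k)) \<longlonglongrightarrow> fourier (hankel w h) (int k)"
  using assms sobolev_functional_hankel unfolding sobolev_weakly_converges_def by blast

text \<open>The Hankel operator returns its symbol at the constant function 1, so coordinates are
  among the functionals just tested.\<close>

lemma weakly_converges_fourier: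
  assumes "sobolev_weakly_converges (1/2) v w"
  shows "(\<lambda>n. fourier (v n) (int k)) \<longlonglongrightarrow> fourier w (int k)"
  using weakly_converges_hankel[OF assms, of "basis_fun 0" k] assms
  by (simp add: fourier_hankel_basis_fun sobolev_weakly_converges_def)

section \<open>Bounded functionals through their values on the characters\<close>

context
  fixes s :: real and \<phi> :: "hardy \<Rightarrow> complex" and C :: real
  assumes add: "\<And>f g. f \<in> sobolev s \<Longrightarrow> g \<in> sobolev s \<Longrightarrow> \<phi> (f + g) = \<phi> f + \<phi> g"
    and scale: "\<And>c f. f \<in> sobolev s \<Longrightarrow> \<phi> (scaleC c f) = c * \<phi> f"
    and bound: "\<And>f. f \<in> sobolev s \<Longrightarrow> cmod (\<phi> f) \<le> C * sobolev_norm s f" and C: "0 \<le> C"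
begin

lemma functional_trig_poly:
  "\<phi> (\<Sum>k<M. scaleC (a k) (basis_fun k)) = (\<Sum>k<M. a k * \<phi> (basis_fun k))"
proof (induction M)
  case 0
  show ?case using scale[OF sobolev_zero, of 0] by simp
next
  case (Suc M)
  then show ?case
    by (simp add: add sobolev_sum sobolev_scaleC sobolev_basis_fun scale)
qed

lemma sobolev_term_trig_poly:
  "sobolev_term s (\<Sum>k<M. scaleC (a k) (basis_fun k)) i =
    (if i < M then (1 + (real i)\<^sup>2) powr s * (cmod (a i))\<^sup>2 else 0)"
  by (simp add: sobolev_term_def fourier_basis_fun if_distrib cong: if_cong)

text \<open>A finite section of the Riesz representation: on the extremal polynomial, with
  coefficients \<open>cnj (\<phi> (basis_fun k)) / W k\<close>, the functional takes the value
  \<open>\<beta>\<close> while the norm is \<open>sqrt \<beta>\<close>.\<close>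

lemma functional_coeffs_bounded:
  "(\<Sum>k<M. (cmod (\<phi> (basis_fun k)))\<^sup>2 / (1 + (real k)\<^sup>2) powr s) \<le> C\<^sup>2"
proof -
  define W where "W k = (1 + (real k)\<^sup>2) powr s" for k
  have W: "W k > 0" for k unfolding W_def by (rule sobolev_weight_pos)
  define \<beta> where "\<beta> = (\<Sum>k<M. (cmod (\<phi> (basis_fun k)))\<^sup>2 / W k)"
  define a where "a k = cnj (\<phi> (basis_fun k)) / of_real (W k)" for k
  define f where "f = (\<Sum>k<M. scaleC (a k) (basis_fun k))"
  have f: "f \<in> sobolev s" unfolding f_def by (intro sobolev_sum sobolev_scaleC sobolev_basis_fun)
  have \<beta>0: "0 \<le> \<beta>" unfolding \<beta>_def using W by (intro sum_nonneg divide_nonneg_pos) auto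
  have "\<phi> f = of_real \<beta>"
    unfolding f_def functional_trig_poly \<beta>_def of_real_sum
    by (intro sum.cong refl) (simp add: a_def complex_norm_square mult.commute del: of_real_power)
  moreover have "sobolev_norm s f = sqrt \<beta>"
  proof (rule sobolev_norm_eqI(2))
    have "sobolev_term s f sums (\<Sum>k<M. sobolev_term s f k)"
      by (rule sums_finite) (auto simp: f_def sobolev_term_trig_poly)
    also have "(\<Sum>k<M. sobolev_term s f k) = \<beta>"
      unfolding \<beta>_def f_def
    proof (intro sum.cong refl)
      fix k assume "k \<in> {..<M}"
      then show "sobolev_term s (\<Sum>k<M. scaleC (a k) (basis_fun k)) k = (cmod (\<phi> (basis_fun k)))\<^sup>2 / W k"
        using W[of k] unfolding sobolev_term_trig_poly
        by (simp add: W_def[symmetric] a_def norm_divide power_divide) (simp add: power2_eq_square)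
    qed
    finally show "sobolev_term s f sums \<beta>" .
  qed
  ultimately have "sqrt \<beta> * sqrt \<beta> \<le> C * sqrt \<beta>" using bound[OF f] \<beta>0 by simp
  then have "sqrt \<beta> \<le> C" using le_if_mult_self_le[of "sqrt \<beta>" C] \<beta>0 C by simp
  then have "\<beta> \<le> C\<^sup>2" using \<beta>0 by (simp add: real_le_lsqrt sqrt_le_D)
  then show ?thesis by (simp add: \<beta>_def W_def)
qed

lemma functional_partial_sum_tendsto:
  assumes x: "x \<in> sobolev s"
  shows "(\<lambda>L. \<Sum>k<L. fourier x (int k) * \<phi> (basis_fun k)) \<longlonglongrightarrow> \<phi> x"
proof -
  define P where "P L = (\<Sum>k<L. scaleC (fourier x (int k)) (basis_fun k))" for L
  have P: "P L \<in> sobolev s" for L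
    unfolding P_def by (intro sobolev_sum sobolev_scaleC sobolev_basis_fun)
  have \<phi>P: "\<phi> (P L) = (\<Sum>k<L. fourier x (int k) * \<phi> (basis_fun k))" for L
    unfolding P_def by (rule functional_trig_poly)
  have sx: "summable (sobolev_term s x)" using x by (simp add: sobolev_iff)
  have norm: "sobolev_norm s (x - P L) = sqrt (suminf (sobolev_term s x) - (\<Sum>k<L. sobolev_term s x k))" for L
  proof (rule sobolev_norm_eqI(2))
    have "sobolev_term s (x - P L) = (\<lambda>k. sobolev_term s x k - (if k < L then sobolev_term s x k else 0))"
      by (rule ext) (simp add: sobolev_term_def P_def fourier_basis_fun if_distrib cong: if_cong)
    moreover have "(\<lambda>k. if k < L then sobolev_term s x k else 0) sums (\<Sum>k<L. sobolev_term s x k)"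
      using sums_If_finite_set[of "{..<L}" "sobolev_term s x"] by simp
    ultimately show "sobolev_term s (x - P L) sums (suminf (sobolev_term s x) - (\<Sum>k<L. sobolev_term s x k))"
      using summable_sums[OF sx] by (simp add: sums_diff)
  qed
  have "(\<lambda>L. \<phi> x - \<phi> (P L)) \<longlonglongrightarrow> 0"
  proof (rule Lim_null_comparison)
    have "\<phi> x - \<phi> (P L) = \<phi> (x - P L)" for L
      using add[OF sobolev_diff[OF x P[of L]] P[of L]] by simp
    then show "eventually (\<lambda>L. norm (\<phi> x - \<phi> (P L)) \<le> C * sobolev_norm s (x - P L)) sequentially"
      using bound[OF sobolev_diff[OF x P]] by simp
    have "(\<lambda>L. \<Sum>k<L. sobolev_term s x k) \<longlonglongrightarrow> suminf (sobolev_term s x)"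
      using summable_LIMSEQ[OF sx] .
    then have "(\<lambda>L. C * sqrt (suminf (sobolev_term s x) - (\<Sum>k<L. sobolev_term s x k))) \<longlonglongrightarrow>
        C * sqrt (suminf (sobolev_term s x) - suminf (sobolev_term s x))"
      by (intro tendsto_intros)
    then show "(\<lambda>L. C * sobolev_norm s (x - P L)) \<longlonglongrightarrow> 0" by (simp add: norm)
  qed
  then have "(\<lambda>L. \<phi> x - (\<phi> x - \<phi> (P L))) \<longlonglongrightarrow> \<phi> x - 0" by (intro tendsto_intros)
  then show ?thesis by (simp add: \<phi>P)
qed

text \<open>Cauchy-Schwarz with the weight on the coefficients of \<open>x\<close> and its inverse
  on the values of \<open>\<phi>\<close>. The first factor depends on \<open>\<phi>\<close> alone
  and tends to 0 with \<open>M\<close>, so tails are uniformly small on bounded sets.\<close>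

lemma functional_tail_bound:
  assumes x: "x \<in> sobolev s"
  shows "cmod (\<phi> x - (\<Sum>k<M. fourier x (int k) * \<phi> (basis_fun k))) \<le>
    sqrt ((\<Sum>k. (cmod (\<phi> (basis_fun k)))\<^sup>2 / (1 + (real k)\<^sup>2) powr s) -
      (\<Sum>k<M. (cmod (\<phi> (basis_fun k)))\<^sup>2 / (1 + (real k)\<^sup>2) powr s)) * sobolev_norm s x"
    (is "_ \<le> sqrt (suminf ?b - sum ?b {..<M}) * _")
proof -
  have sb: "summable ?b"
    by (rule bounded_imp_summable[where B = "C\<^sup>2"])
      (use functional_coeffs_bounded[of "Suc _"] in \<open>auto simp: lessThan_Suc_atMost\<close>)
  have sx: "summable (sobolev_term s x)" using x by (simp add: sobolev_iff)
  have sq: "(sobolev_norm s x)\<^sup>2 = suminf (sobolev_term s x)"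
    using sobolev_norm_sq[OF x] by (simp add: sums_iff)
  have L: "cmod ((\<Sum>k<L. fourier x (int k) * \<phi> (basis_fun k)) - (\<Sum>k<M. fourier x (int k) * \<phi> (basis_fun k)))
      \<le> sqrt (suminf ?b - sum ?b {..<M}) * sobolev_norm s x" if le: "M \<le> L" for L
  proof -
    let ?I = "{M..<L}"
    have un: "{..<L} = {..<M} \<union> ?I" "{..<M} \<inter> ?I = {}" using le by auto
    have "(\<Sum>k<L. fourier x (int k) * \<phi> (basis_fun k)) - (\<Sum>k<M. fourier x (int k) * \<phi> (basis_fun k))
        = (\<Sum>k\<in>?I. fourier x (int k) * \<phi> (basis_fun k))"
      unfolding un(1) by (subst sum.union_disjoint) (use un in auto)
    also have "cmod \<dots> \<le> (\<Sum>k\<in>?I. cmod (fourier x (int k)) * cmod (\<phi> (basis_fun k)))"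
      by (rule order_trans[OF norm_sum]) (simp add: norm_mult)
    also have "\<dots> = (\<Sum>k\<in>?I. sqrt (?b k) * sqrt (sobolev_term s x k))"
    proof (intro sum.cong refl)
      fix k
      show "cmod (fourier x (int k)) * cmod (\<phi> (basis_fun k)) = sqrt (?b k) * sqrt (sobolev_term s x k)"
        using sobolev_weight_pos[of k s] by (simp add: sobolev_term_def real_sqrt_mult real_sqrt_divide)
    qed
    also have "\<dots> \<le> sqrt ((\<Sum>k\<in>?I. (sqrt (?b k))\<^sup>2) * (\<Sum>k\<in>?I. (sqrt (sobolev_term s x k))\<^sup>2))"
      by (rule real_le_rsqrt) (rule Cauchy_Schwarz_ineq_sum)
    also have "\<dots> = sqrt (sum ?b ?I) * sqrt (sum (sobolev_term s x) ?I)"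
      by (simp add: real_sqrt_mult)
    also have "\<dots> \<le> sqrt (suminf ?b - sum ?b {..<M}) * sobolev_norm s x"
    proof (intro mult_mono)
      have "sum ?b {..<L} = sum ?b {..<M} + sum ?b ?I"
        unfolding un(1) by (subst sum.union_disjoint) (use un in auto)
      moreover have "sum ?b {..<L} \<le> suminf ?b" by (rule sum_le_suminf[OF sb]) auto
      ultimately show "sqrt (sum ?b ?I) \<le> sqrt (suminf ?b - sum ?b {..<M})" by simp
      show "0 \<le> sqrt (suminf ?b - sum ?b {..<M})" using sum_le_suminf[OF sb, of "{..<M}"] by simp
      have "sum (sobolev_term s x) ?I \<le> suminf (sobolev_term s x)" by (rule sum_le_suminf[OF sx]) auto
      then have "sqrt (sum (sobolev_term s x) ?I) \<le> sqrt ((sobolev_norm s x)\<^sup>2)" by (simp only: sq real_sqrt_le_iff)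
      then show "sqrt (sum (sobolev_term s x) ?I) \<le> sobolev_norm s x" by simp
    qed (auto intro: sum_nonneg)
    finally show ?thesis .
  qed
  have "(\<lambda>L. cmod ((\<Sum>k<L. fourier x (int k) * \<phi> (basis_fun k)) - (\<Sum>k<M. fourier x (int k) * \<phi> (basis_fun k))))
      \<longlonglongrightarrow> cmod (\<phi> x - (\<Sum>k<M. fourier x (int k) * \<phi> (basis_fun k)))"
    by (intro tendsto_intros functional_partial_sum_tendsto[OF x])
  then show ?thesis by (rule LIMSEQ_le_const2) (use L in blast)
qed

lemma functional_tendsto_zero:
  assumes x: "\<And>n. x n \<in> sobolev s" "\<And>n. sobolev_norm s (x n) \<le> D"
    and coord: "\<And>k. (\<lambda>n. fourier (x n) (int k)) \<longlonglongrightarrow> 0"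
  shows "(\<lambda>n. \<phi> (x n)) \<longlonglongrightarrow> 0"
proof (rule LIMSEQ_I)
  fix e :: real assume e: "e > 0"
  define b where "b k = (cmod (\<phi> (basis_fun k)))\<^sup>2 / (1 + (real k)\<^sup>2) powr s" for k
  have sb: "summable b" unfolding b_def
    by (rule bounded_imp_summable[where B = "C\<^sup>2"])
      (use functional_coeffs_bounded[of "Suc _"] in \<open>auto simp: lessThan_Suc_atMost\<close>)
  have D: "0 \<le> D" using x(2)[of 0] sobolev_norm_nonneg order_trans by blast
  have "(\<lambda>M. sqrt (suminf b - sum b {..<M}) * D) \<longlonglongrightarrow> sqrt (suminf b - suminf b) * D"
    by (intro tendsto_intros summable_LIMSEQ[OF sb])
  then have "eventually (\<lambda>M. sqrt (suminf b - sum b {..<M}) * D < e / 2) sequentially"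
    by (rule order_tendstoD(2)) (use e in simp)
  then obtain M where M: "sqrt (suminf b - sum b {..<M}) * D < e / 2"
    by (auto simp: eventually_sequentially)
  have "(\<lambda>n. cmod (\<Sum>k<M. fourier (x n) (int k) * \<phi> (basis_fun k))) \<longlonglongrightarrow> cmod (\<Sum>k<M. 0 * \<phi> (basis_fun k))"
    by (intro tendsto_intros coord)
  then have "eventually (\<lambda>n. cmod (\<Sum>k<M. fourier (x n) (int k) * \<phi> (basis_fun k)) < e / 2) sequentially"
    by (rule order_tendstoD(2)) (use e in simp)
  then obtain n0 where n0: "\<And>n. n \<ge> n0 \<Longrightarrow> cmod (\<Sum>k<M. fourier (x n) (int k) * \<phi> (basis_fun k)) < e / 2"
    by (auto simp: eventually_sequentially)
  have "norm (\<phi> (x n) - 0) < e" if "n \<ge> n0" for n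
  proof -
    have "cmod (\<phi> (x n) - (\<Sum>k<M. fourier (x n) (int k) * \<phi> (basis_fun k)))
        \<le> sqrt (suminf b - sum b {..<M}) * sobolev_norm s (x n)"
      using functional_tail_bound[OF x(1)[of n], of M] unfolding b_def .
    also have "\<dots> \<le> sqrt (suminf b - sum b {..<M}) * D"
      using sum_le_suminf[OF sb, of "{..<M}"] by (intro mult_left_mono x(2)) (auto simp: b_def)
    finally have "cmod (\<phi> (x n) - (\<Sum>k<M. fourier (x n) (int k) * \<phi> (basis_fun k))) < e / 2" using M by simp
    then show ?thesis
      using n0[OF that] norm_triangle_sub[of "\<phi> (x n)" "\<Sum>k<M. fourier (x n) (int k) * \<phi> (basis_fun k)"] by simp
  qed
  then show "\<exists>n0. \<forall>n\<ge>n0. norm (\<phi> (x n) - 0) < e" by blast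
qed

end

section \<open>Weak convergence of bounded sequences and extraction\<close>

lemma sobolev_norm_diff_le:
  assumes "f \<in> sobolev s" "g \<in> sobolev s" "sobolev_norm s f \<le> C" "sobolev_norm s g \<le> C"
  shows "sobolev_norm s (f - g) \<le> 2 * C"
proof -
  have C: "0 \<le> C" using assms(3) sobolev_norm_nonneg order_trans by blast
  have pt: "sobolev_term s (f - g) k \<le> 2 * (sobolev_term s f k + sobolev_term s g k)" for k
    using sobolev_term_add_le[of s f "- g" k] by (simp add: sobolev_term_def)
  have "(sobolev_norm s (f - g))\<^sup>2 \<le> 2 * ((sobolev_norm s f)\<^sup>2 + (sobolev_norm s g)\<^sup>2)"
    using sobolev_norm_sq[OF sobolev_diff[OF assms(1,2)]]
      sums_mult[OF sums_add[OF sobolev_norm_sq[OF assms(1)] sobolev_norm_sq[OF assms(2)]], of 2]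
    by (rule sums_le[OF pt])
  also have "\<dots> \<le> 2 * (C\<^sup>2 + C\<^sup>2)" by (intro mult_left_mono add_mono power_mono assms) auto
  also have "\<dots> = (2 * C)\<^sup>2" by (simp add: power2_eq_square)
  finally show ?thesis by (rule power2_le_imp_le) (use C in simp)
qed

lemma weakly_converges_if_bounded:
  assumes v: "\<And>n. v n \<in> sobolev s" "\<And>n. sobolev_norm s (v n) \<le> D" and w: "w \<in> sobolev s"
    and coord: "\<And>k. (\<lambda>n. fourier (v n) (int k)) \<longlonglongrightarrow> fourier w (int k)"
  shows "sobolev_weakly_converges s v w"
  unfolding sobolev_weakly_converges_def
proof (intro conjI allI impI v w)
  fix \<phi> assume \<phi>: "sobolev_functional s \<phi>"
  then obtain C where C: "\<And>f. f \<in> sobolev s \<Longrightarrow> cmod (\<phi> f) \<le> C * sobolev_norm s f"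
    unfolding sobolev_functional_def by blast
  have add: "\<phi> (f + g) = \<phi> f + \<phi> g" if "f \<in> sobolev s" "g \<in> sobolev s" for f g
    using \<phi> that by (auto simp: sobolev_functional_def)
  have scale: "\<phi> (scaleC c f) = c * \<phi> f" if "f \<in> sobolev s" for c f
    using \<phi> that by (auto simp: sobolev_functional_def)
  define E where "E = max D (sobolev_norm s w)"
  have "(\<lambda>n. \<phi> (v n - w)) \<longlonglongrightarrow> 0"
  \<comment> \<open>The constant of a bounded functional comes without a sign, hence
    \<open>max C 0\<close>; \<open>E\<close> bounds the norms of the terms and of the limit
    together.\<close>
  proof (rule functional_tendsto_zero[OF add scale, where C = "max C 0" and D = "2 * E"])
    show "cmod (\<phi> f) \<le> max C 0 * sobolev_norm s f" if "f \<in> sobolev s" for f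
      using C[OF that] by (rule order_trans) (intro mult_right_mono, auto)
    show "v n - w \<in> sobolev s" for n by (rule sobolev_diff[OF v(1) w])
    show "sobolev_norm s (v n - w) \<le> 2 * E" for n
      by (rule sobolev_norm_diff_le) (use v w in \<open>auto simp: E_def intro: order_trans[OF v(2)]\<close>)
    show "(\<lambda>n. fourier (v n - w) (int k)) \<longlonglongrightarrow> 0" for k
      using tendsto_diff[OF coord[of k] tendsto_const[of "fourier w (int k)"]] by simp
  qed auto
  moreover have "\<phi> (v n - w) = \<phi> (v n) - \<phi> w" for n
    using add[OF sobolev_diff[OF v(1) w] w, of n] by simp
  ultimately show "(\<lambda>n. \<phi> (v n)) \<longlonglongrightarrow> \<phi> w" by (simp add: LIM_zero_iff)
qed

text \<open>A product of closed discs is compact by Tychonoff's theorem; its sequential compactness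
  extracts a subsequence along which all coordinates converge at once.\<close>

lemma compact_bounded_sequences: "compact {f :: nat \<Rightarrow> complex. \<forall>k. cmod (f k) \<le> C}"
proof -
  have "compactin (product_topology (\<lambda>_. euclidean) UNIV) (PiE UNIV (\<lambda>_::nat. cball (0::complex) C))"
    by (subst compactin_PiE) (simp add: compactin_euclidean_iff)
  then have "compact (PiE UNIV (\<lambda>_::nat. cball (0::complex) C))"
    by (simp add: euclidean_product_topology compactin_euclidean_iff)
  also have "PiE UNIV (\<lambda>_::nat. cball (0::complex) C) = {f. \<forall>k. cmod (f k) \<le> C}"
    by (auto simp: PiE_def)
  finally show ?thesis .
qed

text \<open>By \<open>s >= 0\<close> the weights are at least 1 and bound every coordinate. Weighted
  partial sums stay below \<open>C^2\<close> in the coordinatewise limit, so the limit lies in the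
  same space, and boundedness upgrades the convergence to weak convergence.\<close>

lemma sobolev_weakly_compact:
  fixes v :: "nat \<Rightarrow> hardy"
  assumes s: "0 \<le> s" and v: "\<And>n. v n \<in> sobolev s" "\<And>n. sobolev_norm s (v n) \<le> C"
  shows "\<exists>r w. strict_mono r \<and> sobolev_weakly_converges s (\<lambda>k. v (r k)) w"
proof -
  define W where "W k = (1 + (real k)\<^sup>2) powr s" for k
  have W: "1 \<le> W k" for k unfolding W_def by (intro ge_one_powr_ge_zero s) auto
  have part: "(\<Sum>k<M. W k * (cmod (fourier (v n) (int k)))\<^sup>2) \<le> C\<^sup>2" for M n
  proof -
    have "(\<Sum>k<M. sobolev_term s (v n) k) \<le> (sobolev_norm s (v n))\<^sup>2"
      using sobolev_norm_sq[OF v(1)[of n]] sum_le_suminf[of "sobolev_term s (v n)" "{..<M}"]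
      by (auto simp: sums_iff)
    also have "\<dots> \<le> C\<^sup>2" by (intro power_mono v) simp
    finally show ?thesis by (simp add: sobolev_term_def W_def)
  qed
  have C: "0 \<le> C" using v(2)[of 0] sobolev_norm_nonneg order_trans by blast
  have "cmod (fourier (v n) (int k)) \<le> C" for n k
  proof (rule power2_le_imp_le)
    have "(cmod (fourier (v n) (int k)))\<^sup>2 \<le> W k * (cmod (fourier (v n) (int k)))\<^sup>2"
      using mult_right_mono[OF W[of k]] by simp
    also have "\<dots> \<le> (\<Sum>k<Suc k. W k * (cmod (fourier (v n) (int k)))\<^sup>2)"
      by (rule member_le_sum) (auto simp: W_def)
    also have "\<dots> \<le> C\<^sup>2" by (rule part)
    finally show "(cmod (fourier (v n) (int k)))\<^sup>2 \<le> C\<^sup>2" .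
  qed (rule C)
  then have "\<forall>n. (\<lambda>k. fourier (v n) (int k)) \<in> {f :: nat \<Rightarrow> complex. \<forall>k. cmod (f k) \<le> C}" by simp
  then obtain a r where r: "strict_mono (r :: nat \<Rightarrow> nat)" and
    lim: "((\<lambda>n k. fourier (v n) (int k)) \<circ> r) \<longlonglongrightarrow> a"
    using compact_imp_seq_compact[OF compact_bounded_sequences[of C]] unfolding seq_compact_def by meson
  have lim: "(\<lambda>n. fourier (v (r n)) (int k)) \<longlonglongrightarrow> a k" for k
    using continuous_on_tendsto_compose[OF continuous_on_product_coordinates[of k] lim] by simp
  have bnd: "(\<Sum>k<M. W k * (cmod (a k))\<^sup>2) \<le> C\<^sup>2" for M
  proof (rule LIMSEQ_le_const2)
    show "(\<lambda>n. \<Sum>k<M. W k * (cmod (fourier (v (r n)) (int k)))\<^sup>2) \<longlonglongrightarrow> (\<Sum>k<M. W k * (cmod (a k))\<^sup>2)"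
      by (intro tendsto_intros lim)
  qed (use part in auto)
  have sm: "summable (\<lambda>k. W k * (cmod (a k))\<^sup>2)"
    by (rule bounded_imp_summable[where B = "C\<^sup>2"])
      (use bnd[of "Suc _"] in \<open>auto simp: lessThan_Suc_atMost W_def\<close>)
  have "summable (\<lambda>k. (cmod (a k))\<^sup>2)"
  proof (rule summable_comparison_test'[OF sm, of 0])
    show "norm ((cmod (a k))\<^sup>2) \<le> W k * (cmod (a k))\<^sup>2" for k
      using mult_right_mono[OF W[of k], of "(cmod (a k))\<^sup>2"] by simp
  qed
  then obtain w where w: "\<And>k. fourier w (int k) = a k"
    using hardy_series_exists[of a] by blast
  have "w \<in> sobolev s" unfolding sobolev_iff using sm by (simp add: sobolev_term_def[abs_def] W_def w)
  then have "sobolev_weakly_converges s (\<lambda>k. v (r k)) w"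
    by (intro weakly_converges_if_bounded[where D = C] v) (simp_all add: w lim)
  then show ?thesis using r by blast
qed

section \<open>Bounded and unbounded sequences\<close>

lemma weakly_converges_const: "v \<in> sobolev s \<Longrightarrow> sobolev_weakly_converges s (\<lambda>n. v) v"
  by (simp add: sobolev_weakly_converges_def)

lemma weakly_converges_shifted_hankel:
  assumes "sobolev_weakly_converges (1/2) v w"
  shows "(\<lambda>n. fourier (shifted_hankel (v n) h) (int k)) \<longlonglongrightarrow> fourier (shifted_hankel w h) (int k)"
  using weakly_converges_hankel[OF assms] by (simp add: shifted_hankel_def)

lemma eventually_sobolev_bounded:
  assumes v: "\<And>n. v n \<in> sobolev (1/2)" "\<And>n. sobolev_norm (1/2) (v n) \<le> C"
    and rank: "\<And>n. has_rank (shifted_hankel (v n)) N" "has_rank (shifted_hankel w) N"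
    and weak: "sobolev_weakly_converges (1/2) v w"
  shows "\<exists>M. eventually (\<lambda>n. v n \<in> sobolev s \<and> sobolev_norm s (v n) \<le> M) sequentially"
proof -
  have w: "w \<in> sobolev (1/2)" using weak by (simp add: sobolev_weakly_converges_def)
  obtain m E where m: "m \<ge> 1" and
    decay: "eventually (\<lambda>n. \<forall>k j. cmod (fourier (v n) (int (Suc (j + m * k)))) \<le> E * (1/2) ^ k) sequentially"
    using uniform_exponential_decay[OF v w rank weakly_converges_shifted_hankel[OF weak]] by blast
  \<comment> \<open>\<open>K\<close> does not see the coefficient of index 0; it is bounded by
    \<open>2 * C\<close> through the Hankel operator at the constant function.\<close>
  define E' where "E' = max E (2 * C)"
  obtain M where M: "\<And>u. (\<forall>k j. cmod (fourier u (int (Suc (j + m * k)))) \<le> E' * (1/2) ^ k) \<and> cmod (fourier u 0) \<le> E'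
    \<Longrightarrow> u \<in> sobolev s \<and> sobolev_norm s u \<le> M"
    using sobolev_bound_of_decay[OF m, of E' s] by blast
  have zero: "cmod (fourier (v n) 0) \<le> E'" for n
  proof -
    have "cmod (fourier (v n) 0) = cmod (fourier (hankel (v n) (basis_fun 0)) (int 0))"
      by (simp only: fourier_hankel_basis_fun[OF v(1)]) simp
    also have "\<dots> \<le> norm (hankel (v n) (basis_fun 0))" by (rule norm_fourier_le)
    also have "\<dots> \<le> 2 * sobolev_norm (1/2) (v n) * norm (basis_fun 0)" by (rule norm_hankel_le[OF v(1)])
    also have "\<dots> \<le> E'" using v(2)[of n] by (simp add: E'_def)
    finally show ?thesis .
  qed
  from decay have "eventually (\<lambda>n. v n \<in> sobolev s \<and> sobolev_norm s (v n) \<le> M) sequentially"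
  proof eventually_elim
    case (elim n)
    have "cmod (fourier (v n) (int (Suc (j + m * k)))) \<le> E' * (1/2) ^ k" for j k
      by (rule order_trans[OF elim[rule_format]]) (intro mult_right_mono, auto simp: E'_def)
    then show ?case using zero by (intro M) blast
  qed
  then show ?thesis by blast
qed

text \<open>The decay estimate for a constant sequence, which is its own weak limit without loss of
  rank. Failure of \<open>sobolev_bounded\<close> within the class thus concerns the norms and never
  membership.\<close>

lemma rank_class_smooth:
  assumes "v \<in> rank_class d"
  shows "v \<in> sobolev s"
proof -
  have v: "v \<in> sobolev (1/2)" "has_rank (shifted_hankel v) (d div 2)"
    using assms by (auto simp: rank_class_iff)
  have "\<exists>M. eventually (\<lambda>n::nat. v \<in> sobolev s \<and> sobolev_norm s v \<le> M) sequentially"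
    by (rule eventually_sobolev_bounded[OF v(1) order_refl v(2) v(2) weakly_converges_const[OF v(1)]])
  then show ?thesis by auto
qed

text \<open>Norms of order \<open>s\<close> that tend to infinity keep doing so along every further
  extraction, so a weak limit of such a subsequence cannot retain the full rank.\<close>

lemma weak_limit_of_unbounded:
  fixes v :: "nat \<Rightarrow> hardy"
  assumes v: "\<And>n. v n \<in> rank_class d" and bdd: "sobolev_bounded (1/2) v"
    and unbdd: "\<not> sobolev_bounded s v"
  shows "\<exists>r d' w. strict_mono r \<and> w \<in> rank_class d' \<and> d' div 2 < d div 2 \<and>
    d' \<le> 2 * (d' div 2) + 1 \<and> sobolev_weakly_converges (1/2) (\<lambda>k. v (r k)) w"
proof -
  obtain C where half: "\<And>n. v n \<in> sobolev (1/2)" "\<And>n. sobolev_norm (1/2) (v n) \<le> C"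
    using bdd by (auto simp: sobolev_bounded_def)
  have rank: "has_rank (shifted_hankel (v n)) (d div 2)" for n using v by (auto simp: rank_class_iff)
  \<comment> \<open>Finitely many indices cannot cause unboundedness, so large norms occur beyond
    every index.\<close>
  have "\<exists>n>m. sobolev_norm s (v n) > real m" for m
  proof (rule ccontr)
    assume "\<not> (\<exists>n>m. sobolev_norm s (v n) > real m)"
    then have le: "sobolev_norm s (v n) \<le> real m" if "n > m" for n using that by (meson not_less)
    have "sobolev_norm s (v n) \<le> max (real m) (Max ((\<lambda>n. sobolev_norm s (v n)) ` {..m}))" for n
    proof (cases "n > m")
      case False
      then show ?thesis by (intro max.coboundedI2 Max_ge) auto
    qed (use le in \<open>auto intro: max.coboundedI1\<close>)
    then have "sobolev_bounded s v" using rank_class_smooth[OF v] unfolding sobolev_bounded_def by blast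
    then show False using unbdd by simp
  qed
  then obtain g where g: "\<And>m. g m > m" "\<And>m. sobolev_norm s (v (g m)) > real m" by metis
  define r where "r = rec_nat (g 0) (\<lambda>_ x. g x)"
  have r_Suc: "r (Suc k) = g (r k)" and r_0: "r 0 = g 0" for k by (simp_all add: r_def)
  have r: "strict_mono r" by (intro strict_monoI_Suc) (simp add: r_Suc g)
  have big: "sobolev_norm s (v (r (Suc k))) > real k" for k
    using g(2)[of "r k"] seq_suble[OF r, of k] by (simp add: r_Suc)
  \<comment> \<open>Dropping the first index makes the norm at \<open>r1 k\<close> exceed
    \<open>k\<close>.\<close>
  define r1 where "r1 k = r (Suc k)" for k
  have r1: "strict_mono r1" using r by (simp add: strict_mono_def r1_def)
  obtain r2 w where r2: "strict_mono r2" and weak: "sobolev_weakly_converges (1/2) (\<lambda>k. v (r1 (r2 k))) w"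
    using sobolev_weakly_compact[of "1/2" "\<lambda>k. v (r1 k)" C] half by auto
  have w: "w \<in> sobolev (1/2)" using weak by (simp add: sobolev_weakly_converges_def)
  obtain q where q: "q \<le> d div 2" "has_rank (shifted_hankel w) q"
    using rank_lower_semicontinuous[OF w rank weakly_converges_shifted_hankel[OF weak]] by blast
  have "q \<noteq> d div 2"
  proof
    assume "q = d div 2"
    then obtain M where "eventually (\<lambda>n. v (r1 (r2 n)) \<in> sobolev s \<and> sobolev_norm s (v (r1 (r2 n))) \<le> M) sequentially"
      using eventually_sobolev_bounded[of "\<lambda>k. v (r1 (r2 k))" C "d div 2" w s] half rank q(2) weak by auto
    then obtain n0 where n0: "\<And>n. n \<ge> n0 \<Longrightarrow> sobolev_norm s (v (r1 (r2 n))) \<le> M"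
      by (auto simp: eventually_sequentially)
    obtain n1 :: nat where n1: "M < real n1" using reals_Archimedean2 by blast
    let ?n = "max n0 n1"
    have "real n1 \<le> real (r2 ?n)" using seq_suble[OF r2, of ?n] by simp
    also have "\<dots> < sobolev_norm s (v (r1 (r2 ?n)))" unfolding r1_def by (rule big)
    also have "\<dots> \<le> M" by (rule n0) simp
    finally show False using n1 by simp
  qed
  moreover obtain d' where d': "w \<in> rank_class d'" "d' \<le> 2 * q + 1"
    using rank_class_exists[OF w q(2)] by blast
  then have "has_rank (shifted_hankel w) (d' div 2)" by (auto simp: rank_class_iff)
  then have "d' div 2 = q" using q(2) by (rule has_rank_unique)
  ultimately show ?thesis using d' q(1) weak strict_mono_o[OF r1 r2]
    by (intro exI[of _ "r1 \<circ> r2"] exI[of _ d'] exI[of _ w]) auto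
qed

text \<open>From frequency \<open>M\<close> on, the quotient of the two weights is a power with
  negative exponent \<open>1/2 - s\<close>, largest at \<open>M\<close>.\<close>

lemma sobolev_term_half_tail:
  assumes "s > 1/2"
  shows "sobolev_term (1/2) u (k + M) \<le> (1 + (real M)\<^sup>2) powr (1/2 - s) * sobolev_term s u (k + M)"
proof -
  let ?x = "1 + (real (k + M))\<^sup>2"
  have x: "0 < ?x" by (rule add_pos_nonneg) auto
  have y: "0 < 1 + (real M)\<^sup>2" by (rule add_pos_nonneg) auto
  have "?x powr (1/2) = ?x powr (1/2 - s) * ?x powr s" by (simp flip: powr_add)
  also have "\<dots> \<le> (1 + (real M)\<^sup>2) powr (1/2 - s) * ?x powr s"
  proof (intro mult_right_mono powr_mono2')
    have "(real M)\<^sup>2 \<le> (real (k + M))\<^sup>2" by (intro power_mono) auto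
    then show "1 + (real M)\<^sup>2 \<le> ?x" by simp
  qed (use assms y in auto)
  finally show ?thesis unfolding sobolev_term_def mult.assoc[symmetric] by (intro mult_right_mono) auto
qed

text \<open>The tail beyond \<open>M\<close> is small uniformly in \<open>n\<close>: for
  \<open>u n\<close> by the bound of order \<open>s\<close>, for \<open>w\<close>, known to lie only
  in the space of order 1/2, by summability. The finite head converges coordinatewise.\<close>

lemma strong_convergence_of_bounded:
  assumes s: "s > 1/2" and u: "\<And>n. u n \<in> sobolev s" "\<And>n. sobolev_norm s (u n) \<le> C"
    and uh: "\<And>n. u n \<in> sobolev (1/2)" and w: "w \<in> sobolev (1/2)"
    and coord: "\<And>k. (\<lambda>n. fourier (u n) (int k)) \<longlonglongrightarrow> fourier w (int k)"
  shows "(\<lambda>n. sobolev_norm (1/2) (u n - w)) \<longlonglongrightarrow> 0"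
proof -
  have xw: "u n - w \<in> sobolev (1/2)" for n by (rule sobolev_diff[OF uh w])
  let ?t = "sobolev_term (1/2)"
  have sw: "summable (?t w)" using w by (simp add: sobolev_iff)
  \<comment> \<open>Bounds the tail of the squared norm of \<open>u n - w\<close> for all
    \<open>n\<close>; the 2 comes from the square of a sum.\<close>
  define T where "T M = 2 * ((1 + (real M)\<^sup>2) powr (1/2 - s) * C\<^sup>2 + (suminf (?t w) - (\<Sum>k<M. ?t w k)))" for M
  have split: "(sobolev_norm (1/2) (u n - w))\<^sup>2 \<le> T M + (\<Sum>k<M. ?t (u n - w) k)" for n M
  proof -
    have sx: "summable (?t (u n - w))" using xw by (simp add: sobolev_iff)
    have su: "summable (sobolev_term s (u n))" using u by (simp add: sobolev_iff)
    have pt: "?t (u n - w) (k + M) \<le> 2 * ((1 + (real M)\<^sup>2) powr (1/2 - s) * sobolev_term s (u n) (k + M) + ?t w (k + M))" for k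
    proof -
      have "?t (u n - w) (k + M) \<le> 2 * (?t (u n) (k + M) + ?t w (k + M))"
        using sobolev_term_add_le[of "1/2" "u n" "- w" "k + M"] by (simp add: sobolev_term_def)
      also have "\<dots> \<le> 2 * ((1 + (real M)\<^sup>2) powr (1/2 - s) * sobolev_term s (u n) (k + M) + ?t w (k + M))"
        by (intro mult_left_mono add_right_mono sobolev_term_half_tail s) auto
      finally show ?thesis .
    qed
    have tails: "summable (\<lambda>k. ?t (u n - w) (k + M))" "summable (\<lambda>k. sobolev_term s (u n) (k + M))"
      "summable (\<lambda>k. ?t w (k + M))"
      using sx su sw by (auto intro: summable_ignore_initial_segment)
    have "(\<Sum>k. ?t (u n - w) (k + M)) \<le>
        (\<Sum>k. 2 * ((1 + (real M)\<^sup>2) powr (1/2 - s) * sobolev_term s (u n) (k + M) + ?t w (k + M)))"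
      by (intro suminf_le pt summable_mult summable_add tails)
    also have "\<dots> = 2 * ((1 + (real M)\<^sup>2) powr (1/2 - s) * (\<Sum>k. sobolev_term s (u n) (k + M)) + (\<Sum>k. ?t w (k + M)))"
      using tails by (simp add: suminf_mult suminf_add[symmetric] summable_mult summable_add)
    also have "\<dots> \<le> T M"
    proof -
      have "(\<Sum>k. sobolev_term s (u n) (k + M)) = suminf (sobolev_term s (u n)) - (\<Sum>k<M. sobolev_term s (u n) k)"
        by (rule suminf_minus_initial_segment[OF su])
      also have "\<dots> \<le> suminf (sobolev_term s (u n))" by (simp add: sum_nonneg)
      also have "\<dots> = (sobolev_norm s (u n))\<^sup>2" using sobolev_norm_sq[OF u(1)[of n]] by (simp add: sums_iff)
      also have "\<dots> \<le> C\<^sup>2" by (intro power_mono u) simp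
      finally have a: "(\<Sum>k. sobolev_term s (u n) (k + M)) \<le> C\<^sup>2" .
      show ?thesis unfolding T_def suminf_minus_initial_segment[OF sw]
        by (intro mult_left_mono add_right_mono a) auto
    qed
    finally have "(\<Sum>k. ?t (u n - w) (k + M)) \<le> T M" .
    moreover have "(sobolev_norm (1/2) (u n - w))\<^sup>2 = suminf (?t (u n - w))"
      using sobolev_norm_sq[OF xw[of n]] by (simp add: sums_iff)
    ultimately show ?thesis using suminf_split_initial_segment[OF sx, of M] by simp
  qed
  have T0: "T \<longlonglongrightarrow> 0"
  proof -
    have "(\<lambda>M. (1 + (real M)\<^sup>2) powr (1/2 - s)) \<longlonglongrightarrow> 0"
    proof -
      have "1/2 - s < 0" using s by simp
      then show ?thesis by real_asymp
    qed
    then have "T \<longlonglongrightarrow> 2 * (0 * C\<^sup>2 + (suminf (?t w) - suminf (?t w)))"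
      unfolding T_def[abs_def] by (intro tendsto_intros summable_LIMSEQ[OF sw])
    then show ?thesis by simp
  qed
  have "(\<lambda>n. (sobolev_norm (1/2) (u n - w))\<^sup>2) \<longlonglongrightarrow> 0"
  proof (rule LIMSEQ_I)
    fix e :: real assume e: "e > 0"
    have "eventually (\<lambda>M. T M < e / 2) sequentially" using T0 by (rule order_tendstoD(2)) (use e in simp)
    then obtain M where M: "T M < e / 2" by (auto simp: eventually_sequentially)
    have "(\<lambda>n. \<Sum>k<M. ?t (u n - w) k) \<longlonglongrightarrow> (\<Sum>k<M. (1 + (real k)\<^sup>2) powr (1/2) * (cmod (fourier w (int k) - fourier w (int k)))\<^sup>2)"
      unfolding sobolev_term_def fourier_diff by (intro tendsto_intros coord)
    then have "eventually (\<lambda>n. (\<Sum>k<M. ?t (u n - w) k) < e / 2) sequentially"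
      by (rule order_tendstoD(2)) (use e in simp)
    then obtain n0 where n0: "\<And>n. n \<ge> n0 \<Longrightarrow> (\<Sum>k<M. ?t (u n - w) k) < e / 2"
      by (auto simp: eventually_sequentially)
    have "norm ((sobolev_norm (1/2) (u n - w))\<^sup>2 - 0) < e" if "n \<ge> n0" for n
      using split[of n M] M n0[OF that] by simp
    then show "\<exists>n0. \<forall>n\<ge>n0. norm ((sobolev_norm (1/2) (u n - w))\<^sup>2 - 0) < e" by blast
  qed
  then have "(\<lambda>n. sqrt ((sobolev_norm (1/2) (u n - w))\<^sup>2)) \<longlonglongrightarrow> sqrt 0" by (intro tendsto_intros)
  then show ?thesis by simp
qed

text \<open>Where \<open>K_w h = 0\<close>, the vector \<open>K_v h\<close> is the value at
  \<open>h\<close> of the operator with symbol \<open>v - w\<close>, whose norm becomes small.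
  Against the lower bound on the range of \<open>K_v\<close> this leaves only \<open>h = 0\<close>,
  so \<open>K_w\<close> is injective there.\<close>

lemma unbounded_of_rank_drop:
  fixes v :: "nat \<Rightarrow> hardy"
  assumes v: "\<And>n. v n \<in> rank_class d" and bdd: "sobolev_bounded (1/2) v"
    and spec: "\<And>m n. spectrum (shifted_hankel (v m) \<circ> shifted_hankel (v m))
             = spectrum (shifted_hankel (v n) \<circ> shifted_hankel (v n))"
    and w: "w \<in> rank_class d'" "d' div 2 < d div 2"
    and weak: "sobolev_weakly_converges (1/2) (\<lambda>k. v (r k)) w" and s: "s > 1/2"
  shows "\<not> sobolev_bounded s v"
proof
  assume "sobolev_bounded s v"
  then obtain C where C: "\<And>n. v n \<in> sobolev s" "\<And>n. sobolev_norm s (v n) \<le> C"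
    by (auto simp: sobolev_bounded_def)
  obtain C' where C': "\<And>n. v n \<in> sobolev (1/2)" "\<And>n. sobolev_norm (1/2) (v n) \<le> C'"
    using bdd by (auto simp: sobolev_bounded_def)
  have rank: "has_rank (shifted_hankel (v n)) (d div 2)" for n using v by (auto simp: rank_class_iff)
  have wh: "w \<in> sobolev (1/2)" "has_rank (shifted_hankel w) (d' div 2)" using w(1) by (auto simp: rank_class_iff)
  obtain D where D: "\<And>n h. h \<in> range (shifted_hankel (v n)) \<Longrightarrow> norm h \<le> D * norm (shifted_hankel (v n) h)"
    using spectral_gap[of v C' "d div 2", OF C' rank spec] by blast
  have "(\<lambda>n. sobolev_norm (1/2) (v (r n) - w)) \<longlonglongrightarrow> 0"
    by (rule strong_convergence_of_bounded[OF s C C'(1) wh(1) weakly_converges_fourier[OF weak]])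
  then have "(\<lambda>n. \<bar>D\<bar> * (2 * sobolev_norm (1/2) (v (r n) - w))) \<longlonglongrightarrow> \<bar>D\<bar> * (2 * 0)"
    by (intro tendsto_intros)
  then have "eventually (\<lambda>n. \<bar>D\<bar> * (2 * sobolev_norm (1/2) (v (r n) - w)) < 1) sequentially"
    by (rule order_tendstoD(2)) simp
  then obtain n where n: "\<bar>D\<bar> * (2 * sobolev_norm (1/2) (v (r n) - w)) < 1"
    by (auto simp: eventually_sequentially)
  have "d div 2 \<le> d' div 2"
  proof (rule rank_le_of_injective_on_range[OF wh rank[of "r n"]])
    fix h assume h: "h \<in> range (shifted_hankel (v (r n)))" and 0: "shifted_hankel w h = 0"
    have "shifted_hankel (v (r n) - w) h = shifted_hankel (v (r n)) h"
      using 0 by (simp add: shifted_hankel_def hankel_diff_symbol[OF C'(1) wh(1)])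
    then have "norm (shifted_hankel (v (r n)) h) \<le> 2 * sobolev_norm (1/2) (v (r n) - w) * norm h"
      using norm_shifted_hankel_le[OF sobolev_diff[OF C'(1) wh(1)], of "r n" h] by simp
    then have "norm h \<le> \<bar>D\<bar> * (2 * sobolev_norm (1/2) (v (r n) - w) * norm h)"
      by (intro order_trans[OF D[OF h]] mult_mono) auto
    also have "\<dots> = (\<bar>D\<bar> * (2 * sobolev_norm (1/2) (v (r n) - w))) * norm h" by simp
    finally have "(1 - \<bar>D\<bar> * (2 * sobolev_norm (1/2) (v (r n) - w))) * norm h \<le> 0" by (simp add: algebra_simps)
    then show "h = 0" using n by (simp add: mult_le_0_iff)
  qed
  then show False using w(2) by simp
qed

theorem proposition1p2:
  fixes d :: nat and v :: "nat \<Rightarrow> hardy"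
  assumes "\<And>n. v n \<in> rank_class d"
    and "sobolev_bounded (1/2) v"
    and "\<And>m n. spectrum (shifted_hankel (v m) \<circ> shifted_hankel (v m))
             = spectrum (shifted_hankel (v n) \<circ> shifted_hankel (v n))"
  shows "((\<exists>s\<^sub>0>1/2. \<not> sobolev_bounded s\<^sub>0 v) \<longleftrightarrow> (\<forall>s>1/2. \<not> sobolev_bounded s v))
    \<and> ((\<forall>s>1/2. \<not> sobolev_bounded s v) \<longleftrightarrow>
        (\<exists>r d' v_bad. strict_mono r \<and> v_bad \<in> rank_class d' \<and>
           (if even d then d' + 1 \<le> d else d' + 2 \<le> d) \<and>
           sobolev_weakly_converges (1/2) (\<lambda>k. v (r k)) v_bad))"
    (is "(?i \<longleftrightarrow> ?ii) \<and> (?ii \<longleftrightarrow> ?iii)")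
proof -
  \<comment> \<open>With \<open>N = d div 2\<close>, the condition reads \<open>d' < 2 * N\<close>
    for both parities of \<open>d\<close>.\<close>
  have drop: "(if even d then d' + 1 \<le> d else d' + 2 \<le> d) \<longleftrightarrow> d' div 2 < d div 2" for d'
    by (cases "even d") (auto elim!: evenE oddE)
  \<comment> \<open>A single exponent produces the bad limit, and the bad limit rules out every
    exponent; this closes the circle between (i) and (ii).\<close>
  have "?ii" if "?iii"
    using that unfolding drop using unbounded_of_rank_drop[OF assms] by blast
  moreover have "?iii" if "?i"
    using that unfolding drop using weak_limit_of_unbounded[OF assms(1,2)] by blast
  moreover have "?i" if "?ii"
    using that by (intro exI[of _ 1]) auto
  ultimately show ?thesis by blast
qed

end
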